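(* Let $\Sigma=(X,\sigma)$ be a topological dynamical system and let $\tilde\pi=\pi\times u$ be a representation of $C^*(\Sigma)$ on a Hilbert space. If the family $\Phi'(\tilde\pi)$ is total on $\tilde\pi(C^*(\Sigma))$, then the algebra $\pi(C(X))'$ has the intersection property for ideals of $\tilde\pi(C^*(\Sigma))$; that is, $J\cap\pi(C(X))'\neq\{0\}$ for every non-zero two-sided ideal $J$ of $\tilde\pi(C^*(\Sigma))$, not necessarily closed or self-adjoint.
   Context: A topological dynamical system $\Sigma=(X,\sigma)$ consists of a compact Hausdorff space $X$ and a homeomorphism $\sigma$ of $X$. $C^*(\Sigma)=C(X)\rtimes_\alpha\mathbb{Z}$ is the $C^*$-crossed product for the automorphism $\alpha(f)=f\circ\sigma^{-1}$ of $C(X)$; it is generated by a copy of $C(X)$ and a canonical unitary $\delta$ with $\delta f\delta^*=\alpha(f)$. A representation $\tilde\pi=\pi\times u$ of $C^*(\Sigma)$ is a unital $*$-homomorphism into the bounded operators on a Hilbert space; $\pi$ is its restriction to $C(X)$ and $u=\tilde\pi(\delta)$. $\pi(C(X))'=\{\tilde\pi(a)\in\tilde\pi(C^*(\Sigma)): \tilde\pi(af)=\tilde\pi(fa)\text{ for all }f\in C(X)\}$. This is a commutative $C^*$-algebra, invariant under $\operatorname{Ad}u(b)=ubu^*$ and its inverse. $\Gamma(\tilde\pi)$ denotes its spectrum (character space), and $\sigma(\tilde\pi)$ denotes the homeomorphism of $\Gamma(\tilde\pi)$ induced by $\operatorname{Ad}u$, i.e. $\operatorname{Ad}u(F)=F\circ\sigma(\tilde\pi)^{-1}$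 for $F\in C(\Gamma(\tilde\pi))\cong\pi(C(X))'$. For a homeomorphism $\tau$ of a compact Hausdorff space $Y$: $\operatorname{Per}^\infty(\tau)$ is the set of aperiodic (non-periodic) points; for $k\ge1$, $\operatorname{Per}_k(\tau)$ is the set of points with least period exactly $k$; and $\operatorname{PIP}(\tau)$ is the set of periodic interior points, i.e. the union over $k\ge 1$ of the interiors (in $Y$) of the sets $\operatorname{Per}_k(\tau)$. $\Phi'(\tilde\pi)$ is the set of all pure states of $\tilde\pi(C^*(\Sigma))$ that extend an element of $\operatorname{Per}^\infty(\sigma(\tilde\pi))\cup\operatorname{PIP}(\sigma(\tilde\pi))\subseteq\Gamma(\tilde\pi)$. A family of states of a $C^*$-algebra $A$ is total if the only positive element of $A$ on which every state of the family vanishes is $0$. *)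

theory Defs
  imports "HOL-Analysis.Analysis"
begin

section \<open>Complex Hilbert spaces and unital C*-algebras as type classes\<close>

class scaleC =
  fixes scaleC :: "complex \<Rightarrow> 'a \<Rightarrow> 'a"  (infixr \<open>*\<^sub>C\<close> 75)

class complex_vector = real_vector + scaleC +
  assumes scaleC_add_right: "a *\<^sub>C (x + y) = a *\<^sub>C x + a *\<^sub>C y"
    and scaleC_add_left: "(a + b) *\<^sub>C x = a *\<^sub>C x + b *\<^sub>C x"
    and scaleC_scaleC: "a *\<^sub>C b *\<^sub>C x = (a * b) *\<^sub>C x"
    and scaleC_of_real: "of_real r *\<^sub>C x = r *\<^sub>R x"

text \<open>The norm is the one determined by the real inner product, the real part of \<open>cinner\<close>.
  The zero space is allowed.\<close>

class chilbert_space = complex_vector + real_inner + complete_space +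
  fixes cinner :: "'a \<Rightarrow> 'a \<Rightarrow> complex"
  assumes cinner_commute: "cinner x y = cnj (cinner y x)"
    and cinner_add_left: "cinner (x + y) z = cinner x z + cinner y z"
    and cinner_scaleC_left: "cinner (a *\<^sub>C x) y = a * cinner x y"
    and Re_cinner: "Re (cinner x y) = inner x y"

class star =
  fixes star :: "'a \<Rightarrow> 'a"

instance chilbert_space \<subseteq> banach ..

text \<open>\<open>monoid_mult\<close> instead of \<open>ring_1\<close>: the zero algebra is allowed.\<close>

class star_algebra = complex_vector + real_algebra + monoid_mult + star +
  assumes scaleC_mult_left: "(a *\<^sub>C x) * y = a *\<^sub>C (x * y)"
    and scaleC_mult_right: "x * (a *\<^sub>C y) = a *\<^sub>C (x * y)"
    and star_star: "star (star x) = x"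
    and star_add: "star (x + y) = star x + star y"
    and star_scaleC: "star (a *\<^sub>C x) = cnj a *\<^sub>C star x"
    and star_mult: "star (x * y) = star y * star x"

class cstar_algebra = star_algebra + real_normed_algebra + complete_space +
  assumes norm_scaleC: "norm (a *\<^sub>C x) = cmod a * norm x"
    and cstar_identity: "norm (star x * x) = (norm x)\<^sup>2"

instance cstar_algebra \<subseteq> banach ..

lemma scaleC_one [simp]: "1 *\<^sub>C (x :: 'a::complex_vector) = x"
  using scaleC_of_real[of 1 x] by simp

lemma scaleC_zero_left [simp]: "0 *\<^sub>C (x :: 'a::complex_vector) = 0"
  using scaleC_of_real[of 0 x] by simp

lemma scaleC_zero_right [simp]: "a *\<^sub>C (0 :: 'a::complex_vector) = 0"
  using scaleC_add_right[of a 0 0] by simp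

lemma cinner_scaleC_right: "cinner x (a *\<^sub>C y) = cnj a * cinner x y"
  by (metis cinner_commute cinner_scaleC_left complex_cnj_mult)

lemma cinner_eq_inner:
  "cinner x y = Complex (inner x y) (inner x (\<i> *\<^sub>C y))"
  by (simp add: complex_eq_iff Re_cinner[symmetric] cinner_scaleC_right)

lemma norm_scaleC_hilbert: "norm (a *\<^sub>C (x :: 'a::chilbert_space)) = cmod a * norm x"
proof -
  have *: "cinner (a *\<^sub>C x) (a *\<^sub>C x) = of_real ((cmod a)\<^sup>2) * cinner x x"
    unfolding cinner_scaleC_left cinner_scaleC_right complex_norm_square by (simp add: algebra_simps)
  have "inner (a *\<^sub>C x) (a *\<^sub>C x) = (cmod a)\<^sup>2 * inner x x"
    unfolding Re_cinner[symmetric] * by simp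
  then show ?thesis
    by (simp add: norm_eq_sqrt_inner real_sqrt_mult)
qed

instantiation complex :: cstar_algebra
begin

definition scaleC_complex :: "complex \<Rightarrow> complex \<Rightarrow> complex" where
  "scaleC_complex a x = a * x"

definition star_complex :: "complex \<Rightarrow> complex" where
  "star_complex = cnj"

instance
  by standard
    (auto simp: scaleC_complex_def star_complex_def algebra_simps scaleR_conv_of_real
      norm_mult power2_eq_square)

end

lemma norm_star: "norm (star x) = norm (x :: 'a::cstar_algebra)"
proof -
  have le: "norm y \<le> norm (star y)" for y :: 'a
  proof (cases "norm y = 0")
    case False
    have "norm y * norm y \<le> norm (star y) * norm y"
      using cstar_identity[of y] norm_mult_ineq[of "star y" y] by (simp add: power2_eq_square)
    with False show ?thesis by simp
  qed simp
  show ?thesis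
    using le[of x] le[of "star x"] by (simp add: star_star)
qed

lemma bounded_linear_scaleC:
  assumes "\<And>x :: 'a::{complex_vector, real_normed_vector}. norm (a *\<^sub>C x) = cmod a * norm x"
  shows "bounded_linear (\<lambda>x::'a. a *\<^sub>C x)"
  by (rule bounded_linear_intro[of _ "cmod a"])
    (simp_all add: scaleC_add_right assms scaleC_scaleC scaleC_of_real[symmetric] mult.commute)

lemma bounded_linear_star: "bounded_linear (star :: 'a::cstar_algebra \<Rightarrow> 'a)"
  by (rule bounded_linear_intro[of _ 1])
    (simp_all add: star_add norm_star star_scaleC scaleC_of_real[symmetric])

unbundle bcontfun.lifting

instantiation bcontfun :: (topological_space, cstar_algebra) star_algebra
begin

lift_definition one_bcontfun :: "'a \<Rightarrow>\<^sub>C 'b" is "\<lambda>_. 1"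
  by (rule const_bcontfun)

lift_definition times_bcontfun :: "('a \<Rightarrow>\<^sub>C 'b) \<Rightarrow> ('a \<Rightarrow>\<^sub>C 'b) \<Rightarrow> 'a \<Rightarrow>\<^sub>C 'b" is "\<lambda>f g x. f x * g x"
proof -
  fix f g :: "'a \<Rightarrow> 'b"
  assume "f \<in> bcontfun" "g \<in> bcontfun"
  then have c: "continuous_on UNIV f" "continuous_on UNIV g"
    and "bounded (range f)" "bounded (range g)"
    by (auto simp: bcontfun_def)
  then obtain M N where "\<And>x. norm (f x) \<le> M" "\<And>x. norm (g x) \<le> N"
    by (auto simp: bounded_iff)
  then have "norm (f x * g x) \<le> M * N" for x
    by (meson mult_mono norm_ge_zero norm_mult_ineq order_trans)
  then show "(\<lambda>x. f x * g x) \<in> bcontfun"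
    using c by (intro bcontfun_normI continuous_intros) auto
qed

lift_definition scaleC_bcontfun :: "complex \<Rightarrow> ('a \<Rightarrow>\<^sub>C 'b) \<Rightarrow> 'a \<Rightarrow>\<^sub>C 'b" is "\<lambda>a f x. a *\<^sub>C f x"
proof -
  fix a :: complex and f :: "'a \<Rightarrow> 'b"
  assume "f \<in> bcontfun"
  then have "continuous_on UNIV f" "bounded (range f)"
    by (auto simp: bcontfun_def)
  then show "(\<lambda>x. a *\<^sub>C f x) \<in> bcontfun"
    using bounded_linear.continuous_on[OF bounded_linear_scaleC[OF norm_scaleC]]
      bounded_linear_image[OF _ bounded_linear_scaleC[OF norm_scaleC], of "range f" a]
    by (auto simp: bcontfun_def image_image)
qed

lift_definition star_bcontfun :: "('a \<Rightarrow>\<^sub>C 'b) \<Rightarrow> 'a \<Rightarrow>\<^sub>C 'b" is "\<lambda>f x. star (f x)"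
proof -
  fix f :: "'a \<Rightarrow> 'b"
  assume "f \<in> bcontfun"
  then have "continuous_on UNIV f" "bounded (range f)"
    by (auto simp: bcontfun_def)
  then show "(\<lambda>x. star (f x)) \<in> bcontfun"
    using bounded_linear.continuous_on[OF bounded_linear_star]
      bounded_linear_image[OF _ bounded_linear_star, of "range f"]
    by (auto simp: bcontfun_def image_image)
qed

instance
  by standard
    (transfer; simp add: fun_eq_iff scaleC_add_right scaleC_add_left scaleC_scaleC scaleC_of_real
      scaleC_mult_left scaleC_mult_right star_star star_add star_scaleC star_mult algebra_simps)+

end


section \<open>Bounded operators on a complex Hilbert space\<close>

lemma riesz_real:
  fixes f :: "'h::{real_inner, complete_space} \<Rightarrow> real"
  assumes f: "bounded_linear f"
  obtains y where "\<And>x. f x = inner x y"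
proof -
  interpret f: bounded_linear f by fact
  define g where "g x = inner x x - 2 * f x" for x
  obtain K where K: "\<And>x. \<bar>f x\<bar> \<le> norm x * K"
    using f.bounded by auto
  have lower: "- K\<^sup>2 \<le> g x" for x
  proof -
    have "0 \<le> (norm x - K)\<^sup>2" by simp
    also have "\<dots> = inner x x - 2 * (norm x * K) + K\<^sup>2"
      by (simp add: power2_diff power2_norm_eq_inner)
    finally show ?thesis using K[of x] unfolding g_def by linarith
  qed
  define m where "m = Inf (range g)"
  have bdd: "bdd_below (range g)"
    using lower by (auto intro!: bdd_belowI)
  have m_le: "m \<le> g x" for x
    unfolding m_def by (rule cInf_lower[OF _ bdd]) simp
  have par: "(norm (x - y))\<^sup>2 = 2 * g x + 2 * g y - 4 * g ((1/2) *\<^sub>R (x + y))" for x y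
    by (simp add: g_def power2_norm_eq_inner inner_add_left inner_add_right inner_diff_left
        inner_diff_right f.scaleR f.add inner_commute field_simps)
  have "\<exists>x. g x < m + 1 / real (Suc n)" for n
  proof -
    have "Inf (range g) < m + 1 / real (Suc n)" by (simp add: m_def)
    then show ?thesis using cInf_lessD[of "range g"] by blast
  qed
  then obtain s where s: "\<And>n. g (s n) < m + 1 / real (Suc n)" by metis
  have "Cauchy s"
  proof (rule metric_CauchyI)
    fix e :: real assume e: "e > 0"
    obtain N where N: "1 / real (Suc N) < e\<^sup>2 / 4"
      using nat_approx_posE[of "e\<^sup>2/4"] e by auto
    have "dist (s i) (s j) < e" if "i \<ge> N" "j \<ge> N" for i j
    proof -
      have le: "1 / real (Suc i) \<le> 1 / real (Suc N)" "1 / real (Suc j) \<le> 1 / real (Suc N)"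
        using that by (auto simp: field_simps)
      have "(norm (s i - s j))\<^sup>2 < e\<^sup>2"
        using par[of "s i" "s j"] s[of i] s[of j] m_le[of "(1/2) *\<^sub>R (s i + s j)"] N le by linarith
      then show ?thesis
        using e by (simp add: dist_norm power2_less_imp_less)
    qed
    then show "\<exists>N. \<forall>i\<ge>N. \<forall>j\<ge>N. dist (s i) (s j) < e" by blast
  qed
  then obtain y where y: "s \<longlonglongrightarrow> y"
    using Cauchy_convergent_iff convergent_def by blast
  have "(\<lambda>n. g (s n)) \<longlonglongrightarrow> g y"
    unfolding g_def by (intro tendsto_intros f.tendsto y)
  moreover have "(\<lambda>n. m + 1 / real (Suc n)) \<longlonglongrightarrow> m + 0"
    by (intro tendsto_intros LIMSEQ_Suc[OF lim_1_over_n])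
  ultimately have "g y \<le> m + 0"
    by (rule LIMSEQ_le) (meson less_imp_le s)
  then have min: "g y \<le> g x" for x using m_le[of x] by simp
  have "f x = inner x y" for x
  proof (rule ccontr)
    define d where "d = inner x y - f x"
    assume "f x \<noteq> inner x y"
    then have d: "d \<noteq> 0" by (simp add: d_def)
    define q where "q = inner x x + 1"
    have q: "q > 0" by (simp add: q_def add_nonneg_pos)
    define t where "t = - (d / q)"
    have "g (y + t *\<^sub>R x) = g y + 2 * t * d + t\<^sup>2 * inner x x"
      by (simp add: g_def d_def f.add f.scaleR inner_add_left inner_add_right inner_commute
          power2_eq_square algebra_simps)
    then have "0 \<le> 2 * t * d + t\<^sup>2 * inner x x" using min[of "y + t *\<^sub>R x"] by simp
    also have "\<dots> \<le> 2 * t * d + t\<^sup>2 * q" by (simp add: q_def mult_left_mono)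
    also have "\<dots> = - (d\<^sup>2 / q)"
      using q by (simp add: t_def power2_eq_square field_simps)
    also have "\<dots> < 0" using d q by simp
    finally show False by simp
  qed
  then show ?thesis using that by blast
qed

typedef (overloaded) 'h bounded_op =
  "{T :: 'h::chilbert_space \<Rightarrow>\<^sub>L 'h. \<forall>a x. blinfun_apply T (a *\<^sub>C x) = a *\<^sub>C blinfun_apply T x}"
  by (rule exI[of _ 0]) (simp add: zero_blinfun.rep_eq)

setup_lifting type_definition_bounded_op

lift_definition op_apply :: "'h::chilbert_space bounded_op \<Rightarrow> 'h \<Rightarrow> 'h" is blinfun_apply .

lemma op_eqI: "(\<And>x. op_apply S x = op_apply T x) \<Longrightarrow> S = T"
  by transfer (rule blinfun_eqI)

lemma op_apply_scaleC: "op_apply T (a *\<^sub>C x) = a *\<^sub>C op_apply T x"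
  by transfer simp

lemma bounded_linear_op_apply: "bounded_linear (op_apply T)"
  by transfer (rule blinfun.bounded_linear_right)

instantiation bounded_op :: (chilbert_space) real_normed_vector
begin

lift_definition norm_bounded_op :: "'a bounded_op \<Rightarrow> real" is norm .

lift_definition zero_bounded_op :: "'a bounded_op" is 0
  by simp

lift_definition plus_bounded_op :: "'a bounded_op \<Rightarrow> 'a bounded_op \<Rightarrow> 'a bounded_op" is "(+)"
  by (simp add: blinfun.add_left scaleC_add_right)

lift_definition uminus_bounded_op :: "'a bounded_op \<Rightarrow> 'a bounded_op" is uminus
  by (metis (no_types, lifting) add_eq_0_iff blinfun.minus_left scaleC_add_right scaleC_zero_right)

lift_definition minus_bounded_op :: "'a bounded_op \<Rightarrow> 'a bounded_op \<Rightarrow> 'a bounded_op" is "(-)"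
  by (metis (no_types, lifting) add_diff_cancel blinfun.diff_left diff_add_cancel scaleC_add_right)

lift_definition scaleR_bounded_op :: "real \<Rightarrow> 'a bounded_op \<Rightarrow> 'a bounded_op" is scaleR
  by (simp add: blinfun.scaleR_left scaleC_of_real[symmetric] scaleC_scaleC mult.commute)

definition dist_bounded_op :: "'a bounded_op \<Rightarrow> 'a bounded_op \<Rightarrow> real" where
  "dist_bounded_op S T = norm (S - T)"

definition sgn_bounded_op :: "'a bounded_op \<Rightarrow> 'a bounded_op" where
  "sgn_bounded_op T = scaleR (inverse (norm T)) T"

definition uniformity_bounded_op :: "('a bounded_op \<times> 'a bounded_op) filter" where
  "uniformity_bounded_op = (INF e\<in>{0 <..}. principal {(x, y). dist x y < e})"

definition open_bounded_op :: "'a bounded_op set \<Rightarrow> bool" where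
  "open_bounded_op U = (\<forall>x\<in>U. eventually (\<lambda>(x', y). x' = x \<longrightarrow> y \<in> U) uniformity)"

instance
  by standard
    ((simp only: dist_bounded_op_def sgn_bounded_op_def uniformity_bounded_op_def
        open_bounded_op_def)
    | (transfer; simp add: algebra_simps norm_triangle_ineq))+

end

lemma op_zero: "op_apply 0 x = 0"
  by transfer simp

lemma op_add: "op_apply (S + T) x = op_apply S x + op_apply T x"
  by transfer (simp add: blinfun.add_left)

lemma op_diff: "op_apply (S - T) x = op_apply S x - op_apply T x"
  by transfer (simp add: blinfun.diff_left)

lemma op_scaleR: "op_apply (r *\<^sub>R T) x = r *\<^sub>R op_apply T x"
  by transfer (simp add: blinfun.scaleR_left)

lemma norm_op_apply: "norm (op_apply T x) \<le> norm T * norm x"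
  by transfer (rule norm_blinfun)

lemma norm_op_bound: "0 \<le> b \<Longrightarrow> (\<And>x. norm (op_apply T x) \<le> b * norm x) \<Longrightarrow> norm T \<le> b"
  by transfer (rule norm_blinfun_bound)

instance bounded_op :: (chilbert_space) complete_space
proof
  fix X :: "nat \<Rightarrow> 'a bounded_op"
  assume X: "Cauchy X"
  have rep: "Rep_bounded_op (S - T) = Rep_bounded_op S - Rep_bounded_op T" for S T :: "'a bounded_op"
    by transfer simp
  have nrm: "norm (Rep_bounded_op S) = norm S" for S :: "'a bounded_op"
    by transfer simp
  have "Cauchy (\<lambda>n. Rep_bounded_op (X n))"
    using X by (simp add: Cauchy_def dist_norm rep[symmetric] nrm)
  then obtain L where L: "(\<lambda>n. Rep_bounded_op (X n)) \<longlonglongrightarrow> L"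
    using Cauchy_convergent[of "\<lambda>n. Rep_bounded_op (X n)"] unfolding convergent_def by metis
  have lim: "(\<lambda>n. Rep_bounded_op (X n) x) \<longlonglongrightarrow> L x" for x
    by (intro tendsto_intros L)
  have "L (a *\<^sub>C x) = a *\<^sub>C L x" for a x
  proof (rule LIMSEQ_unique[OF lim])
    have "(\<lambda>n. a *\<^sub>C Rep_bounded_op (X n) x) \<longlonglongrightarrow> a *\<^sub>C L x"
      by (rule bounded_linear.tendsto[OF bounded_linear_scaleC[OF norm_scaleC_hilbert] lim])
    then show "(\<lambda>n. Rep_bounded_op (X n) (a *\<^sub>C x)) \<longlonglongrightarrow> a *\<^sub>C L x"
      using Rep_bounded_op[of "X _"] by simp
  qed
  then have "Rep_bounded_op (Abs_bounded_op L) = L"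
    by (intro Abs_bounded_op_inverse) simp
  then have "X \<longlonglongrightarrow> Abs_bounded_op L"
    using L by (simp add: LIMSEQ_def dist_norm nrm[symmetric] rep)
  then show "convergent X" by (auto simp: convergent_def)
qed

lemma ex_adjoint:
  fixes T :: "'h::chilbert_space bounded_op"
  shows "\<exists>S. \<forall>x y. cinner (op_apply T x) y = cinner x (op_apply S y)"
proof -
  interpret T: bounded_linear "op_apply T" by (rule bounded_linear_op_apply)
  have "\<exists>z. \<forall>x. inner (op_apply T x) y = inner x z" for y
    using riesz_real[of "\<lambda>x. inner (op_apply T x) y"]
      bounded_linear_compose[OF bounded_linear_inner_left T.bounded_linear_axioms] by metis
  then obtain S where S: "\<And>x y. inner (op_apply T x) y = inner x (S y)" by metis
  have Sc: "cinner (op_apply T x) y = cinner x (S y)" for x y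
  proof (rule complex_eqI)
    show "Re (cinner (op_apply T x) y) = Re (cinner x (S y))" by (simp add: Re_cinner S)
    have "Re (cinner (op_apply T (\<i> *\<^sub>C x)) y) = Re (cinner (\<i> *\<^sub>C x) (S y))"
      by (simp add: Re_cinner S)
    then show "Im (cinner (op_apply T x) y) = Im (cinner x (S y))"
      by (simp add: op_apply_scaleC cinner_scaleC_left)
  qed
  have eqI: "u = v" if "\<And>x. inner x u = inner x v" for u v :: 'h
    by (rule iffD1[OF vector_eq_ldot], rule allI, rule that)
  have ceqI: "u = v" if "\<And>x. cinner x u = cinner x v" for u v :: 'h
    using that eqI by (metis Re_cinner)
  have add: "S (x + y) = S x + S y" for x y
    by (rule eqI) (simp add: S[symmetric] inner_add_right)
  have scC: "S (a *\<^sub>C x) = a *\<^sub>C S x" for a x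
    by (rule ceqI) (simp add: Sc[symmetric] cinner_scaleC_right)
  have scR: "S (r *\<^sub>R x) = r *\<^sub>R S x" for r x
    using scC[of "of_real r"] by (simp add: scaleC_of_real)
  have bnd: "norm (S y) \<le> norm y * norm T" for y
  proof (cases "S y = 0")
    case False
    have "norm (S y) * norm (S y) = inner (op_apply T (S y)) y"
      by (simp add: S power2_norm_eq_inner[symmetric] power2_eq_square)
    also have "\<dots> \<le> norm (op_apply T (S y)) * norm y" by (rule norm_cauchy_schwarz)
    also have "\<dots> \<le> (norm T * norm (S y)) * norm y"
      by (intro mult_right_mono norm_op_apply) simp
    finally show ?thesis using False by (simp add: mult_ac)
  qed simp
  have bl: "bounded_linear S"
    by (rule bounded_linear_intro[OF add scR bnd])
  have "op_apply (Abs_bounded_op (Blinfun S)) = S"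
    by (simp add: op_apply.rep_eq Abs_bounded_op_inverse bounded_linear_Blinfun_apply bl scC)
  with Sc show ?thesis by (metis (no_types))
qed

instantiation bounded_op :: (chilbert_space) cstar_algebra
begin

lift_definition one_bounded_op :: "'a bounded_op" is id_blinfun
  by simp

lift_definition times_bounded_op :: "'a bounded_op \<Rightarrow> 'a bounded_op \<Rightarrow> 'a bounded_op" is "(o\<^sub>L)"
  by simp

lift_definition scaleC_bounded_op :: "complex \<Rightarrow> 'a bounded_op \<Rightarrow> 'a bounded_op" is
  "\<lambda>a T. blinfun_compose (Blinfun (\<lambda>x. a *\<^sub>C x)) T"
  by (simp add: bounded_linear_Blinfun_apply bounded_linear_scaleC norm_scaleC_hilbert
      scaleC_scaleC mult.commute)

definition star_bounded_op :: "'a bounded_op \<Rightarrow> 'a bounded_op" where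
  "star_bounded_op T = (THE S. \<forall>x y. cinner (op_apply T x) y = cinner x (op_apply S y))"

lemma op_one: "op_apply 1 x = (x :: 'a)"
  by transfer simp

lemma op_mult: "op_apply (S * T) x = op_apply S (op_apply T (x :: 'a))"
  by transfer simp

lemma op_scaleC: "op_apply (a *\<^sub>C T) x = a *\<^sub>C op_apply T (x :: 'a)"
  by transfer (simp add: bounded_linear_Blinfun_apply bounded_linear_scaleC norm_scaleC_hilbert)

lemma op_star_unique:
  fixes S T :: "'a bounded_op"
  assumes "\<And>x y. cinner (op_apply T x) y = cinner x (op_apply S y)"
  shows "star T = S"
  unfolding star_bounded_op_def
proof (rule the_equality)
  fix R assume R: "\<forall>x y. cinner (op_apply T x) y = cinner x (op_apply R y)"
  show "R = S"
  proof (rule op_eqI)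
    fix y
    have "inner x (op_apply R y) = inner x (op_apply S y)" for x
      using R assms by (metis Re_cinner)
    then have "\<forall>x. inner x (op_apply R y) = inner x (op_apply S y)" ..
    then show "op_apply R y = op_apply S y" by (rule iffD1[OF vector_eq_ldot])
  qed
qed (use assms in blast)

lemma cinner_star: "cinner (op_apply T x) y = cinner x (op_apply (star T) (y :: 'a))"
  using ex_adjoint[of T] op_star_unique by metis

lemma cinner_star': "cinner (op_apply (star T) x) y = cinner x (op_apply T (y :: 'a))"
  using cinner_star[of T y x] by (metis cinner_commute)

instance
proof
  fix a b :: complex and r :: real and S T U :: "'a bounded_op"
  note op = op_add op_scaleR op_mult op_scaleC op_one op_apply_scaleC
    linear_simps[OF bounded_linear_op_apply]
  show "a *\<^sub>C (S + T) = a *\<^sub>C S + a *\<^sub>C T" "(a + b) *\<^sub>C S = a *\<^sub>C S + b *\<^sub>C S"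
    "a *\<^sub>C b *\<^sub>C S = (a * b) *\<^sub>C S" "of_real r *\<^sub>C S = r *\<^sub>R S"
    "(a *\<^sub>C S) * T = a *\<^sub>C (S * T)" "S * (a *\<^sub>C T) = a *\<^sub>C (S * T)"
    "(S * T) * U = S * (T * U)" "(S + T) * U = S * U + T * U" "S * (T + U) = S * T + S * U"
    "(r *\<^sub>R S) * T = r *\<^sub>R (S * T)" "S * (r *\<^sub>R T) = r *\<^sub>R (S * T)" "1 * S = S" "S * 1 = S"
    by (rule op_eqI, simp add: op scaleC_add_right scaleC_add_left scaleC_scaleC scaleC_of_real)+
  show "star (star S) = S"
    by (rule op_star_unique) (rule cinner_star')
  have add_right: "cinner (x::'a) (y + z) = cinner x y + cinner x z" for x y z
    by (metis cinner_add_left cinner_commute complex_cnj_add)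
  show "star (S + T) = star S + star T"
    by (rule op_star_unique) (simp add: op add_right cinner_add_left cinner_star)
  show "star (a *\<^sub>C S) = cnj a *\<^sub>C star S"
    by (rule op_star_unique) (simp add: op cinner_scaleC_left cinner_scaleC_right cinner_star)
  show "star (S * T) = star T * star S"
    by (rule op_star_unique) (simp add: op cinner_star)
  have mult_le: "norm (S * T) \<le> norm S * norm T" for S T :: "'a bounded_op"
    by transfer (rule norm_blinfun_compose)
  show "norm (S * T) \<le> norm S * norm T" by (rule mult_le)
  have sc_le: "norm (a *\<^sub>C S) \<le> cmod a * norm S" for a and S :: "'a bounded_op"
    by (rule norm_op_bound)
      (auto simp: op_scaleC norm_scaleC_hilbert mult.assoc intro!: mult_left_mono norm_op_apply)
  show "norm (a *\<^sub>C S) = cmod a * norm S"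
  proof (cases "a = 0")
    case False
    have one: "inverse a *\<^sub>C a *\<^sub>C S = S"
      by (rule op_eqI) (simp add: op_scaleC scaleC_scaleC False)
    have "norm S \<le> inverse (cmod a) * norm (a *\<^sub>C S)"
      using sc_le[of "inverse a" "a *\<^sub>C S"] unfolding one by (simp add: norm_inverse)
    then have "cmod a * norm S \<le> norm (a *\<^sub>C S)"
      using False by (simp add: field_simps)
    with sc_le[of a S] show ?thesis by simp
  next
    case True
    then have "norm (a *\<^sub>C S) \<le> 0" using sc_le[of a S] by simp
    then show ?thesis using True by simp
  qed
  have sq: "(norm (op_apply S x))\<^sup>2 \<le> norm (star S * S) * (norm x)\<^sup>2" for S :: "'a bounded_op" and x
  proof -
    have "(norm (op_apply S x))\<^sup>2 = Re (cinner x (op_apply (star S * S) x))"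
      by (simp add: power2_norm_eq_inner Re_cinner[symmetric] cinner_star op_mult)
    also have "\<dots> \<le> norm x * norm (op_apply (star S * S) x)"
      unfolding Re_cinner by (rule norm_cauchy_schwarz)
    also have "\<dots> \<le> norm x * (norm (star S * S) * norm x)"
      by (intro mult_left_mono norm_op_apply) simp
    finally show ?thesis by (simp add: power2_eq_square mult_ac)
  qed
  have lower: "(norm S)\<^sup>2 \<le> norm (star S * S)" for S :: "'a bounded_op"
  proof -
    have "norm (op_apply S x) \<le> sqrt (norm (star S * S)) * norm x" for x
      using sq[of S x] by (metis norm_ge_zero real_le_rsqrt real_sqrt_abs2 real_sqrt_mult
          real_sqrt_mult_self abs_norm_cancel power2_eq_square)
    then have "norm S \<le> sqrt (norm (star S * S))"
      by (intro norm_op_bound) auto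
    then show ?thesis using norm_ge_zero power_mono real_sqrt_pow2 by (metis)
  qed
  have le: "norm S \<le> norm (star S)" for S :: "'a bounded_op"
  proof (cases "norm S = 0")
    case False
    have "norm S * norm S \<le> norm (star S) * norm S"
      using lower[of S] mult_le[of "star S" S] by (simp add: power2_eq_square)
    with False show ?thesis by simp
  qed simp
  have "norm (star S) \<le> norm S"
    using le[of "star S"] \<open>star (star S) = S\<close> by simp
  then have "norm (star S * S) \<le> (norm S)\<^sup>2"
    using mult_le[of "star S" S] by (simp add: power2_eq_square mult_mono order_trans
        mult_right_mono)
  then show "norm (star S * S) = (norm S)\<^sup>2" using lower[of S] by simp
qed

end

section \<open>Subalgebras, homomorphisms, ideals, states, characters\<close>

definition star_subalgebra :: "'a::star_algebra set \<Rightarrow> bool" where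
  "star_subalgebra A \<longleftrightarrow>
     1 \<in> A \<and> (\<forall>x\<in>A. \<forall>y\<in>A. x + y \<in> A \<and> x * y \<in> A) \<and> (\<forall>c. \<forall>x\<in>A. c *\<^sub>C x \<in> A) \<and> (\<forall>x\<in>A. star x \<in> A)"

definition cstar_generated :: "'a::cstar_algebra set \<Rightarrow> 'a set" where
  "cstar_generated G = \<Inter>{A. star_subalgebra A \<and> closed A \<and> G \<subseteq> A}"

definition unital_star_hom :: "'a::star_algebra set \<Rightarrow> ('a \<Rightarrow> 'b::star_algebra) \<Rightarrow> bool" where
  "unital_star_hom A h \<longleftrightarrow>
     h 1 = 1 \<and> (\<forall>x\<in>A. \<forall>y\<in>A. h (x + y) = h x + h y \<and> h (x * y) = h x * h y) \<and>
     (\<forall>c. \<forall>x\<in>A. h (c *\<^sub>C x) = c *\<^sub>C h x) \<and> (\<forall>x\<in>A. h (star x) = star (h x))"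

definition two_sided_ideal :: "'a::star_algebra set \<Rightarrow> 'a set \<Rightarrow> bool" where
  "two_sided_ideal A J \<longleftrightarrow>
     J \<subseteq> A \<and> 0 \<in> J \<and> (\<forall>x\<in>J. \<forall>y\<in>J. x + y \<in> J) \<and> (\<forall>c. \<forall>x\<in>J. c *\<^sub>C x \<in> J) \<and>
     (\<forall>x\<in>J. \<forall>a\<in>A. a * x \<in> J \<and> x * a \<in> J)"

definition intersection_property :: "'a::star_algebra set \<Rightarrow> 'a set \<Rightarrow> bool" where
  "intersection_property A B \<longleftrightarrow> (\<forall>J. two_sided_ideal A J \<and> J \<noteq> {0} \<longrightarrow> J \<inter> B \<noteq> {0})"

definition positive_elements :: "'a::star_algebra set \<Rightarrow> 'a set" where
  "positive_elements A = {star x * x |x. x \<in> A}"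

text \<open>Functionals on a subalgebra \<open>A\<close> are made \<^const>\<open>extensional\<close>, so that equality of
  functions is equality on \<open>A\<close>.\<close>

definition linear_functional :: "'a::star_algebra set \<Rightarrow> ('a \<Rightarrow> complex) \<Rightarrow> bool" where
  "linear_functional A \<phi> \<longleftrightarrow> \<phi> \<in> extensional A \<and>
     (\<forall>x\<in>A. \<forall>y\<in>A. \<phi> (x + y) = \<phi> x + \<phi> y) \<and> (\<forall>c. \<forall>x\<in>A. \<phi> (c *\<^sub>C x) = c * \<phi> x)"

definition state :: "'a::star_algebra set \<Rightarrow> ('a \<Rightarrow> complex) \<Rightarrow> bool" where
  "state A \<phi> \<longleftrightarrow> linear_functional A \<phi> \<and> (\<forall>x\<in>positive_elements A. \<phi> x \<in> \<real>\<^sub>\<ge>\<^sub>0) \<and> \<phi> 1 = 1"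

definition pure_state :: "'a::star_algebra set \<Rightarrow> ('a \<Rightarrow> complex) \<Rightarrow> bool" where
  "pure_state A \<phi> \<longleftrightarrow> state A \<phi> \<and>
     (\<forall>\<psi>1 \<psi>2 t. state A \<psi>1 \<and> state A \<psi>2 \<and> 0 < t \<and> t < 1 \<and>
        (\<forall>x\<in>A. \<phi> x = of_real (1 - t) * \<psi>1 x + of_real t * \<psi>2 x) \<longrightarrow> \<psi>1 = \<phi> \<and> \<psi>2 = \<phi>)"

definition total_family :: "'a::star_algebra set \<Rightarrow> ('a \<Rightarrow> complex) set \<Rightarrow> bool" where
  "total_family A \<Phi> \<longleftrightarrow> (\<forall>x\<in>positive_elements A. (\<forall>\<phi>\<in>\<Phi>. \<phi> x = 0) \<longrightarrow> x = 0)"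

definition characters :: "'a::star_algebra set \<Rightarrow> ('a \<Rightarrow> complex) set" where
  "characters B = {\<omega>. linear_functional B \<omega> \<and> (\<forall>x\<in>B. \<forall>y\<in>B. \<omega> (x * y) = \<omega> x * \<omega> y) \<and> (\<exists>x\<in>B. \<omega> x \<noteq> 0)}"

text \<open>The topology of pointwise convergence on \<open>B\<close>.\<close>

definition spectrum_topology :: "'a::star_algebra set \<Rightarrow> ('a \<Rightarrow> complex) topology" where
  "spectrum_topology B = subtopology (product_topology (\<lambda>_. euclidean) B) (characters B)"

lemma topspace_spectrum_topology [simp]: "topspace (spectrum_topology B) = characters B"
  by (auto simp: spectrum_topology_def characters_def linear_functional_def PiE_def)


section \<open>Periodic and aperiodic points\<close>

definition aperiodic_points :: "'y topology \<Rightarrow> ('y \<Rightarrow> 'y) \<Rightarrow> 'y set" where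
  "aperiodic_points Y \<tau> = {y \<in> topspace Y. \<forall>k\<ge>1. (\<tau> ^^ k) y \<noteq> y}"

definition points_of_period :: "'y topology \<Rightarrow> ('y \<Rightarrow> 'y) \<Rightarrow> nat \<Rightarrow> 'y set" where
  "points_of_period Y \<tau> k = {y \<in> topspace Y. (\<tau> ^^ k) y = y \<and> (\<forall>j. 1 \<le> j \<and> j < k \<longrightarrow> (\<tau> ^^ j) y \<noteq> y)}"

definition periodic_interior_points :: "'y topology \<Rightarrow> ('y \<Rightarrow> 'y) \<Rightarrow> 'y set" where
  "periodic_interior_points Y \<tau> = (\<Union>k\<in>{1..}. Y interior_of points_of_period Y \<tau> k)"


section \<open>The crossed product of \<open>C(X)\<close> by the integers\<close>

text \<open>\<open>C(X)\<close> is \<^typ>\<open>'x \<Rightarrow>\<^sub>C complex\<close>, since \<open>X\<close> will be compact.\<close>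

definition int_iterate :: "('x \<Rightarrow> 'x) \<Rightarrow> int \<Rightarrow> 'x \<Rightarrow> 'x" where
  "int_iterate \<sigma> n = (if n \<ge> 0 then \<sigma> ^^ nat n else inv \<sigma> ^^ nat (- n))"

definition unitary_power :: "'a::star_algebra \<Rightarrow> int \<Rightarrow> 'a" where
  "unitary_power u n = (if n \<ge> 0 then u ^ nat n else star u ^ nat (- n))"

definition unitary_element :: "'a::star_algebra \<Rightarrow> bool" where
  "unitary_element u \<longleftrightarrow> star u * u = 1 \<and> u * star u = 1"

text \<open>The \<open>n\<close>-th power of the automorphism \<open>f \<mapsto> f \<circ> \<sigma>\<^sup>-\<^sup>1\<close>.\<close>

definition cx_auto :: "('x::topological_space \<Rightarrow> 'x) \<Rightarrow> int \<Rightarrow> ('x \<Rightarrow>\<^sub>C complex) \<Rightarrow> ('x \<Rightarrow>\<^sub>C complex)" where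
  "cx_auto \<sigma> n f = Bcontfun (\<lambda>x. apply_bcontfun f (int_iterate \<sigma> (- n) x))"

text \<open>A finitely supported \<open>a\<close> stands for the formal sum of the \<open>a n \<delta>\<^sup>n\<close>; product and
  involution are forced by \<open>\<delta> f \<delta>\<^sup>* = f \<circ> \<sigma>\<^sup>-\<^sup>1\<close> with \<open>\<delta>\<close> unitary
  (see \<open>cp_eval_mult\<close> and \<open>cp_eval_star\<close> below).\<close>

definition cp_poly :: "(int \<Rightarrow> ('x::topological_space \<Rightarrow>\<^sub>C complex)) set" where
  "cp_poly = {a. finite {n. a n \<noteq> 0}}"

definition cp_mult :: "('x::topological_space \<Rightarrow> 'x) \<Rightarrow> (int \<Rightarrow> ('x \<Rightarrow>\<^sub>C complex)) \<Rightarrow>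
    (int \<Rightarrow> ('x \<Rightarrow>\<^sub>C complex)) \<Rightarrow> int \<Rightarrow> ('x \<Rightarrow>\<^sub>C complex)" where
  "cp_mult \<sigma> a b n = (\<Sum>k | a k \<noteq> 0. a k * cx_auto \<sigma> k (b (n - k)))"

definition cp_star :: "('x::topological_space \<Rightarrow> 'x) \<Rightarrow> (int \<Rightarrow> ('x \<Rightarrow>\<^sub>C complex)) \<Rightarrow>
    int \<Rightarrow> ('x \<Rightarrow>\<^sub>C complex)" where
  "cp_star \<sigma> a n = cx_auto \<sigma> n (star (a (- n)))"

definition cp_eval :: "(('x::topological_space \<Rightarrow>\<^sub>C complex) \<Rightarrow> 'a::star_algebra) \<Rightarrow> 'a \<Rightarrow>
    (int \<Rightarrow> ('x \<Rightarrow>\<^sub>C complex)) \<Rightarrow> 'a" where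
  "cp_eval \<iota> \<delta> a = (\<Sum>n | a n \<noteq> 0. \<iota> (a n) * unitary_power \<delta> n)"

definition cp_cstar_seminorm :: "('x::topological_space \<Rightarrow> 'x) \<Rightarrow> ((int \<Rightarrow> ('x \<Rightarrow>\<^sub>C complex)) \<Rightarrow> real) \<Rightarrow> bool" where
  "cp_cstar_seminorm \<sigma> p \<longleftrightarrow>
     (\<forall>a\<in>cp_poly. 0 \<le> p a \<and> p (cp_mult \<sigma> (cp_star \<sigma> a) a) = (p a)\<^sup>2 \<and>
        (\<forall>c. p (\<lambda>n. c *\<^sub>C a n) = cmod c * p a) \<and>
        (\<forall>b\<in>cp_poly. p (\<lambda>n. a n + b n) \<le> p a + p b \<and> p (cp_mult \<sigma> a b) \<le> p a * p b))"

definition covariant_pair :: "('x::topological_space \<Rightarrow> 'x) \<Rightarrow> (('x \<Rightarrow>\<^sub>C complex) \<Rightarrow> 'a::star_algebra) \<Rightarrow> 'a \<Rightarrow> bool" where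
  "covariant_pair \<sigma> \<iota> \<delta> \<longleftrightarrow> unital_star_hom UNIV \<iota> \<and> unitary_element \<delta> \<and>
     (\<forall>f. \<delta> * \<iota> f * star \<delta> = \<iota> (cx_auto \<sigma> 1 f))"

text \<open>\<open>A\<close>, a closed subalgebra of an ambient C*-algebra, is generated by the covariant pair
  \<open>(\<iota>, \<delta>)\<close>, and its norm is the universal one on the formal sums, i.e. the largest
  C*-seminorm (that it is one of the C*-seminorms is \<open>cp_cstar_seminorm_norm\<close> below).
  The C*-seminorms are the norms pulled back along covariant pairs with values in arbitrary
  C*-algebras; using them avoids quantifying over the types of these algebras. The carrier \<open>A\<close>
  is a subset of a type because a type cannot depend on \<open>\<sigma>\<close>.\<close>

definition is_crossed_product ::
  "('x::topological_space \<Rightarrow> 'x) \<Rightarrow> 'a::cstar_algebra set \<Rightarrow> (('x \<Rightarrow>\<^sub>C complex) \<Rightarrow> 'a) \<Rightarrow> 'a \<Rightarrow> bool" where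
  "is_crossed_product \<sigma> A \<iota> \<delta> \<longleftrightarrow> covariant_pair \<sigma> \<iota> \<delta> \<and> A = cstar_generated (insert \<delta> (range \<iota>)) \<and>
     (\<forall>p. cp_cstar_seminorm \<sigma> p \<longrightarrow> (\<forall>a\<in>cp_poly. p a \<le> norm (cp_eval \<iota> \<delta> a)))"


section \<open>Representations of the crossed product\<close>

text \<open>For \<open>\<rho> = \<pi> \<times> u\<close> one has \<open>\<pi> = \<rho> \<circ> \<iota>\<close> and \<open>u = \<rho> \<delta>\<close>.\<close>

definition rep_commutant :: "'a::cstar_algebra set \<Rightarrow> (('x::topological_space \<Rightarrow>\<^sub>C complex) \<Rightarrow> 'a) \<Rightarrow>
    ('a \<Rightarrow> 'h::chilbert_space bounded_op) \<Rightarrow> 'h bounded_op set" where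
  "rep_commutant A \<iota> \<rho> = {\<rho> a |a. a \<in> A \<and> (\<forall>f. \<rho> (a * \<iota> f) = \<rho> (\<iota> f * a))}"

text \<open>The homeomorphism \<open>\<tau>\<close> of the spectrum of \<open>B\<close> with \<open>Ad u (F) = F \<circ> \<tau>\<^sup>-\<^sup>1\<close>, that is,
  \<open>(\<tau> \<omega>) (u b u\<^sup>*) = \<omega> b\<close> (see \<open>spectrum_map_Ad\<close> below).\<close>

definition spectrum_map :: "'a::star_algebra set \<Rightarrow> 'a \<Rightarrow> ('a \<Rightarrow> complex) \<Rightarrow> ('a \<Rightarrow> complex)" where
  "spectrum_map B u \<omega> = restrict (\<lambda>b. \<omega> (star u * b * u)) B"

definition Phi' :: "'a::cstar_algebra set \<Rightarrow> (('x::topological_space \<Rightarrow>\<^sub>C complex) \<Rightarrow> 'a) \<Rightarrow> 'a \<Rightarrow>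
    ('a \<Rightarrow> 'h::chilbert_space bounded_op) \<Rightarrow> ('h bounded_op \<Rightarrow> complex) set" where
  "Phi' A \<iota> \<delta> \<rho> =
     (let B = rep_commutant A \<iota> \<rho>; Y = spectrum_topology B; \<tau> = spectrum_map B (\<rho> \<delta>)
      in {\<phi>. pure_state (\<rho> ` A) \<phi> \<and>
             restrict \<phi> B \<in> aperiodic_points Y \<tau> \<union> periodic_interior_points Y \<tau>})"


section \<open>The definitions fit together\<close>

lemma int_iterate_add1:
  assumes "bij \<sigma>"
  shows "int_iterate \<sigma> (n + 1) x = \<sigma> (int_iterate \<sigma> n x)"
proof (cases "n \<ge> 0")
  case True
  then show ?thesis by (simp add: int_iterate_def nat_add_distrib)
next
  case False
  define k where "k = nat (- n - 1)"
  have n: "n = - int k - 1" using False by (simp add: k_def)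
  have [simp]: "nat (1 + int j) = Suc j" "nat (int j + 1) = Suc j" for j by simp_all
  have "int_iterate \<sigma> n x = inv \<sigma> ((inv \<sigma> ^^ k) x)"
    by (simp add: n int_iterate_def)
  moreover have "int_iterate \<sigma> (n + 1) x = (inv \<sigma> ^^ k) x"
    by (cases k) (simp_all add: n int_iterate_def)
  ultimately show ?thesis
    using assms by (simp add: bij_is_surj surj_f_inv_f)
qed

lemma int_iterate_add:
  assumes "bij \<sigma>"
  shows "int_iterate \<sigma> (m + n) x = int_iterate \<sigma> m (int_iterate \<sigma> n x)"
proof (induction m rule: int_induct[of _ 0])
  case base
  then show ?case by (simp add: int_iterate_def)
next
  case (step1 i)
  then show ?case
    using int_iterate_add1[OF assms, of "i + n"] int_iterate_add1[OF assms, of i]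
    by (simp add: algebra_simps)
next
  case (step2 i)
  have "\<sigma> (int_iterate \<sigma> (i - 1 + n) x) = \<sigma> (int_iterate \<sigma> (i - 1) (int_iterate \<sigma> n x))"
    using int_iterate_add1[OF assms, of "i - 1 + n" x]
      int_iterate_add1[OF assms, of "i - 1" "int_iterate \<sigma> n x"] step2
    by (simp add: algebra_simps)
  then show ?case using assms by (simp add: bij_is_inj inj_eq)
qed

lemma unitary_power_add1:
  assumes "unitary_element u"
  shows "unitary_power u (n + 1) = u * unitary_power u n"
proof (cases "n \<ge> 0")
  case True
  then show ?thesis by (simp add: unitary_power_def nat_add_distrib)
next
  case False
  define k where "k = nat (- n - 1)"
  have n: "n = - int k - 1" using False by (simp add: k_def)
  have [simp]: "nat (1 + int j) = Suc j" "nat (int j + 1) = Suc j" for j by simp_all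
  have "unitary_power u n = star u * star u ^ k"
    by (simp add: n unitary_power_def)
  moreover have "unitary_power u (n + 1) = star u ^ k"
    by (cases k) (simp_all add: n unitary_power_def)
  moreover have "u * (star u * star u ^ k) = star u ^ k"
    using assms by (simp add: unitary_element_def flip: mult.assoc)
  ultimately show ?thesis by simp
qed

lemma unitary_power_add:
  assumes "unitary_element u"
  shows "unitary_power u (m + n) = unitary_power u m * unitary_power u n"
proof (induction m rule: int_induct[of _ 0])
  case base
  then show ?case by (simp add: unitary_power_def)
next
  case (step1 i)
  then show ?case
    using unitary_power_add1[OF assms, of "i + n"] unitary_power_add1[OF assms, of i]
    by (simp add: algebra_simps)
next
  case (step2 i)
  have "u * unitary_power u (i - 1 + n) = u * (unitary_power u (i - 1) * unitary_power u n)"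
    using unitary_power_add1[OF assms, of "i - 1 + n"]
      unitary_power_add1[OF assms, of "i - 1"] step2
    by (simp add: algebra_simps)
  then have "star u * (u * unitary_power u (i - 1 + n)) =
      star u * (u * (unitary_power u (i - 1) * unitary_power u n))" by simp
  then show ?case
    using assms by (simp add: unitary_element_def flip: mult.assoc)
qed

lemma star_one: "star 1 = (1 :: 'a::star_algebra)"
  by (metis mult_1 mult_1_right star_mult star_star)

lemma star_zero: "star 0 = (0 :: 'a::star_algebra)"
  using star_add[of 0 "0::'a"] by simp

lemma star_sum: "star (sum f F) = (\<Sum>x\<in>F. star (f x :: 'a::star_algebra))"
  by (induction F rule: infinite_finite_induct) (simp_all add: star_zero star_add)

lemma star_power: "star (u ^ n) = star (u :: 'a::star_algebra) ^ n"
  by (induction n) (simp_all add: star_one star_mult power_commutes)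

lemma star_unitary_power: "star (unitary_power u n) = unitary_power u (- n)"
  by (cases "n = 0") (auto simp: unitary_power_def star_power star_star star_one)

context
  fixes \<sigma> :: "'x::topological_space \<Rightarrow> 'x"
  assumes \<sigma>: "homeomorphism UNIV UNIV \<sigma> (inv \<sigma>)"
begin

lemma bij_homeo: "bij \<sigma>"
  by (rule o_bij[of "inv \<sigma>"]) (use \<sigma> in \<open>auto simp: homeomorphism_def fun_eq_iff\<close>)

lemma continuous_int_iterate: "continuous_on UNIV (int_iterate \<sigma> n)"
proof -
  have "continuous_on UNIV (f ^^ k)" if "continuous_on UNIV f" for f :: "'x \<Rightarrow> 'x" and k
  proof (induction k)
    case (Suc k)
    have "continuous_on UNIV (f \<circ> f ^^ k)"
      by (rule continuous_on_compose[OF Suc continuous_on_subset[OF that subset_UNIV]])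
    then show ?case by simp
  qed (simp add: id_def)
  then show ?thesis
    using \<sigma> by (simp add: int_iterate_def homeomorphism_def)
qed

lemma apply_cx_auto [simp]: "apply_bcontfun (cx_auto \<sigma> n f) x = apply_bcontfun f (int_iterate \<sigma> (- n) x)"
proof -
  have "continuous_on UNIV (\<lambda>x. apply_bcontfun f (int_iterate \<sigma> (- n) x))"
    by (rule continuous_on_compose2[OF continuous_on_apply_bcontfun continuous_int_iterate subset_UNIV])
  moreover have "bounded (range (\<lambda>x. apply_bcontfun f (int_iterate \<sigma> (- n) x)))"
    by (rule bounded_subset[of "range (apply_bcontfun f)"])
      (use apply_bcontfun[of f] in \<open>auto simp: bcontfun_def\<close>)
  ultimately show ?thesis
    unfolding cx_auto_def by (simp add: Bcontfun_inverse bcontfun_def)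
qed

lemma cx_auto_simps:
  "cx_auto \<sigma> n 0 = 0" "cx_auto \<sigma> n (star f) = star (cx_auto \<sigma> n f)"
  "cx_auto \<sigma> 0 f = f" "cx_auto \<sigma> (m + n) f = cx_auto \<sigma> m (cx_auto \<sigma> n f)"
  "cx_auto \<sigma> n (f * g) = cx_auto \<sigma> n f * cx_auto \<sigma> n g"
proof -
  have *: "- (m + n) = - n + - m" by simp
  show "cx_auto \<sigma> (m + n) f = cx_auto \<sigma> m (cx_auto \<sigma> n f)"
    by (rule bcontfun_eqI) (simp only: apply_cx_auto * int_iterate_add[OF bij_homeo])
  show "cx_auto \<sigma> 0 f = f"
    by (rule bcontfun_eqI) (simp add: int_iterate_def)
  show "cx_auto \<sigma> n 0 = 0"
    by (rule bcontfun_eqI) (simp only: apply_cx_auto zero_bcontfun.rep_eq)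
  show "cx_auto \<sigma> n (star f) = star (cx_auto \<sigma> n f)"
    by (rule bcontfun_eqI) (simp only: apply_cx_auto star_bcontfun.rep_eq)
  show "cx_auto \<sigma> n (f * g) = cx_auto \<sigma> n f * cx_auto \<sigma> n g"
    by (rule bcontfun_eqI) (simp only: apply_cx_auto times_bcontfun.rep_eq)
qed

context
  fixes \<iota> :: "('x \<Rightarrow>\<^sub>C complex) \<Rightarrow> 'a::star_algebra" and \<delta> :: 'a
  assumes cov: "covariant_pair \<sigma> \<iota> \<delta>"
begin

lemma unitary: "unitary_element \<delta>"
  using cov by (simp add: covariant_pair_def)

lemma \<iota>_simps: "\<iota> 1 = 1" "\<iota> (f + g) = \<iota> f + \<iota> g" "\<iota> (f * g) = \<iota> f * \<iota> g"
  "\<iota> (c *\<^sub>C f) = c *\<^sub>C \<iota> f" "\<iota> (star f) = star (\<iota> f)"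
  using cov by (auto simp: covariant_pair_def unital_star_hom_def)

lemma \<iota>_zero: "\<iota> 0 = 0"
  using \<iota>_simps(2)[of 0 0] by simp

lemma \<iota>_sum: "\<iota> (sum f F) = (\<Sum>x\<in>F. \<iota> (f x))"
  by (induction F rule: infinite_finite_induct) (simp_all add: \<iota>_zero \<iota>_simps)

lemma power_commute: "unitary_power \<delta> n * \<iota> f = \<iota> (cx_auto \<sigma> n f) * unitary_power \<delta> n"
proof -
  have 1: "\<delta> * \<iota> f = \<iota> (cx_auto \<sigma> 1 f) * \<delta>" for f
  proof -
    have "\<delta> * \<iota> f * star \<delta> * \<delta> = \<iota> (cx_auto \<sigma> 1 f) * \<delta>"
      using cov by (simp add: covariant_pair_def)
    then show ?thesis using unitary by (simp add: unitary_element_def mult.assoc)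
  qed
  show ?thesis
  proof (induction n arbitrary: f rule: int_induct[of _ 0])
    case base
    then show ?case by (simp add: unitary_power_def cx_auto_simps)
  next
    case (step1 i)
    have "unitary_power \<delta> (i + 1) * \<iota> f = \<delta> * (unitary_power \<delta> i * \<iota> f)"
      by (simp add: unitary_power_add1[OF unitary] mult.assoc)
    also have "\<dots> = (\<delta> * \<iota> (cx_auto \<sigma> i f)) * unitary_power \<delta> i"
      by (simp add: step1 mult.assoc)
    also have "\<dots> = \<iota> (cx_auto \<sigma> (i + 1) f) * unitary_power \<delta> (i + 1)"
      by (simp add: 1 unitary_power_add1[OF unitary] mult.assoc cx_auto_simps(4)[of 1 i, unfolded add.commute[of 1 i]])
    finally show ?case .
  next
    case (step2 i)
    have a: "unitary_power \<delta> i = \<delta> * unitary_power \<delta> (i - 1)"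
      using unitary_power_add1[OF unitary, of "i - 1"] by simp
    have b: "cx_auto \<sigma> i f = cx_auto \<sigma> 1 (cx_auto \<sigma> (i - 1) f)"
      using cx_auto_simps(4)[of 1 "i - 1" f] by simp
    have "\<delta> * (unitary_power \<delta> (i - 1) * \<iota> f) = \<delta> * (\<iota> (cx_auto \<sigma> (i - 1) f) * unitary_power \<delta> (i - 1))"
      using step2(2)[of f] unfolding a b by (simp add: 1 flip: mult.assoc)
    then have "star \<delta> * (\<delta> * (unitary_power \<delta> (i - 1) * \<iota> f)) =
        star \<delta> * (\<delta> * (\<iota> (cx_auto \<sigma> (i - 1) f) * unitary_power \<delta> (i - 1)))" by simp
    then show ?case
      using unitary by (simp add: unitary_element_def flip: mult.assoc)
  qed
qed

lemma cp_eval_superset: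
  assumes "finite F" "{n. a n \<noteq> 0} \<subseteq> F"
  shows "cp_eval \<iota> \<delta> a = (\<Sum>n\<in>F. \<iota> (a n) * unitary_power \<delta> n)"
  unfolding cp_eval_def using assms by (intro sum.mono_neutral_left) (auto simp: \<iota>_zero)

lemma cp_eval_add:
  assumes "a \<in> cp_poly" "b \<in> cp_poly"
  shows "cp_eval \<iota> \<delta> (\<lambda>n. a n + b n) = cp_eval \<iota> \<delta> a + cp_eval \<iota> \<delta> b"
proof -
  define F where "F = {n. a n \<noteq> 0} \<union> {n. b n \<noteq> 0}"
  have "finite F" using assms by (simp add: F_def cp_poly_def)
  then show ?thesis
    by (subst (1 2 3) cp_eval_superset[of F]) (auto simp: F_def \<iota>_simps distrib_right sum.distrib)
qed

lemma scaleC_sum: "(\<Sum>x\<in>F. c *\<^sub>C f x) = c *\<^sub>C (sum f F :: 'b::complex_vector)"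
  by (induction F rule: infinite_finite_induct) (simp_all add: scaleC_add_right)

lemma cp_eval_scaleC:
  assumes "a \<in> cp_poly"
  shows "cp_eval \<iota> \<delta> (\<lambda>n. c *\<^sub>C a n) = c *\<^sub>C cp_eval \<iota> \<delta> a"
  using assms by (subst (1 2) cp_eval_superset[of "{n. a n \<noteq> 0}"])
    (auto simp: cp_poly_def \<iota>_simps scaleC_mult_left scaleC_sum)

lemma cp_eval_mult:
  assumes "a \<in> cp_poly" "b \<in> cp_poly"
  shows "cp_eval \<iota> \<delta> (cp_mult \<sigma> a b) = cp_eval \<iota> \<delta> a * cp_eval \<iota> \<delta> b"
proof -
  define S where "S = {n. a n \<noteq> 0}"
  define T where "T = {n. b n \<noteq> 0}"
  define F where "F = (\<lambda>(k, m). k + m) ` (S \<times> T)"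
  have fin: "finite S" "finite T" "finite F"
    using assms by (auto simp: S_def T_def F_def cp_poly_def)
  have sub: "{n. cp_mult \<sigma> a b n \<noteq> 0} \<subseteq> F"
  proof safe
    fix n assume "cp_mult \<sigma> a b n \<noteq> 0"
    then have "\<exists>k\<in>S. a k * cx_auto \<sigma> k (b (n - k)) \<noteq> 0"
      unfolding cp_mult_def S_def[symmetric] by (metis (no_types, lifting) sum.neutral)
    then obtain k where k: "k \<in> S" "b (n - k) \<noteq> 0"
      by (metis cx_auto_simps(1) mult_zero_right)
    then have "(k, n - k) \<in> S \<times> T" by (simp add: T_def)
    then show "n \<in> F" unfolding F_def by (force intro!: image_eqI[of _ _ "(k, n - k)"])
  qed
  have "cp_eval \<iota> \<delta> (cp_mult \<sigma> a b) =
      (\<Sum>n\<in>F. \<Sum>k\<in>S. \<iota> (a k) * \<iota> (cx_auto \<sigma> k (b (n - k))) * unitary_power \<delta> n)"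
    by (subst cp_eval_superset[OF fin(3) sub])
      (simp add: cp_mult_def S_def[symmetric] \<iota>_sum \<iota>_simps sum_distrib_right)
  also have "\<dots> = (\<Sum>k\<in>S. \<Sum>n\<in>F. \<iota> (a k) * \<iota> (cx_auto \<sigma> k (b (n - k))) * unitary_power \<delta> n)"
    by (rule sum.swap)
  also have "\<dots> = (\<Sum>k\<in>S. \<Sum>m\<in>T. (\<iota> (a k) * unitary_power \<delta> k) * (\<iota> (b m) * unitary_power \<delta> m))"
  proof (rule sum.cong[OF refl])
    fix k assume k: "k \<in> S"
    have "(\<Sum>n\<in>F. \<iota> (a k) * \<iota> (cx_auto \<sigma> k (b (n - k))) * unitary_power \<delta> n) =
        (\<Sum>n\<in>(+) k ` T. \<iota> (a k) * \<iota> (cx_auto \<sigma> k (b (n - k))) * unitary_power \<delta> n)"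
    proof (rule sum.mono_neutral_right[OF fin(3)])
      show "(+) k ` T \<subseteq> F" using k by (auto simp: F_def)
      have "b (n - k) = 0" if "n \<notin> (+) k ` T" for n
        using that by (auto simp: T_def image_iff dest: spec[of _ "n - k"])
      then show "\<forall>n\<in>F - (+) k ` T. \<iota> (a k) * \<iota> (cx_auto \<sigma> k (b (n - k))) * unitary_power \<delta> n = 0"
        by (simp add: cx_auto_simps \<iota>_zero)
    qed
    also have "\<dots> = (\<Sum>m\<in>T. \<iota> (a k) * (\<iota> (cx_auto \<sigma> k (b m)) * unitary_power \<delta> k) * unitary_power \<delta> m)"
      by (subst sum.reindex) (simp_all add: unitary_power_add[OF unitary] mult.assoc)
    finally show "(\<Sum>n\<in>F. \<iota> (a k) * \<iota> (cx_auto \<sigma> k (b (n - k))) * unitary_power \<delta> n) =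
        (\<Sum>m\<in>T. (\<iota> (a k) * unitary_power \<delta> k) * (\<iota> (b m) * unitary_power \<delta> m))"
      by (simp add: mult.assoc flip: power_commute)
  qed
  also have "\<dots> = cp_eval \<iota> \<delta> a * cp_eval \<iota> \<delta> b"
    by (simp add: cp_eval_def S_def T_def sum_product)
  finally show ?thesis .
qed

lemma cp_star_poly:
  assumes "a \<in> cp_poly" shows "{n. cp_star \<sigma> a n \<noteq> 0} \<subseteq> uminus ` {n. a n \<noteq> 0}"
proof
  fix n assume "n \<in> {n. cp_star \<sigma> a n \<noteq> 0}"
  then have "a (- n) \<noteq> 0"
    by (auto simp: cp_star_def cx_auto_simps(1) star_zero)
  then show "n \<in> uminus ` {n. a n \<noteq> 0}"
    by (intro image_eqI[of _ _ "- n"]) simp_all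
qed

lemma cp_eval_star:
  assumes "a \<in> cp_poly"
  shows "cp_eval \<iota> \<delta> (cp_star \<sigma> a) = star (cp_eval \<iota> \<delta> a)"
proof -
  have fin: "finite (uminus ` {n. a n \<noteq> 0})" using assms by (simp add: cp_poly_def)
  have "cp_eval \<iota> \<delta> (cp_star \<sigma> a) = (\<Sum>n | a n \<noteq> 0. \<iota> (cx_auto \<sigma> (- n) (star (a n))) * unitary_power \<delta> (- n))"
    by (subst cp_eval_superset[OF fin cp_star_poly[OF assms]], subst sum.reindex)
      (simp_all add: cp_star_def)
  also have "\<dots> = star (cp_eval \<iota> \<delta> a)"
    by (simp add: cp_eval_def star_sum star_mult star_unitary_power power_commute
        flip: \<iota>_simps(5))
  finally show ?thesis .
qed

end

lemma cp_cstar_seminorm_norm: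
  fixes \<iota> :: "('x \<Rightarrow>\<^sub>C complex) \<Rightarrow> 'a::cstar_algebra"
  assumes cov: "covariant_pair \<sigma> \<iota> \<delta>"
  shows "cp_cstar_seminorm \<sigma> (\<lambda>a. norm (cp_eval \<iota> \<delta> a))"
proof -
  have "cp_star \<sigma> a \<in> cp_poly" if "a \<in> cp_poly" for a
    using cp_star_poly[OF cov that] that finite_subset unfolding cp_poly_def by blast
  then show ?thesis
    unfolding cp_cstar_seminorm_def
    by (simp add: cp_eval_mult[OF cov] cp_eval_star[OF cov] cp_eval_add[OF cov]
        cp_eval_scaleC[OF cov] cstar_identity norm_scaleC norm_triangle_ineq norm_mult_ineq)
qed

end

lemma spectrum_map_Ad:
  assumes "unitary_element u" "b \<in> B" "u * b * star u \<in> B"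
  shows "spectrum_map B u \<omega> (u * b * star u) = \<omega> b"
proof -
  have "star u * (u * b * star u) * u = (star u * u) * b * (star u * u)"
    by (simp add: mult.assoc)
  then show ?thesis
    using assms by (simp add: spectrum_map_def unitary_element_def)
qed

end

theory Submission
  imports Defs "HOL-Complex_Analysis.Complex_Analysis"
begin

text \<open>
  Write C = \<rho>(A), \<pi> = \<rho> \<circ> \<iota>, u = \<rho>(\<delta>), and let B be the commutant of \<pi>(C(X)) in C.
  Suppose that an ideal J of C meets B only in 0. Then every character \<omega> of B extends
  to a state of C that vanishes on J (\<open>ex_state_extension_vanishing_on_ideal\<close>). If \<omega> is an
  aperiodic or a periodic interior point, it has only one state extension at all
  (\<open>state_extension_unique\<close>). So every member of the given family vanishes on J, in particular on
  j^* j for j \<in> J, and totality gives j = 0.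

  Existence. As J need not be closed, the embedding of B into C / J is replaced by the left
  ideal N of all x + j with j \<in> J and x^* x \<le> h for some h \<in> B with \<omega>(h) = 0. If 1 = x + j
  were in N, take functions g, g' of h that are concentrated near the value 0 and
  satisfy g g' = g', \<omega>(g') = 1, \<parallel>x g\<parallel> < 1. From (1 - x g) g' = (1 - x) g' = j g' and the
  invertibility of 1 - x g one gets g' \<in> J \<inter> B, a contradiction. A proper left ideal has
  distance 1 from the unit, so Hahn--Banach gives a functional of norm one that is 1 at the unit
  and 0 on N. It is a state, and it extends \<omega> because N contains the kernel of \<omega>.

  Uniqueness. A state \<phi> that extends a character of B satisfies \<phi>(b c) = \<omega>(b) \<phi>(c) = \<phi>(c b). If the
  automorphism of B given by u^n moves \<omega>, this forces \<phi>(\<pi>(f) u^n) = 0. If it fixes \<omega> and \<omega> is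
  interior to the points of period k, a bump function F \<in> B at \<omega> that lives on these points has
  F u^n \<in> B, so that \<phi>(\<pi>(f) u^n) = \<omega>(F \<pi>(f) u^n). The elements \<pi>(f) u^n span a dense subspace.

  That F u^n lies in B is checked on characters, and these separate the points of B because B is
  commutative (\<open>B_commutative\<close>). For the latter, localise at a point x of X: modulo the closed left
  ideal of C generated by the functions vanishing at x, an element of B is a limit of
  polynomials in those u^n for which \<sigma>^n fixes x, and these commute with each other. So the
  commutators of B lie in all these left ideals, and an element of B that does so is 0.

  The C*-algebra theory behind this starts from square roots given by the binomial series. They make a
  self-adjoint contraction the real part of a unitary, which yields the norm estimate for polynomials
  (\<open>norm_poly_at_le\<close>) and so the continuous functional calculus. This in turn shows that C is closed, and
  that the quotient of a commutative algebra by a maximal ideal consists of scalars.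
\<close>

section \<open>Closed star-subalgebras\<close>

locale cstar_subalgebra =
  fixes A :: "'a::cstar_algebra set"
  assumes subalg: "star_subalgebra A" and closed: "closed A"
begin

lemma one_mem: "1 \<in> A"
  and add_mem: "x \<in> A \<Longrightarrow> y \<in> A \<Longrightarrow> x + y \<in> A"
  and mult_mem: "x \<in> A \<Longrightarrow> y \<in> A \<Longrightarrow> x * y \<in> A"
  and scaleC_mem: "x \<in> A \<Longrightarrow> c *\<^sub>C x \<in> A"
  and star_mem: "x \<in> A \<Longrightarrow> star x \<in> A"
  using subalg by (auto simp: star_subalgebra_def)

lemma scaleR_mem: "x \<in> A \<Longrightarrow> r *\<^sub>R x \<in> A"
  using scaleC_mem[of x "of_real r"] by (simp add: scaleC_of_real)

lemma uminus_mem: "x \<in> A \<Longrightarrow> - x \<in> A"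
  using scaleR_mem[of x "-1"] by simp

lemma diff_mem: "x \<in> A \<Longrightarrow> y \<in> A \<Longrightarrow> x - y \<in> A"
  using add_mem[of x "- y"] uminus_mem by simp

lemma zero_mem: "0 \<in> A"
  using diff_mem[OF one_mem one_mem] by simp

lemma power_mem: "x \<in> A \<Longrightarrow> x ^ n \<in> A"
  by (induction n) (auto intro: one_mem mult_mem)

lemma sum_mem: "(\<And>i. i \<in> I \<Longrightarrow> f i \<in> A) \<Longrightarrow> sum f I \<in> A"
  by (induction I rule: infinite_finite_induct) (auto intro: zero_mem add_mem)

lemma suminf_mem:
  assumes "summable f" "\<And>n. f n \<in> A"
  shows "suminf f \<in> A"
proof -
  have "(\<lambda>n. \<Sum>i<n. f i) \<longlonglongrightarrow> suminf f"
    using assms(1) by (simp add: summable_LIMSEQ)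
  then show ?thesis
    using closed_sequentially[OF closed] assms(2) sum_mem by metis
qed

lemmas mem = one_mem add_mem mult_mem scaleC_mem star_mem scaleR_mem uminus_mem diff_mem
  zero_mem power_mem sum_mem

end

lemma star_minus: "star (- x) = - star (x :: 'a::star_algebra)"
  using star_add[of x "- x"] by (simp add: star_zero eq_neg_iff_add_eq_0 add.commute)

lemma scaleC_minus: "a *\<^sub>C (- x) = - (a *\<^sub>C (x :: 'a::complex_vector))"
  using scaleC_add_right[of a x "- x"] by (simp add: eq_neg_iff_add_eq_0 add.commute)

lemma scaleC_minus_left: "(- a) *\<^sub>C x = - (a *\<^sub>C (x :: 'a::complex_vector))"
  using scaleC_add_left[of "- a" a x] by (simp add: eq_neg_iff_add_eq_0)

lemma scaleC_i_i: "\<i> *\<^sub>C \<i> *\<^sub>C x = - (x :: 'a::complex_vector)"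
  using scaleC_of_real[of "-1" x] by (simp add: scaleC_scaleC)

lemma scaleC_diff: "a *\<^sub>C (x - y) = a *\<^sub>C x - a *\<^sub>C (y :: 'a::complex_vector)"
  using scaleC_add_right[of a x "- y"] by (simp add: scaleC_minus)

lemma star_diff: "star (x - y) = star x - star (y :: 'a::star_algebra)"
  using star_add[of x "- y"] by (simp add: star_minus)

lemma star_scaleR: "star (r *\<^sub>R x) = r *\<^sub>R star (x :: 'a::star_algebra)"
  using star_scaleC[of "of_real r" x] by (simp add: scaleC_of_real)

lemma cstar_subalgebra_generated: "cstar_subalgebra (cstar_generated G)"
  unfolding cstar_generated_def by unfold_locales (auto simp: star_subalgebra_def)

lemma generated_subset: "G \<subseteq> cstar_generated G"
  by (auto simp: cstar_generated_def)

lemma generated_least: "cstar_subalgebra A \<Longrightarrow> G \<subseteq> A \<Longrightarrow> cstar_generated G \<subseteq> A"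
  by (auto simp: cstar_generated_def cstar_subalgebra_def)

definition commutant :: "'a::cstar_algebra set \<Rightarrow> 'a set" where
  "commutant S = {x. \<forall>s\<in>S. x * s = s * x}"

lemma cstar_subalgebra_commutant:
  assumes "\<And>s. s \<in> S \<Longrightarrow> star s \<in> S"
  shows "cstar_subalgebra (commutant S)"
proof
  have "star x * s = s * star x" if "\<forall>s\<in>S. x * s = s * x" "s \<in> S" for x s
  proof -
    have "star (x * star s) = star (star s * x)" using that assms by simp
    then show ?thesis by (simp add: star_mult star_star)
  qed
  then show "star_subalgebra (commutant S)"
    unfolding star_subalgebra_def commutant_def
    by (simp add: distrib_left distrib_right scaleC_mult_left scaleC_mult_right mult.assoc)
      (metis mult.assoc)
  have "commutant S = (\<Inter>s\<in>S. {x. x * s - s * x = 0})"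
    by (auto simp: commutant_def)
  moreover have "closed {x. x * s - s * x = 0}" for s :: 'a
    by (intro closed_Collect_eq continuous_intros)
  ultimately show "closed (commutant S)" by auto
qed

lemma cstar_subalgebra_Int:
  assumes "cstar_subalgebra A" "cstar_subalgebra B"
  shows "cstar_subalgebra (A \<inter> B)"
  using assms by (auto simp: cstar_subalgebra_def star_subalgebra_def)

text \<open>The elements that commute with z and with its adjoint form a closed star-subalgebra; if it contains x,
  it contains everything that x generates. Power series in x inherit commutation in this way.\<close>

lemma generated_self_adjoint_commute:
  assumes "star x = x" "y \<in> cstar_generated {x}" "z * x = x * z"
    "star z * x = x * star z"
  shows "y * z = z * y"
proof -
  have "cstar_generated {x} \<subseteq> commutant {z, star z}"
    using assms by (intro generated_least cstar_subalgebra_commutant)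
      (auto simp: star_star commutant_def)
  then show ?thesis using assms(2) by (auto simp: commutant_def)
qed

section \<open>Inverses and square roots by power series\<close>

text \<open>Equality fails in the zero algebra, where 1 = 0.\<close>

lemma norm_one_le: "norm (1 :: 'a::cstar_algebra) \<le> 1"
  using cstar_identity[of "1::'a"] by (auto simp: star_one power2_eq_square)

lemma norm_power_le: "norm (x ^ n) \<le> norm (x :: 'a::cstar_algebra) ^ n"
proof (induction n)
  case (Suc n)
  have "norm (x ^ Suc n) \<le> norm x * norm (x ^ n)" by (simp add: norm_mult_ineq)
  also have "\<dots> \<le> norm x * norm x ^ n" using Suc by (intro mult_left_mono) auto
  finally show ?case by simp
qed (simp add: norm_one_le)

lemma summable_power_series:
  fixes z :: "'a::cstar_algebra"
  assumes "norm z < 1" "\<And>n. \<bar>a n\<bar> \<le> 1"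
  shows "summable (\<lambda>n. norm (a n *\<^sub>R z ^ n))"
proof (rule summable_comparison_test)
  have "\<bar>a n\<bar> * norm (z ^ n) \<le> 1 * norm z ^ n" for n
    using assms norm_power_le by (intro mult_mono) auto
  then show "\<exists>N. \<forall>n\<ge>N. norm (norm (a n *\<^sub>R z ^ n)) \<le> norm z ^ n" by simp
  show "summable (\<lambda>n. norm z ^ n)" using assms(1) by (simp add: summable_geometric)
qed

context cstar_subalgebra
begin

text \<open>The Neumann series converges in \<open>A\<close>: later arguments need the inverse to be in the subalgebra.\<close>

lemma inverse_near_one:
  assumes "x \<in> A" "norm (1 - x) < 1"
  obtains y where "y \<in> A" "y * x = 1" "x * y = 1"
proof -
  define z where "z = 1 - x"
  have z: "z \<in> A" "norm z < 1" using assms mem by (auto simp: z_def)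
  have "summable (\<lambda>n. norm (1 *\<^sub>R z ^ n))"
    by (rule summable_power_series[where a = "\<lambda>_. 1"]) (use z in auto)
  then have s: "summable (\<lambda>n. z ^ n)"
    by (simp add: summable_norm_cancel)
  define y where "y = (\<Sum>n. z ^ n)"
  have 1: "y = 1 + (\<Sum>n. z ^ Suc n)"
    using suminf_split_head[OF s] by (simp add: y_def)
  have "z * y = (\<Sum>n. z ^ Suc n)"
    unfolding y_def using s by (simp add: suminf_mult)
  moreover have "y * z = (\<Sum>n. z ^ Suc n)"
    unfolding y_def using s by (simp add: suminf_mult2 power_commutes)
  ultimately have "x * y = 1" "y * x = 1"
    using 1 by (auto simp: z_def algebra_simps)
  moreover have "y \<in> A" unfolding y_def by (intro suminf_mem s power_mem z)
  ultimately show ?thesis using that by blast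
qed

end

text \<open>The coefficients of the binomial series of \<surd>(1 + t); the bound makes the series converge absolutely
  in every C*-algebra for \<parallel>t\<parallel> < 1.\<close>

lemma abs_gbinomial_half_le: "\<bar>(1/2 :: real) gchoose n\<bar> \<le> 1"
proof (induction n)
  case (Suc n)
  have "\<bar>(1/2 :: real) gchoose Suc n\<bar> = \<bar>(1/2 :: real) gchoose n\<bar> * (\<bar>1/2 - real n\<bar> / (1 + real n))"
    by (simp add: gbinomial_absorb_comp gbinomial_mult_1 gbinomial_Suc_rec abs_mult)
  also have "\<dots> \<le> 1 * 1" using Suc by (intro mult_mono) auto
  finally show ?case by simp
qed simp

text \<open>The binomial series: by Vandermonde's convolution the Cauchy product of the series with itself has
  the coefficients of (1 + t)^1.\<close>

lemma (in cstar_subalgebra) sqrt_one_minus: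
  assumes z: "z \<in> A" "star z = z" "norm z < 1"
  obtains y where "y \<in> A" "star y = y" "y * y = 1 - z"
proof -
  define f where "f n = ((1/2 :: real) gchoose n) *\<^sub>R (- z) ^ n" for n
  define y where "y = (\<Sum>n. f n)"
  have sn: "summable (\<lambda>n. norm (f n))"
    unfolding f_def by (rule summable_power_series) (use z abs_gbinomial_half_le in auto)
  then have s: "summable f" by (rule summable_norm_cancel)
  have "(\<lambda>k. \<Sum>i\<le>k. f i * f (k - i)) sums (y * y)"
    unfolding y_def by (rule Cauchy_product_sums[OF sn sn])
  moreover have "(\<Sum>i\<le>k. f i * f (k - i)) = (1 gchoose k) *\<^sub>R (- z) ^ k" for k
  proof -
    have "(\<Sum>i\<le>k. f i * f (k - i)) =
        (\<Sum>i\<le>k. (((1/2 :: real) gchoose i) * ((1/2) gchoose (k - i))) *\<^sub>R (- z) ^ k)"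
      by (rule sum.cong) (auto simp: f_def mult.commute simp flip: power_add)
    also have "\<dots> = (\<Sum>i\<in>{0..k}. ((1/2 :: real) gchoose i) * ((1/2) gchoose (k - i))) *\<^sub>R (- z) ^ k"
      by (simp add: scaleR_sum_left atMost_atLeast0)
    also have "\<dots> = (1 gchoose k) *\<^sub>R (- z) ^ k"
      by (subst gbinomial_Vandermonde) simp
    finally show ?thesis .
  qed
  ultimately have 1: "(\<lambda>k. (1 gchoose k) *\<^sub>R (- z) ^ k) sums (y * y)" by simp
  have "(\<lambda>k. ((1::real) gchoose k) *\<^sub>R (- z) ^ k) sums (\<Sum>k<2. ((1::real) gchoose k) *\<^sub>R (- z) ^ k)"
  proof (rule sums_finite)
    fix k :: nat assume "k \<notin> {..<2}"
    then have "k > 1" by auto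
    then have "((1::real) gchoose k) = 0"
      using binomial_gbinomial[of 1 k, where 'a=real] binomial_eq_0[of 1 k]
      by (metis of_nat_0 of_nat_1)
    then show "((1::real) gchoose k) *\<^sub>R (- z) ^ k = 0" by simp
  qed simp
  moreover have "(\<Sum>k<2. ((1::real) gchoose k) *\<^sub>R (- z) ^ k) = 1 - z"
    by (simp add: numeral_2_eq_2)
  ultimately have "y * y = 1 - z" using 1 sums_unique2 by metis
  moreover have "y \<in> A"
    unfolding y_def by (intro suminf_mem s) (auto simp: f_def intro: mem z)
  moreover have "star y = y"
  proof -
    have "star y = (\<Sum>n. star (f n))"
      unfolding y_def by (rule bounded_linear.suminf[OF bounded_linear_star s])
    then show ?thesis by (simp add: y_def f_def star_scaleR star_power star_minus z)
  qed
  ultimately show ?thesis using that by blast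
qed

text \<open>The form in which square roots are used later: r^2 - x^* x is a square whenever r exceeds the norm of x.\<close>

lemma (in cstar_subalgebra) sqrt_norm_diff:
  assumes x: "x \<in> A" "norm x < r"
  obtains y where "y \<in> A" "star y = y" "y * y = r\<^sup>2 *\<^sub>R 1 - star x * x"
proof -
  have r: "0 < r" using x(2) norm_ge_zero[of x] by linarith
  define z where "z = (1 / r\<^sup>2) *\<^sub>R (star x * x)"
  have "(norm x)\<^sup>2 < r\<^sup>2" using x(2) by (intro power_strict_mono) auto
  then have "norm z < 1" using r by (simp add: z_def cstar_identity)
  moreover have "z \<in> A" "star z = z"
    using x by (auto simp: z_def star_scaleR star_mult star_star intro: mem)
  ultimately obtain y where y: "y \<in> A" "star y = y" "y * y = 1 - z"
    using sqrt_one_minus by blast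
  have "(r *\<^sub>R y) * (r *\<^sub>R y) = r\<^sup>2 *\<^sub>R (y * y)" by (simp add: power2_eq_square)
  also have "\<dots> = r\<^sup>2 *\<^sub>R 1 - star x * x" using r by (simp add: y z_def scaleR_diff_right)
  finally show ?thesis using that[of "r *\<^sub>R y"] y by (simp add: star_scaleR mem)
qed

text \<open>The unitary is \<open>w = k + i \<surd>(1 - k\<^sup>2)\<close>, and the equation between \<open>k\<close> and \<open>w\<close> is \<open>k = (w + w\<^sup>*) / 2\<close> multiplied
  by \<open>2 w\<close>, so that it involves only non-negative powers of \<open>w\<close>.\<close>

lemma self_adjoint_eq_Re_unitary:
  fixes k :: "'a::cstar_algebra"
  assumes k: "star k = k" "norm k < 1"
  obtains w where "unitary_element w" "2 *\<^sub>R (k * w) = w * w + 1" "k * w = w * k"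
proof -
  interpret G: cstar_subalgebra "cstar_generated {k}"
    by (rule cstar_subalgebra_generated)
  have kG: "k \<in> cstar_generated {k}" using generated_subset by blast
  have "norm (k * k) \<le> norm k * norm k" by (rule norm_mult_ineq)
  also have "\<dots> < 1" using k(2) by (metis norm_ge_zero mult_strict_mono' mult_1)
  finally have "norm (k * k) < 1" .
  then obtain y where y: "y \<in> cstar_generated {k}" "star y = y" "y * y = 1 - k * k"
    using G.sqrt_one_minus[of "k * k"] kG k by (auto simp: star_mult G.mem)
  have yk: "y * k = k * y"
    by (rule generated_self_adjoint_commute[OF k(1) y(1)]) (simp_all add: k)
  define w where "w = k + \<i> *\<^sub>C y"
  have sw: "star w = k - \<i> *\<^sub>C y"
    by (simp add: w_def star_add star_scaleC k y scaleC_minus_left)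
  have 1: "star w * w = 1" "w * star w = 1"
    by (simp_all only: sw, simp_all add: w_def algebra_simps scaleC_mult_left scaleC_mult_right yk y scaleC_i_i scaleC_diff
        scaleC_add_right scaleC_minus)
  have "star w + w = 2 *\<^sub>R k" unfolding sw by (simp add: w_def scaleR_2)
  then have 2: "2 *\<^sub>R k * w = (star w + w) * w" by simp
  show ?thesis
  proof
    show "unitary_element w" using 1 by (simp add: unitary_element_def)
    show "2 *\<^sub>R (k * w) = w * w + 1" using 2 by (simp add: 1 distrib_right add.commute)
    show "k * w = w * k" by (simp add: w_def algebra_simps scaleC_mult_left scaleC_mult_right yk)
  qed
qed

lemma norm_unitary: "unitary_element (w :: 'a::cstar_algebra) \<Longrightarrow> norm w \<le> 1"
  using cstar_identity[of w] norm_one_le[where 'a='a] power2_le_imp_le[of "norm w" 1]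
  by (simp add: unitary_element_def)

section \<open>Real polynomials of a self-adjoint element\<close>

definition poly_at :: "real poly \<Rightarrow> 'a::star_algebra \<Rightarrow> 'a" where
  "poly_at p x = (\<Sum>i\<le>degree p. coeff p i *\<^sub>R x ^ i)"

lemma poly_at_eq_sum: "degree p \<le> n \<Longrightarrow> poly_at p x = (\<Sum>i\<le>n. coeff p i *\<^sub>R x ^ i)"
  unfolding poly_at_def by (rule sum.mono_neutral_left) (auto simp: coeff_eq_0)

lemma poly_at_0 [simp]: "poly_at 0 x = 0"
  by (simp add: poly_at_def)

lemma poly_at_pCons [simp]: "poly_at (pCons a p) x = a *\<^sub>R 1 + x * poly_at p x"
proof -
  have "poly_at (pCons a p) x = (\<Sum>i\<le>Suc (degree p). coeff (pCons a p) i *\<^sub>R x ^ i)"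
    by (rule poly_at_eq_sum) (simp add: degree_pCons_le)
  then show ?thesis
    by (simp add: sum.atMost_Suc_shift poly_at_def sum_distrib_left del: sum.atMost_Suc)
qed

lemma poly_at_add [simp]: "poly_at (p + q) x = poly_at p x + poly_at q x"
  by (subst (1 2 3) poly_at_eq_sum[of _ "max (degree p) (degree q)"])
    (auto simp: degree_add_le_max scaleR_add_left sum.distrib)

lemma poly_at_smult [simp]: "poly_at (smult a p) x = a *\<^sub>R poly_at p x"
  by (induction p) (simp_all add: scaleR_add_right)

lemma poly_at_diff [simp]: "poly_at (p - q) x = poly_at p x - poly_at q x"
  using poly_at_add[of "p - q" q x] by simp

lemma poly_at_mult [simp]: "poly_at (p * q) x = poly_at p x * poly_at q x"
  by (induction p) (simp_all add: mult.assoc distrib_right)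

lemma poly_at_1 [simp]: "poly_at 1 x = 1"
  by (simp add: poly_at_def)

lemma poly_at_power [simp]: "poly_at (p ^ n) x = poly_at p x ^ n"
  by (induction n) simp_all

lemma poly_at_monom [simp]: "poly_at (monom a n) x = a *\<^sub>R x ^ n"
  by (induction n) (simp_all add: monom_0 monom_Suc)

lemma poly_at_commute:
  assumes "x * y = y * x"
  shows "poly_at p x * y = y * poly_at p x"
proof (induction p)
  case (pCons a p)
  have "x * poly_at p x * y = (x * y) * poly_at p x" by (simp add: mult.assoc pCons.IH)
  also have "\<dots> = y * (x * poly_at p x)" by (simp add: assms mult.assoc)
  finally show ?case by (simp add: distrib_left distrib_right)
qed simp

lemma star_poly_at: "star x = x \<Longrightarrow> star (poly_at p x) = poly_at p x"
  by (simp add: poly_at_def star_sum star_scaleR star_power)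

lemma (in cstar_subalgebra) poly_at_mem: "x \<in> A \<Longrightarrow> poly_at p x \<in> A"
  by (auto simp: poly_at_def intro: mem)

lemma poly_at_complex: "poly_at p (z :: complex) = poly (map_poly of_real p) z"
  by (simp add: poly_at_def poly_altdef degree_map_poly coeff_map_poly scaleR_conv_of_real)

lemma poly_at_of_real: "poly_at p (of_real t :: complex) = of_real (poly p t)"
  by (simp add: poly_at_def poly_altdef scaleR_conv_of_real)

text \<open>Cauchy's estimate for the k-th derivative at 0.\<close>

lemma abs_coeff_le_of_circle:
  assumes "\<And>z :: complex. cmod z = 1 \<Longrightarrow> cmod (poly_at p z) \<le> s"
  shows "\<bar>coeff p k\<bar> \<le> s"
proof -
  define P :: "complex poly" where "P = map_poly of_real p"
  have "deriv (poly q) = poly (pderiv q)" for q :: "complex poly"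
    by (rule ext) (rule DERIV_imp_deriv, rule poly_DERIV)
  then have d: "(deriv ^^ k) (poly P) = poly ((pderiv ^^ k) P)"
    by (induction k) simp_all
  have "norm ((deriv ^^ k) (poly P) 0) \<le> fact k * s / 1 ^ k"
    by (rule Cauchy_inequality)
      (use assms in \<open>auto simp: P_def poly_at_complex intro!: holomorphic_intros continuous_intros\<close>)
  moreover have "(deriv ^^ k) (poly P) 0 = fact k * of_real (coeff p k)"
    unfolding d poly_0_coeff_0 coeff_higher_pderiv
    by (simp add: P_def coeff_map_poly pochhammer_fact)
  ultimately show ?thesis by (simp add: norm_mult)
qed

text \<open>The hypotheses say h = M (w + w^*) / 2 when w is unitary. Then p(h) is a trigonometric polynomial in
  w, and multiplication by w^n makes it a polynomial q. For a complex number z of modulus one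
  the same q has the modulus of p(M Re z), so that Cauchy's estimate bounds its coefficients.\<close>

lemma ex_circle_poly:
  fixes h w :: "'a::star_algebra"
  assumes hw: "h * w = (M / 2) *\<^sub>R (w * w + 1)" "h * w = w * h" and "degree p \<le> n"
  obtains q where "degree q \<le> 2 * n" "poly_at q w = poly_at p h * w ^ n"
    "\<And>z :: complex. cmod z = 1 \<Longrightarrow> poly_at q z = z ^ n * of_real (poly p (M * Re z))"
proof -
  have "\<exists>q. degree q \<le> 2 * n \<and> poly_at q w = poly_at p h * w ^ n \<and>
      (\<forall>z :: complex. cmod z = 1 \<longrightarrow> poly_at q z = z ^ n * of_real (poly p (M * Re z)))"
    using assms(3)
  proof (induction n arbitrary: p)
    case 0
    then obtain a where "p = [:a:]" by (auto elim: degree_eq_zeroE)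
    then show ?case by (intro exI[of _ "[:a:]"]) (simp add: scaleR_conv_of_real)
  next
    case (Suc n)
    obtain a p' where p: "p = pCons a p'" by (cases p)
    then have "degree p' \<le> n" using Suc.prems by (cases "p' = 0") auto
    from Suc.IH[OF this] obtain q where q: "degree q \<le> 2 * n" "poly_at q w = poly_at p' h * w ^ n"
      "\<And>z :: complex. cmod z = 1 \<Longrightarrow> poly_at q z = z ^ n * of_real (poly p' (M * Re z))"
      by blast
    define Q where "Q = monom a (Suc n) + smult (M / 2) ([:1, 0, 1:] * q)"
    have "degree ([:1, 0, 1:] * q) \<le> 2 * Suc n"
      using degree_mult_le[of "[:1, 0, 1:]" q] q(1) by simp
    then have "degree Q \<le> 2 * Suc n"
      unfolding Q_def
      by (intro degree_add_le order_trans[OF degree_smult_le] order_trans[OF degree_monom_le]) auto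
    moreover have "poly_at Q w = poly_at p h * w ^ Suc n"
    proof -
      have "poly_at Q w = a *\<^sub>R w ^ Suc n + (h * w) * poly_at q w"
        by (simp add: Q_def hw(1) add.commute distrib_right mult.assoc)
      also have "(h * w) * poly_at q w = h * (poly_at q w * w)"
        by (simp add: mult.assoc poly_at_commute)
      finally show ?thesis
        unfolding q(2) by (simp add: p distrib_right mult.assoc power_commutes)
    qed
    moreover have "poly_at Q z = z ^ Suc n * of_real (poly p (M * Re z))" if "cmod z = 1" for z
    proof -
      have "z * cnj z = 1" using that by (simp add: complex_norm_square[symmetric])
      then have "1 + z * z = z * (z + cnj z)" by (simp add: algebra_simps)
      also have "\<dots> = 2 * of_real (Re z) * z" by (simp add: complex_add_cnj)
      finally have zz: "1 + z * z = 2 * of_real (Re z) * z" .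
      have "poly_at Q z = of_real a * z ^ Suc n
          + of_real (M / 2) * ((1 + z * z) * (z ^ n * of_real (poly p' (M * Re z))))"
        by (simp add: Q_def q(3)[OF that] scaleR_conv_of_real distrib_right mult.assoc)
      also have "\<dots> = z ^ Suc n * of_real (poly p (M * Re z))"
        unfolding zz by (simp add: p algebra_simps)
      finally show ?thesis .
    qed
    ultimately show ?case by blast
  qed
  then show ?thesis using that by blast
qed

text \<open>A linear factor disappears when 2^j-th roots are taken.\<close>

lemma le_of_power_le_linear_mult:
  fixes a b c :: real
  assumes "0 \<le> b" and le: "\<And>j. a ^ 2 ^ j \<le> (c * 2 ^ j + 1) * b ^ 2 ^ j"
  shows "a \<le> b"
proof (rule ccontr)
  assume "\<not> a \<le> b"
  then have ab: "b < a" "0 < a" using assms(1) by auto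
  define x where "x = b / a"
  have x: "norm x < 1" using ab assms(1) by (simp add: x_def)
  have "(\<lambda>n. c * (real n * x ^ n) + x ^ n) \<longlonglongrightarrow> c * 0 + 0"
    by (intro tendsto_intros powser_times_n_limit_0 x LIMSEQ_power_zero)
  then have "eventually (\<lambda>n. c * (real n * x ^ n) + x ^ n < 1) sequentially"
    by (auto intro: order_tendstoD)
  then obtain N where N: "\<And>n. n \<ge> N \<Longrightarrow> c * (real n * x ^ n) + x ^ n < 1"
    by (auto simp: eventually_sequentially)
  have "c * (real (2 ^ N) * x ^ 2 ^ N) + x ^ 2 ^ N < 1"
    by (rule N) (simp add: less_imp_le)
  then have "(c * 2 ^ N + 1) * b ^ 2 ^ N < a ^ 2 ^ N"
    using ab by (simp add: x_def power_divide field_simps)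
  with le[of N] show False by linarith
qed

lemma norm_power2_self_adjoint:
  fixes x :: "'a::cstar_algebra"
  assumes "star x = x"
  shows "norm (x ^ 2 ^ j) = norm x ^ 2 ^ j"
proof (induction j)
  case (Suc j)
  have "norm (x ^ 2 ^ Suc j) = norm (star (x ^ 2 ^ j) * x ^ 2 ^ j)"
    by (simp add: star_power assms mult_2 power_add)
  also have "\<dots> = (norm x ^ 2 ^ j)\<^sup>2" by (simp only: cstar_identity Suc)
  finally show ?case by (simp add: mult.commute flip: power_mult)
qed simp

text \<open>The spectral estimate. By \<open>ex_circle_poly\<close> and the triangle inequality, \<parallel>p(h)\<parallel> \<le> (2 deg p + 1) s. Apply
  this to p^N for N = 2^j, where \<parallel>p(h)^N\<parallel> = \<parallel>p(h)\<parallel>^N by the C*-identity, and let N grow.\<close>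

lemma norm_poly_at_le:
  fixes h :: "'a::cstar_algebra"
  assumes h: "star h = h" "norm h < M"
    and s: "\<And>t. t \<in> {-M..M} \<Longrightarrow> \<bar>poly p t\<bar> \<le> s"
  shows "norm (poly_at p h) \<le> s"
proof -
  have M: "0 < M" using h(2) norm_ge_zero[of h] by linarith
  then have s0: "0 \<le> s" using s[of 0] by auto
  obtain w where w: "unitary_element w" "2 *\<^sub>R ((h /\<^sub>R M) * w) = w * w + 1"
    "(h /\<^sub>R M) * w = w * (h /\<^sub>R M)"
    using self_adjoint_eq_Re_unitary[of "h /\<^sub>R M"] h M by (auto simp: star_scaleR field_simps)
  have hw: "h * w = (M / 2) *\<^sub>R (w * w + 1)" "h * w = w * h"
    using M w(3) by (simp_all flip: w(2))
  have wn: "norm (w ^ i) \<le> 1" "norm (star w ^ i) \<le> 1" for i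
    by (rule order_trans[OF norm_power_le power_le_one];
        use norm_unitary[OF w(1)] in \<open>simp add: norm_star\<close>)+
  have ww: "w ^ i * star w ^ i = 1" for i
  proof (induction i)
    case (Suc i)
    have "w ^ Suc i * star w ^ Suc i = w ^ i * (w * star w) * star w ^ i"
      by (simp only: power_Suc2[of w] power_Suc[of "star w"] mult.assoc)
    then show ?case using Suc w(1) by (simp add: unitary_element_def)
  qed simp
  show ?thesis
  proof (rule le_of_power_le_linear_mult[OF s0, where c = "2 * real (degree p)"])
    fix j :: nat
    define N :: nat where "N = 2 ^ j"
    define n where "n = N * degree p"
    have "degree (p ^ N) \<le> n" unfolding n_def by (metis degree_power_le mult.commute)
    then obtain q where q: "degree q \<le> 2 * n" "poly_at q w = poly_at (p ^ N) h * w ^ n"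
      "\<And>z :: complex. cmod z = 1 \<Longrightarrow> poly_at q z = z ^ n * of_real (poly (p ^ N) (M * Re z))"
      using ex_circle_poly[OF hw] by metis
    have c: "\<bar>coeff q i\<bar> \<le> s ^ N" for i
    proof (rule abs_coeff_le_of_circle)
      fix z :: complex assume z: "cmod z = 1"
      have "\<bar>M * Re z\<bar> \<le> M * 1"
        unfolding abs_mult using M abs_Re_le_cmod[of z] z by (intro mult_mono) auto
      then have "\<bar>poly p (M * Re z)\<bar> \<le> s" by (intro s) auto
      then have "\<bar>poly p (M * Re z)\<bar> ^ N \<le> s ^ N" by (intro power_mono) auto
      then show "cmod (poly_at q z) \<le> s ^ N"
        by (simp add: q(3)[OF z] norm_mult norm_power z)
    qed
    have "norm (poly_at p h) ^ N = norm (poly_at p h ^ N)"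
      unfolding N_def by (rule norm_power2_self_adjoint[symmetric]) (simp add: star_poly_at h)
    also have "poly_at p h ^ N = poly_at q w * star w ^ n"
      unfolding q(2) by (simp add: mult.assoc ww)
    also have "norm \<dots> \<le> norm (poly_at q w) * norm (star w ^ n)" by (rule norm_mult_ineq)
    also have "\<dots> \<le> norm (poly_at q w) * 1" by (intro mult_left_mono wn) auto
    also have "\<dots> \<le> (\<Sum>i\<le>2 * n. norm (coeff q i *\<^sub>R w ^ i))"
      unfolding poly_at_eq_sum[OF q(1)] by (simp only: mult_1_right norm_sum)
    also have "\<dots> \<le> (\<Sum>i\<le>2 * n. s ^ N)"
    proof (rule sum_mono)
      fix i
      have "\<bar>coeff q i\<bar> * norm (w ^ i) \<le> s ^ N * 1"
        using c wn by (intro mult_mono) (auto simp: s0)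
      then show "norm (coeff q i *\<^sub>R w ^ i) \<le> s ^ N" by simp
    qed
    also have "\<dots> = (2 * real (degree p) * 2 ^ j + 1) * s ^ N"
      by (simp add: n_def N_def algebra_simps)
    finally show "norm (poly_at p h) ^ 2 ^ j \<le> (2 * real (degree p) * 2 ^ j + 1) * s ^ 2 ^ j"
      by (simp add: N_def)
  qed
qed

section \<open>Continuous functional calculus\<close>

definition approx_by_polys :: "real \<Rightarrow> (real \<Rightarrow> real) \<Rightarrow> (nat \<Rightarrow> real poly) \<Rightarrow> bool" where
  "approx_by_polys M f P \<longleftrightarrow> uniform_limit {-M..M} (\<lambda>n t. poly (P n) t) f sequentially"

lemma approx_by_polysD:
  assumes "approx_by_polys M f P" "e > 0"
  obtains N where "\<And>n t. n \<ge> N \<Longrightarrow> t \<in> {-M..M} \<Longrightarrow> \<bar>poly (P n) t - f t\<bar> < e"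
proof -
  obtain N where "\<forall>n\<ge>N. \<forall>t\<in>{-M..M}. dist (poly (P n) t) (f t) < e"
    using uniform_limitD[OF assms(1)[unfolded approx_by_polys_def] assms(2)]
    unfolding eventually_sequentially by blast
  then show ?thesis using that[of N] by (simp add: dist_real_def)
qed

text \<open>Functions on [-M, M] are applied to a self-adjoint element of norm less than M. By \<open>cfc_tendsto\<close> below
  the limit is the same for all sequences of polynomials that converge uniformly to f.\<close>

definition cfc :: "real \<Rightarrow> 'a::cstar_algebra \<Rightarrow> (real \<Rightarrow> real) \<Rightarrow> 'a" where
  "cfc M h f = lim (\<lambda>n. poly_at ((SOME P. approx_by_polys M f P) n) h)"

lemma ex_approx_by_polys:
  assumes "continuous_on {-M..M} f"
  obtains P where "approx_by_polys M f P"
proof -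
  have "\<exists>p. \<forall>t\<in>{-M..M}. \<bar>f t - poly p t\<bar> < 1 / real (Suc n)" for n
  proof -
    obtain g where g: "real_polynomial_function g" "\<And>t. t \<in> {-M..M} \<Longrightarrow> \<bar>f t - g t\<bar> < 1 / real (Suc n)"
      using Stone_Weierstrass_real_polynomial_function[of "{-M..M}" f "1 / real (Suc n)"] assms
      by auto
    then obtain a m where "g = (\<lambda>x. \<Sum>i\<le>m. a i * x ^ i)"
      by (auto simp: real_polynomial_function_iff_sum)
    then have "g = poly (\<Sum>i\<le>m. monom (a i) i)"
      by (auto simp: poly_sum poly_monom)
    then show ?thesis using g by blast
  qed
  then obtain P where P: "\<And>n t. t \<in> {-M..M} \<Longrightarrow> \<bar>f t - poly (P n) t\<bar> < 1 / real (Suc n)"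
    by metis
  have "approx_by_polys M f P"
    unfolding approx_by_polys_def
  proof (rule uniform_limitI)
    fix e :: real assume "e > 0"
    then obtain N where N: "1 / real (Suc N) < e" using nat_approx_posE by blast
    have "dist (poly (P n) t) (f t) < e" if "n \<ge> N" "t \<in> {-M..M}" for n t
    proof -
      have "1 / real (Suc n) \<le> 1 / real (Suc N)" using that by (simp add: field_simps)
      then show ?thesis using P[OF that(2), of n] N by (simp add: dist_real_def abs_minus_commute)
    qed
    then show "\<forall>\<^sub>F n in sequentially. \<forall>t\<in>{-M..M}. dist (poly (P n) t) (f t) < e"
      unfolding eventually_sequentially by blast
  qed
  then show ?thesis using that by blast
qed

context
  fixes h :: "'a::cstar_algebra" and M :: real
  assumes h: "star h = h" "norm h < M"
begin

lemma poly_at_diff_small: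
  assumes "approx_by_polys M f P" "approx_by_polys M f Q" "e > 0"
  shows "\<exists>N. \<forall>m\<ge>N. \<forall>n\<ge>N. norm (poly_at (P m) h - poly_at (Q n) h) < e"
proof -
  have e: "e / 3 > 0" using assms(3) by simp
  obtain N1 where N1: "\<And>n t. n \<ge> N1 \<Longrightarrow> t \<in> {-M..M} \<Longrightarrow> \<bar>poly (P n) t - f t\<bar> < e / 3"
    using approx_by_polysD[OF assms(1) e] by blast
  obtain N2 where N2: "\<And>n t. n \<ge> N2 \<Longrightarrow> t \<in> {-M..M} \<Longrightarrow> \<bar>poly (Q n) t - f t\<bar> < e / 3"
    using approx_by_polysD[OF assms(2) e] by blast
  have "norm (poly_at (P m) h - poly_at (Q n) h) < e" if "m \<ge> max N1 N2" "n \<ge> max N1 N2" for m n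
  proof -
    have "norm (poly_at (P m - Q n) h) \<le> 2 * e / 3"
    proof (rule norm_poly_at_le[OF h])
      fix t assume "t \<in> {-M..M}"
      then have "\<bar>poly (P m) t - f t\<bar> < e / 3" "\<bar>poly (Q n) t - f t\<bar> < e / 3"
        using N1 N2 that by auto
      then show "\<bar>poly (P m - Q n) t\<bar> \<le> 2 * e / 3" unfolding poly_diff by linarith
    qed
    then show ?thesis using assms(3) by simp
  qed
  then show ?thesis by blast
qed

lemma cfc_tendsto:
  assumes P: "approx_by_polys M f P"
  shows "(\<lambda>n. poly_at (P n) h) \<longlonglongrightarrow> cfc M h f"
proof -
  define Q where "Q = (SOME P. approx_by_polys M f P)"
  have Q: "approx_by_polys M f Q" unfolding Q_def using P by (rule someI[of "approx_by_polys M f"])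
  have "Cauchy (\<lambda>n. poly_at (Q n) h)"
    using poly_at_diff_small[OF Q Q] by (simp add: Cauchy_def dist_norm)
  then have 1: "(\<lambda>n. poly_at (Q n) h) \<longlonglongrightarrow> cfc M h f"
    unfolding cfc_def Q_def[symmetric] using Cauchy_convergent convergent_LIMSEQ_iff
    by blast
  have "(\<lambda>n. poly_at (P n) h - poly_at (Q n) h) \<longlonglongrightarrow> 0"
    using poly_at_diff_small[OF P Q] unfolding LIMSEQ_iff diff_zero by blast
  from tendsto_add[OF this 1] show ?thesis by simp
qed

lemma cfc_unique: "approx_by_polys M f P \<Longrightarrow> (\<lambda>n. poly_at (P n) h) \<longlonglongrightarrow> y \<Longrightarrow> cfc M h f = y"
  by (rule LIMSEQ_unique[OF cfc_tendsto])

lemma cfc_poly: "cfc M h (poly p) = poly_at p h"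
  by (rule cfc_unique[where P = "\<lambda>_. p"]) (simp_all add: approx_by_polys_def uniform_limit_const)

lemma cfc_const: "cfc M h (\<lambda>_. c) = c *\<^sub>R 1"
proof -
  have "poly [:c:] = (\<lambda>_. c)" by (simp add: fun_eq_iff)
  then show ?thesis using cfc_poly[of "[:c:]"] by simp
qed

lemma cfc_ident: "cfc M h (\<lambda>t. t) = h"
proof -
  have "poly [:0, 1:] = (\<lambda>t::real. t)" by (simp add: fun_eq_iff)
  then show ?thesis using cfc_poly[of "[:0, 1:]"] by simp
qed

lemma cfc_diff:
  assumes "continuous_on {-M..M} f" "continuous_on {-M..M} g"
  shows "cfc M h (\<lambda>t. f t - g t) = cfc M h f - cfc M h g"
proof -
  obtain P Q where PQ: "approx_by_polys M f P" "approx_by_polys M g Q"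
    using ex_approx_by_polys assms by metis
  then have "approx_by_polys M (\<lambda>t. f t - g t) (\<lambda>n. P n - Q n)"
    unfolding approx_by_polys_def poly_diff by (rule uniform_limit_minus)
  then show ?thesis
    by (rule cfc_unique) (auto intro!: tendsto_intros cfc_tendsto PQ)
qed

lemma cfc_mult:
  assumes "continuous_on {-M..M} f" "continuous_on {-M..M} g"
  shows "cfc M h (\<lambda>t. f t * g t) = cfc M h f * cfc M h g"
proof -
  obtain P Q where PQ: "approx_by_polys M f P" "approx_by_polys M g Q"
    using ex_approx_by_polys assms by metis
  have "bounded (f ` {-M..M})" "bounded (g ` {-M..M})"
    using assms by (auto intro!: compact_imp_bounded compact_continuous_image)
  then have "approx_by_polys M (\<lambda>t. f t * g t) (\<lambda>n. P n * Q n)"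
    using PQ unfolding approx_by_polys_def poly_mult by (intro uniform_lim_mult)
  then show ?thesis
    by (rule cfc_unique) (auto intro!: tendsto_intros cfc_tendsto PQ)
qed

lemma norm_cfc_le:
  assumes "continuous_on {-M..M} f" "\<And>t. t \<in> {-M..M} \<Longrightarrow> \<bar>f t\<bar> \<le> s"
  shows "norm (cfc M h f) \<le> s"
proof (rule field_le_epsilon)
  fix e :: real assume e: "e > 0"
  obtain P where P: "approx_by_polys M f P" using ex_approx_by_polys assms by metis
  obtain N where N: "\<And>n t. n \<ge> N \<Longrightarrow> t \<in> {-M..M} \<Longrightarrow> \<bar>poly (P n) t - f t\<bar> < e"
    using approx_by_polysD[OF P e] by blast
  have "norm (poly_at (P n) h) \<le> s + e" if "n \<ge> N" for n
  proof (rule norm_poly_at_le[OF h])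
    fix t assume "t \<in> {-M..M}"
    then show "\<bar>poly (P n) t\<bar> \<le> s + e" using N[OF that, of t] assms(2)[of t] by linarith
  qed
  then have "\<forall>\<^sub>F n in sequentially. norm (poly_at (P n) h) \<le> s + e"
    unfolding eventually_sequentially by blast
  then show "norm (cfc M h f) \<le> s + e"
    by (intro tendsto_upperbound[OF tendsto_norm[OF cfc_tendsto[OF P]]]) auto
qed

lemma norm_cfc_diff_le:
  assumes "continuous_on {-M..M} f" "continuous_on {-M..M} g"
    "\<And>t. t \<in> {-M..M} \<Longrightarrow> \<bar>f t - g t\<bar> \<le> s"
  shows "norm (cfc M h f - cfc M h g) \<le> s"
  using norm_cfc_le[of "\<lambda>t. f t - g t" s] assms by (simp add: cfc_diff continuous_on_diff)

lemma cfc_cong: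
  assumes "continuous_on {-M..M} f" "continuous_on {-M..M} g" "\<And>t. t \<in> {-M..M} \<Longrightarrow> f t = g t"
  shows "cfc M h f = cfc M h g"
  using norm_cfc_diff_le[OF assms(1,2), of 0] assms(3) by simp

lemma star_cfc:
  assumes "continuous_on {-M..M} f"
  shows "star (cfc M h f) = cfc M h f"
proof -
  obtain P where P: "approx_by_polys M f P" using ex_approx_by_polys assms by metis
  have "(\<lambda>n. star (poly_at (P n) h)) \<longlonglongrightarrow> star (cfc M h f)"
    by (rule bounded_linear.tendsto[OF bounded_linear_star cfc_tendsto[OF P]])
  then show ?thesis
    by (intro cfc_unique[OF P, symmetric]) (simp add: star_poly_at h)
qed

lemma cfc_mem:
  assumes "cstar_subalgebra A" "h \<in> A" "continuous_on {-M..M} f"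
  shows "cfc M h f \<in> A"
proof -
  interpret cstar_subalgebra A by fact
  obtain P where P: "approx_by_polys M f P" using ex_approx_by_polys assms by metis
  show ?thesis
    by (rule closed_sequentially[OF closed _ cfc_tendsto[OF P]]) (simp add: poly_at_mem assms)
qed

end

section \<open>Representations are contractive and have closed range\<close>

lemma inner_star: "inner (op_apply T x) y = inner x (op_apply (star T) (y :: 'h::chilbert_space))"
  using cinner_star[of T x y] by (simp flip: Re_cinner)

lemma norm_op_apply_power2:
  "(norm (op_apply T (x :: 'h::chilbert_space)))\<^sup>2 = inner (op_apply (star T * T) x) x"
  using inner_star[of "star T" "op_apply T x" x]
  by (simp add: power2_norm_eq_inner op_mult star_star)

text \<open>With S a square root, this is how both \<rho> and its restriction to the continuous functions are shown
  to be contractive.\<close>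

lemma norm_le_of_sum_squares:
  fixes S T :: "'h::chilbert_space bounded_op"
  assumes "star T * T + star S * S = r\<^sup>2 *\<^sub>R 1" "0 \<le> r"
  shows "norm T \<le> r"
proof (rule norm_op_bound[OF assms(2)])
  fix x :: 'h
  have "(norm (op_apply T x))\<^sup>2 + (norm (op_apply S x))\<^sup>2 = (r * norm x)\<^sup>2"
    unfolding norm_op_apply_power2 inner_add_left[symmetric] op_add[symmetric] assms(1)
    by (simp add: op_scaleR op_one power_mult_distrib power2_norm_eq_inner)
  then have "(norm (op_apply T x))\<^sup>2 \<le> (r * norm x)\<^sup>2"
    using zero_le_power2[of "norm (op_apply S x)"] by linarith
  then show "norm (op_apply T x) \<le> r * norm x"
    by (rule power2_le_imp_le) (simp add: assms(2))
qed

locale star_rep = cstar_subalgebra A for A :: "'a::cstar_algebra set" +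
  fixes \<rho> :: "'a \<Rightarrow> 'h::chilbert_space bounded_op"
  assumes hom: "unital_star_hom A \<rho>"
begin

lemma rep_one: "\<rho> 1 = 1"
  and rep_add: "x \<in> A \<Longrightarrow> y \<in> A \<Longrightarrow> \<rho> (x + y) = \<rho> x + \<rho> y"
  and rep_mult: "x \<in> A \<Longrightarrow> y \<in> A \<Longrightarrow> \<rho> (x * y) = \<rho> x * \<rho> y"
  and rep_scaleC: "x \<in> A \<Longrightarrow> \<rho> (c *\<^sub>C x) = c *\<^sub>C \<rho> x"
  and rep_star: "x \<in> A \<Longrightarrow> \<rho> (star x) = star (\<rho> x)"
  using hom by (auto simp: unital_star_hom_def)

lemma rep_scaleR: "x \<in> A \<Longrightarrow> \<rho> (r *\<^sub>R x) = r *\<^sub>R \<rho> x"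
  using rep_scaleC[of x "of_real r"] by (simp add: scaleC_of_real)

lemma rep_zero: "\<rho> 0 = 0"
  using rep_scaleR[OF one_mem, of 0] by simp

lemma rep_diff: "x \<in> A \<Longrightarrow> y \<in> A \<Longrightarrow> \<rho> (x - y) = \<rho> x - \<rho> y"
  using rep_add[of "x - y" y] by (simp add: mem)

lemma rep_sum: "(\<And>i. i \<in> I \<Longrightarrow> f i \<in> A) \<Longrightarrow> \<rho> (sum f I) = (\<Sum>i\<in>I. \<rho> (f i))"
  by (induction I rule: infinite_finite_induct) (simp_all add: rep_zero rep_add mem)

lemma rep_poly_at: "x \<in> A \<Longrightarrow> \<rho> (poly_at p x) = poly_at p (\<rho> x)"
  by (induction p) (simp_all add: rep_zero rep_one rep_add rep_scaleR rep_mult mem poly_at_mem)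

text \<open>For r > \<parallel>a\<parallel> the element r^2 - a^* a is a square in A, and a homomorphism preserves this.\<close>

lemma norm_rep_le:
  assumes a: "a \<in> A"
  shows "norm (\<rho> a) \<le> norm a"
proof (rule field_le_epsilon)
  fix e :: real assume "e > 0"
  define r where "r = norm a + e"
  have r: "norm a < r" "0 < r" using \<open>e > 0\<close> norm_ge_zero[of a] by (auto simp: r_def simp del: norm_ge_zero)
  from a r(1) obtain y where y: "y \<in> A" "star y = y" "y * y = r\<^sup>2 *\<^sub>R 1 - star a * a"
    by (rule sqrt_norm_diff)
  have "star (\<rho> y) * \<rho> y = \<rho> (r\<^sup>2 *\<^sub>R 1 - star a * a)"
    using y by (simp flip: rep_star rep_mult)
  then have "star (\<rho> a) * \<rho> a + star (\<rho> y) * \<rho> y = r\<^sup>2 *\<^sub>R 1"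
    using a by (simp add: rep_diff rep_scaleR rep_one rep_mult rep_star mem)
  then show "norm (\<rho> a) \<le> norm a + e"
    unfolding r_def[symmetric] by (rule norm_le_of_sum_squares) (use r in simp)
qed

lemma rep_tendsto:
  assumes "\<And>n. a n \<in> A" "b \<in> A" "a \<longlonglongrightarrow> b"
  shows "(\<lambda>n. \<rho> (a n)) \<longlonglongrightarrow> \<rho> b"
proof -
  have le: "norm (\<rho> (a n) - \<rho> b) \<le> norm (a n - b)" for n
    using norm_rep_le[of "a n - b"] assms(1,2) by (simp add: diff_mem rep_diff)
  moreover have "(\<lambda>n. norm (a n - b)) \<longlonglongrightarrow> 0"
    using assms(3) by (simp add: LIM_zero tendsto_norm_zero)
  ultimately have "(\<lambda>n. \<rho> (a n) - \<rho> b) \<longlonglongrightarrow> 0"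
    by (intro Lim_null_comparison[OF always_eventually[OF allI[OF le]]])
  then show ?thesis by (rule LIM_zero_cancel)
qed

text \<open>The interval may shrink because \<rho>(h) may have smaller norm than h; so the values of f outside [-N, N]
  change f(h) but not its image.\<close>

lemma rep_cfc:
  assumes h: "h \<in> A" "star h = h" "norm h < M" "norm (\<rho> h) < N" "N \<le> M"
    and f: "continuous_on {-M..M} f"
  shows "\<rho> (cfc M h f) = cfc N (\<rho> h) f"
proof -
  obtain P where P: "approx_by_polys M f P" using ex_approx_by_polys f by metis
  then have P': "approx_by_polys N f P"
    unfolding approx_by_polys_def by (rule uniform_limit_on_subset) (use h(5) in auto)
  have c: "cfc M h f \<in> A" by (rule cfc_mem[OF h(2,3) cstar_subalgebra_axioms h(1) f])
  have "(\<lambda>n. \<rho> (poly_at (P n) h)) \<longlonglongrightarrow> \<rho> (cfc M h f)"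
    by (rule rep_tendsto[OF _ c cfc_tendsto[OF h(2,3) P]]) (simp add: poly_at_mem h)
  moreover have "star (\<rho> h) = \<rho> h" using h rep_star by metis
  ultimately show ?thesis
    using cfc_unique[OF _ h(4) P'] by (simp add: rep_poly_at h)
qed

text \<open>Let \<rho>(b) = c with \<parallel>c\<parallel> = 1 and replace b by a = b f(h), where h = b^* b and f(t) is 1 for \<bar>t\<bar> \<le> 2 and
  \<surd>(2 / \<bar>t\<bar>) beyond. As \<parallel>\<rho>(h)\<parallel> = 1, the image does not change, while \<parallel>a\<parallel>^2 = \<parallel>f(h) h f(h)\<parallel> is at most
  sup \<bar>t\<bar> f(t)^2 = 2.\<close>

lemma bounded_lift:
  assumes "c \<in> \<rho> ` A"
  obtains a where "a \<in> A" "\<rho> a = c" "norm a \<le> 2 * norm c"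
proof -
  have unit: "\<exists>a\<in>A. \<rho> a = c \<and> norm a \<le> 2" if c: "c \<in> \<rho> ` A" "norm c = 1" for c
  proof -
    obtain b where b: "b \<in> A" "\<rho> b = c" using c by auto
    define h where "h = star b * b"
    define M where "M = norm h + 2"
    define f :: "real \<Rightarrow> real" where "f t = sqrt (1 / max 1 (\<bar>t\<bar> / 2))" for t
    have h: "h \<in> A" "star h = h" "norm h < M"
      using b by (auto simp: h_def M_def star_mult star_star intro: mem)
    have f: "continuous_on S f" for S
      unfolding f_def by (intro continuous_intros) auto
    have hc: "\<rho> h = star c * c" using b by (simp add: h_def rep_mult rep_star mem)
    have "cfc 2 (\<rho> h) f = cfc 2 (\<rho> h) (\<lambda>_. 1)"
      by (rule cfc_cong) (auto simp: hc cstar_identity c star_mult star_star f, simp add: f_def)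
    also have "\<dots> = 1"
      by (subst cfc_const) (simp_all add: hc cstar_identity c star_mult star_star)
    finally have 1: "\<rho> (cfc M h f) = 1"
      by (subst rep_cfc[OF h, of 2]) (auto simp: hc cstar_identity c M_def f)
    define a where "a = b * cfc M h f"
    have F: "cfc M h f \<in> A" "star (cfc M h f) = cfc M h f"
      using h f cstar_subalgebra_axioms by (auto intro!: cfc_mem star_cfc)
    have "(norm a)\<^sup>2 = norm (star a * a)" by (simp add: cstar_identity)
    also have "star a * a = cfc M h f * (h * cfc M h f)"
      by (simp add: a_def star_mult F mult.assoc) (simp add: h_def mult.assoc)
    also have "\<dots> = cfc M h (\<lambda>t. f t * (t * f t))"
      using h f by (simp add: cfc_mult cfc_ident continuous_on_mult continuous_on_id)
    also have "norm \<dots> \<le> 2"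
    proof (rule norm_cfc_le[OF h(2,3)])
      fix t :: real
      have "\<bar>f t * (t * f t)\<bar> = \<bar>t\<bar> * (f t * f t)" by (simp add: abs_mult)
      also have "\<dots> = \<bar>t\<bar> / max 1 (\<bar>t\<bar> / 2)" by (simp add: f_def)
      also have "\<dots> \<le> 2" by (simp add: divide_le_eq max_def)
      finally show "\<bar>f t * (t * f t)\<bar> \<le> 2" .
    qed (intro continuous_intros f)
    also have "\<dots> \<le> 2\<^sup>2" by simp
    finally have "norm a \<le> 2" by (rule power2_le_imp_le) simp
    moreover have "a \<in> A" "\<rho> a = c"
      using b F by (auto simp: a_def rep_mult 1 intro: mem)
    ultimately show ?thesis by blast
  qed
  show ?thesis
  proof (cases "c = 0")
    case True
    then show ?thesis using that[of 0] by (simp add: rep_zero zero_mem)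
  next
    case False
    obtain b where b: "b \<in> A" "\<rho> b = c" using assms by auto
    have "(1 / norm c) *\<^sub>R c = \<rho> ((1 / norm c) *\<^sub>R b)" using b by (simp add: rep_scaleR)
    then have "(1 / norm c) *\<^sub>R c \<in> \<rho> ` A" using b by (auto intro: mem)
    from unit[OF this] obtain a where a: "a \<in> A" "\<rho> a = (1 / norm c) *\<^sub>R c" "norm a \<le> 2"
      using False by auto
    show ?thesis
      using that[of "norm c *\<^sub>R a"] a False by (simp add: mem rep_scaleR)
  qed
qed

text \<open>A limit point of the range is the sum of a series of differences in the range whose norms decrease
  geometrically; lifting its terms by \<open>bounded_lift\<close> gives a convergent series in A.\<close>

lemma closed_range: "closed (\<rho> ` A)"
  unfolding closed_sequential_limits
proof (intro allI impI, elim conjE)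
  fix x l assume x: "\<forall>n. x n \<in> \<rho> ` A" and "x \<longlonglongrightarrow> l"
  have "\<exists>y\<in>\<rho> ` A. norm (y - l) < (1/2) ^ n" for n :: nat
  proof -
    have "(1/2::real) ^ n > 0" by simp
    then obtain k where "norm (x k - l) < (1/2) ^ n"
      using \<open>x \<longlonglongrightarrow> l\<close> by (metis LIMSEQ_iff order_refl)
    then show ?thesis using x by blast
  qed
  then obtain y where y: "\<And>n. y n \<in> \<rho> ` A" "\<And>n. norm (y n - l) < (1/2) ^ n" by metis
  define d where "d n = (case n of 0 \<Rightarrow> y 0 | Suc m \<Rightarrow> y (Suc m) - y m)" for n
  have diff: "p - q \<in> \<rho> ` A" if "p \<in> \<rho> ` A" "q \<in> \<rho> ` A" for p q
    using that by (auto simp: mem simp flip: rep_diff)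
  have "d n \<in> \<rho> ` A" for n using y diff by (auto simp: d_def split: nat.split)
  then have "\<exists>a\<in>A. \<rho> a = d n \<and> norm a \<le> 2 * norm (d n)" for n
    using bounded_lift by metis
  then obtain a where a: "\<And>n. a n \<in> A" "\<And>n. \<rho> (a n) = d n" "\<And>n. norm (a n) \<le> 2 * norm (d n)"
    by metis
  have sum_d: "(\<Sum>i\<le>n. d i) = y n" for n
    by (induction n) (simp_all add: d_def)
  have nd: "norm (d (Suc n)) \<le> 2 * (1/2) ^ n" for n
  proof -
    have "norm (d (Suc n)) = norm ((y (Suc n) - l) - (y n - l))" by (simp add: d_def)
    also have "\<dots> \<le> norm (y (Suc n) - l) + norm (y n - l)" by (rule norm_triangle_ineq4)
    also have "\<dots> \<le> (1/2) ^ Suc n + (1/2) ^ n" using y(2) by (intro add_mono less_imp_le)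
    also have "\<dots> \<le> 2 * (1/2) ^ n" by simp
    finally show ?thesis .
  qed
  have "summable (\<lambda>n. a (Suc n))"
  proof (rule summable_comparison_test)
    show "\<exists>N. \<forall>n\<ge>N. norm (a (Suc n)) \<le> 4 * (1/2) ^ n"
      using a(3) nd by (intro exI allI impI order_trans[OF a(3)]) (simp add: mult_left_mono)
    show "summable (\<lambda>n. 4 * (1/2 :: real) ^ n)"
      by (intro summable_mult summable_geometric) simp
  qed
  then have s: "summable a" by (simp only: summable_Suc_iff)
  then have lim: "(\<lambda>n. \<Sum>i\<le>n. a i) \<longlonglongrightarrow> suminf a" by (rule summable_LIMSEQ')
  have "suminf a \<in> A" using s a(1) by (rule suminf_mem)
  with lim have "(\<lambda>n. \<rho> (\<Sum>i\<le>n. a i)) \<longlonglongrightarrow> \<rho> (suminf a)"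
    by (intro rep_tendsto) (auto intro: mem a)
  then have "y \<longlonglongrightarrow> \<rho> (suminf a)"
    by (simp add: rep_sum a sum_d)
  moreover have "y \<longlonglongrightarrow> l"
  proof (rule LIM_zero_cancel, rule Lim_null_comparison)
    show "\<forall>\<^sub>F n in sequentially. norm (y n - l) \<le> (1/2) ^ n"
      using y(2) by (simp add: less_imp_le)
    show "(\<lambda>n. (1/2 :: real) ^ n) \<longlonglongrightarrow> 0" by (rule LIMSEQ_power_zero) simp
  qed
  ultimately have "l = \<rho> (suminf a)" by (rule LIMSEQ_unique[rotated])
  then show "l \<in> \<rho> ` A" using \<open>suminf a \<in> A\<close> by blast
qed

lemma cstar_subalgebra_range: "cstar_subalgebra (\<rho> ` A)"
proof
  have "1 \<in> \<rho> ` A" using one_mem rep_one by force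
  then show "star_subalgebra (\<rho> ` A)"
    unfolding star_subalgebra_def
    by (auto simp: mem simp flip: rep_add rep_mult rep_scaleC rep_star)
qed (rule closed_range)

end

section \<open>Characters\<close>

locale character = cstar_subalgebra A for A :: "'a::cstar_algebra set" +
  fixes \<omega> :: "'a \<Rightarrow> complex"
  assumes character: "\<omega> \<in> characters A"
begin

lemma char_add: "x \<in> A \<Longrightarrow> y \<in> A \<Longrightarrow> \<omega> (x + y) = \<omega> x + \<omega> y"
  and char_mult: "x \<in> A \<Longrightarrow> y \<in> A \<Longrightarrow> \<omega> (x * y) = \<omega> x * \<omega> y"
  and char_scaleC: "x \<in> A \<Longrightarrow> \<omega> (c *\<^sub>C x) = c * \<omega> x"
  using character by (auto simp: characters_def linear_functional_def)

lemma char_one: "\<omega> 1 = 1"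
proof -
  obtain x where x: "x \<in> A" "\<omega> x \<noteq> 0" using character by (auto simp: characters_def)
  then show ?thesis using char_mult[OF one_mem x(1)] by simp
qed

lemma char_scaleR: "x \<in> A \<Longrightarrow> \<omega> (r *\<^sub>R x) = of_real r * \<omega> x"
  using char_scaleC[of x "of_real r"] by (simp add: scaleC_of_real)

lemma char_diff: "x \<in> A \<Longrightarrow> y \<in> A \<Longrightarrow> \<omega> (x - y) = \<omega> x - \<omega> y"
  using char_add[of "x - y" y] by (simp add: mem)

lemma char_zero: "\<omega> 0 = 0"
  using char_diff[OF one_mem one_mem] by simp

lemma char_sum: "(\<And>i. i \<in> I \<Longrightarrow> f i \<in> A) \<Longrightarrow> \<omega> (sum f I) = (\<Sum>i\<in>I. \<omega> (f i))"
  by (induction I rule: infinite_finite_induct) (simp_all add: char_zero char_add mem)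

text \<open>Otherwise 1 - x / \<omega>(x) is invertible by the Neumann series, although \<omega> vanishes on it.\<close>

lemma norm_char_le:
  assumes x: "x \<in> A"
  shows "cmod (\<omega> x) \<le> norm x"
proof (rule ccontr)
  assume "\<not> ?thesis"
  then have lt: "norm x < cmod (\<omega> x)" by simp
  then have nz: "\<omega> x \<noteq> 0" using norm_ge_zero[of x] by auto
  define y where "y = 1 - (1 / \<omega> x) *\<^sub>C x"
  have "norm (1 - y) < 1" using lt nz by (simp add: y_def norm_scaleC norm_divide)
  moreover have y: "y \<in> A" unfolding y_def by (intro mem x)
  ultimately obtain z where z: "z \<in> A" "z * y = 1" using inverse_near_one by metis
  have "\<omega> y = 0" using nz x by (simp add: y_def char_diff char_one char_scaleC mem)
  then show False using char_mult[OF z(1) y] z(2) char_one by simp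
qed

text \<open>Compare \<bar>\<omega>(h + i t)\<bar>^2 \<le> \<parallel>h + i t\<parallel>^2 \<le> \<parallel>h\<parallel>^2 + t^2 for real t: the left side contains t^2 and a term linear
  in t with coefficient 2 Im \<omega>(h).\<close>

lemma Im_char_self_adjoint:
  assumes h: "h \<in> A" "star h = h"
  shows "Im (\<omega> h) = 0"
proof (rule ccontr)
  assume nz: "Im (\<omega> h) \<noteq> 0"
  have "(Re (\<omega> h))\<^sup>2 + (Im (\<omega> h) + t)\<^sup>2 \<le> (norm h)\<^sup>2 + t\<^sup>2" for t :: real
  proof -
    define c where "c = \<i> * of_real t"
    define k where "k = h + c *\<^sub>C 1"
    have cc: "c *\<^sub>C c *\<^sub>C 1 = - (t\<^sup>2 *\<^sub>R (1 :: 'a))"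
      using scaleC_of_real[of "- t\<^sup>2" "1 :: 'a"]
      by (simp add: scaleC_scaleC c_def power2_eq_square algebra_simps)
    have "star k * k = (h - c *\<^sub>C 1) * (h + c *\<^sub>C 1)"
      by (simp add: k_def star_add star_scaleC star_one h scaleC_minus_left c_def)
    also have "\<dots> = h * h - c *\<^sub>C c *\<^sub>C 1"
      by (simp add: algebra_simps scaleC_mult_left scaleC_mult_right scaleC_diff scaleC_add_right)
    finally have "star k * k = h * h + t\<^sup>2 *\<^sub>R 1" by (simp add: cc)
    then have "(norm k)\<^sup>2 \<le> norm (h * h) + norm (t\<^sup>2 *\<^sub>R (1::'a))"
      using cstar_identity[of k] norm_triangle_ineq by metis
    also have "\<dots> \<le> (norm h)\<^sup>2 + t\<^sup>2"
      using norm_mult_ineq[of h h] mult_left_mono[OF norm_one_le[where 'a='a], of "t\<^sup>2"]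
      by (simp add: power2_eq_square)
    finally have "(norm k)\<^sup>2 \<le> (norm h)\<^sup>2 + t\<^sup>2" .
    moreover have "(cmod (\<omega> k))\<^sup>2 \<le> (norm k)\<^sup>2"
      by (intro power_mono norm_char_le) (auto simp: k_def intro: mem h)
    moreover have "\<omega> k = \<omega> h + \<i> * of_real t"
      using h by (simp add: k_def c_def char_add char_scaleC char_one mem)
    ultimately show ?thesis by (simp add: cmod_power2)
  qed
  \<comment> \<open>The value of \<open>t\<close> makes the linear term equal to \<open>\<parallel>h\<parallel>\<^sup>2 + 1\<close>.\<close>
  from this[of "((norm h)\<^sup>2 + 1) / (2 * Im (\<omega> h))"]
  have "(Re (\<omega> h))\<^sup>2 + (Im (\<omega> h))\<^sup>2 + ((norm h)\<^sup>2 + 1) \<le> (norm h)\<^sup>2"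
    using nz by (simp add: power2_sum)
  then show False by (smt (verit) zero_le_power2)
qed

lemma char_star:
  assumes x: "x \<in> A"
  shows "\<omega> (star x) = cnj (\<omega> x)"
proof -
  have "Im (\<omega> (x + star x)) = 0"
    by (rule Im_char_self_adjoint) (auto simp: star_add star_star add.commute intro: mem x)
  moreover have "Im (\<omega> (\<i> *\<^sub>C (x - star x))) = 0"
  proof (rule Im_char_self_adjoint)
    have "star (\<i> *\<^sub>C (x - star x)) = (- \<i>) *\<^sub>C (star x - x)"
      by (simp add: star_scaleC star_diff star_star)
    also have "\<dots> = \<i> *\<^sub>C (x - star x)"
      by (simp add: scaleC_minus_left flip: scaleC_minus)
    finally show "star (\<i> *\<^sub>C (x - star x)) = \<i> *\<^sub>C (x - star x)" .
  qed (intro mem x)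
  ultimately show ?thesis
    using x by (simp add: complex_eq_iff char_add char_diff char_scaleC mem)
qed

lemma char_poly_at: "h \<in> A \<Longrightarrow> \<omega> (poly_at p h) = poly_at p (\<omega> h)"
  by (induction p)
    (simp_all add: char_zero char_one char_add char_scaleR char_mult mem poly_at_mem scaleR_conv_of_real)

lemma char_self_adjoint: "h \<in> A \<Longrightarrow> star h = h \<Longrightarrow> \<omega> h = of_real (Re (\<omega> h))"
  by (simp add: Im_char_self_adjoint complex_eq_iff)

lemma char_cfc:
  assumes h: "h \<in> A" "star h = h" "norm h < M" and f: "continuous_on {-M..M} f"
  shows "\<omega> (cfc M h f) = of_real (f (Re (\<omega> h)))"
proof -
  obtain P where P: "approx_by_polys M f P" using ex_approx_by_polys f by metis
  define t where "t = Re (\<omega> h)"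
  have wt: "\<omega> h = of_real t" unfolding t_def by (rule char_self_adjoint[OF h(1,2)])
  have "\<bar>t\<bar> < M" using norm_char_le[OF h(1)] h(3) by (simp add: wt)
  then have tM: "t \<in> {-M..M}" by auto
  have c: "cfc M h f \<in> A" by (rule cfc_mem[OF h(2,3) cstar_subalgebra_axioms h(1) f])
  have le: "cmod (\<omega> (poly_at (P n) h) - \<omega> (cfc M h f)) \<le> norm (poly_at (P n) h - cfc M h f)" for n
    using norm_char_le[of "poly_at (P n) h - cfc M h f"] c h(1)
    by (simp add: diff_mem poly_at_mem char_diff)
  moreover have "(\<lambda>n. norm (poly_at (P n) h - cfc M h f)) \<longlonglongrightarrow> 0"
    using cfc_tendsto[OF h(2,3) P] by (simp add: LIM_zero tendsto_norm_zero)
  ultimately have "(\<lambda>n. \<omega> (poly_at (P n) h) - \<omega> (cfc M h f)) \<longlonglongrightarrow> 0"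
    by (intro Lim_null_comparison[OF always_eventually[OF allI[OF le]]])
  then have "(\<lambda>n. \<omega> (poly_at (P n) h)) \<longlonglongrightarrow> \<omega> (cfc M h f)" by (rule LIM_zero_cancel)
  then have "(\<lambda>n. complex_of_real (poly (P n) t)) \<longlonglongrightarrow> \<omega> (cfc M h f)"
    by (simp add: char_poly_at h(1) wt poly_at_of_real)
  moreover have "(\<lambda>n. complex_of_real (poly (P n) t)) \<longlonglongrightarrow> of_real (f t)"
    using tendsto_uniform_limitI[OF P[unfolded approx_by_polys_def] tM] by (rule tendsto_of_real)
  ultimately show ?thesis unfolding t_def[symmetric] by (rule LIMSEQ_unique)
qed

end

section \<open>Characters of commutative algebras\<close>

locale commutative_cstar = cstar_subalgebra B for B :: "'a::cstar_algebra set" +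
  assumes commute: "x \<in> B \<Longrightarrow> y \<in> B \<Longrightarrow> x * y = y * x"
begin

definition proper_ideal :: "'a set \<Rightarrow> bool" where
  "proper_ideal I \<longleftrightarrow> I \<subseteq> B \<and> 0 \<in> I \<and> 1 \<notin> I \<and>
     (\<forall>x\<in>I. \<forall>y\<in>I. x + y \<in> I) \<and> (\<forall>b\<in>B. \<forall>x\<in>I. b * x \<in> I)"

definition maximal_ideal :: "'a set \<Rightarrow> bool" where
  "maximal_ideal I \<longleftrightarrow> proper_ideal I \<and> (\<forall>I'. proper_ideal I' \<and> I \<subseteq> I' \<longrightarrow> I' = I)"

lemma ex_maximal_ideal:
  assumes "proper_ideal I0"
  obtains I where "maximal_ideal I" "I0 \<subseteq> I"
proof -
  have "\<exists>M\<in>{I. proper_ideal I \<and> I0 \<subseteq> I}. \<forall>X\<in>{I. proper_ideal I \<and> I0 \<subseteq> I}. M \<subseteq> X \<longrightarrow> X = M"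
  proof (rule subset_Zorn_nonempty)
    show "{I. proper_ideal I \<and> I0 \<subseteq> I} \<noteq> {}" using assms by blast
  next
    fix \<C> assume ne: "\<C> \<noteq> {}" and ch: "subset.chain {I. proper_ideal I \<and> I0 \<subseteq> I} \<C>"
    then have sub: "proper_ideal I" "I0 \<subseteq> I" if "I \<in> \<C>" for I
      using that by (auto simp: subset.chain_def)
    have "x + y \<in> \<Union>\<C>" if "x \<in> \<Union>\<C>" "y \<in> \<Union>\<C>" for x y
    proof -
      obtain I J where "I \<in> \<C>" "x \<in> I" "J \<in> \<C>" "y \<in> J"
        using \<open>x \<in> \<Union>\<C>\<close> \<open>y \<in> \<Union>\<C>\<close> by blast
      moreover have "I \<subseteq> J \<or> J \<subseteq> I"
        using ch calculation unfolding subset_chain_def by blast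
      ultimately show ?thesis using sub unfolding proper_ideal_def by blast
    qed
    moreover have "\<Union>\<C> \<subseteq> B" "0 \<in> \<Union>\<C>" "1 \<notin> \<Union>\<C>" "I0 \<subseteq> \<Union>\<C>"
      using sub ne unfolding proper_ideal_def by blast+
    moreover have "\<forall>b\<in>B. \<forall>x\<in>\<Union>\<C>. b * x \<in> \<Union>\<C>"
      using sub unfolding proper_ideal_def by blast
    ultimately show "\<Union>\<C> \<in> {I. proper_ideal I \<and> I0 \<subseteq> I}"
      unfolding proper_ideal_def by simp
  qed
  then obtain M where M: "proper_ideal M" "I0 \<subseteq> M"
    "\<And>X. proper_ideal X \<Longrightarrow> I0 \<subseteq> X \<Longrightarrow> M \<subseteq> X \<Longrightarrow> X = M"
    by auto
  then have "maximal_ideal M" unfolding maximal_ideal_def by (meson order_trans)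
  then show ?thesis using that M(2) by simp
qed

context
  fixes I assumes max: "maximal_ideal I"
begin

lemma ideal: "I \<subseteq> B" "0 \<in> I" "1 \<notin> I" "x \<in> I \<Longrightarrow> y \<in> I \<Longrightarrow> x + y \<in> I"
    "b \<in> B \<Longrightarrow> x \<in> I \<Longrightarrow> b * x \<in> I"
  using max by (auto simp: maximal_ideal_def proper_ideal_def)

lemma ideal_scaleC: "x \<in> I \<Longrightarrow> c *\<^sub>C x \<in> I"
  using ideal(5)[of "c *\<^sub>C 1" x] by (simp add: mem scaleC_mult_left)

lemma ideal_diff: "x \<in> I \<Longrightarrow> y \<in> I \<Longrightarrow> x - y \<in> I"
  using ideal(4)[of x "(-1) *\<^sub>C y"] ideal_scaleC[of y "-1"] by (simp add: scaleC_minus_left)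

lemma maximalD: "proper_ideal I' \<Longrightarrow> I \<subseteq> I' \<Longrightarrow> I' = I"
  using max by (simp add: maximal_ideal_def)

text \<open>The closure of a proper ideal is proper, since elements close to 1 are invertible.\<close>

lemma maximal_ideal_closed:
  assumes "x \<in> B" "\<And>e. e > 0 \<Longrightarrow> \<exists>y\<in>I. norm (x - y) < e"
  shows "x \<in> I"
proof -
  define I' where "I' = {x \<in> B. \<forall>e>0. \<exists>y\<in>I. norm (x - y) < e}"
  have "proper_ideal I'"
    unfolding proper_ideal_def
  proof (intro conjI ballI)
    show "I' \<subseteq> B" by (auto simp: I'_def)
    show "0 \<in> I'" using ideal(2) by (auto simp: I'_def mem intro!: bexI[of _ 0])
    show "1 \<notin> I'"
    proof
      assume "1 \<in> I'"
      then obtain y where y: "y \<in> I" "norm (1 - y) < 1"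
        unfolding I'_def using zero_less_one by blast
      obtain z where "z \<in> B" "z * y = 1"
        by (rule inverse_near_one[of y]) (use y ideal(1) in auto)
      then show False using ideal(3) ideal(5)[of z y] y(1) by simp
    qed
  next
    fix x y assume xy: "x \<in> I'" "y \<in> I'"
    have "\<exists>z\<in>I. norm (x + y - z) < e" if "e > 0" for e
    proof -
      have "e / 2 > 0" using that by simp
      then obtain p q where pq: "p \<in> I" "q \<in> I" "norm (x - p) < e / 2" "norm (y - q) < e / 2"
        using xy unfolding I'_def by blast
      have "norm (x + y - (p + q)) \<le> norm (x - p) + norm (y - q)"
        using norm_triangle_ineq[of "x - p" "y - q"] by (simp add: algebra_simps)
      then have "norm (x + y - (p + q)) < e" using pq by linarith
      then show ?thesis using ideal(4) pq by blast
    qed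
    then show "x + y \<in> I'" using xy by (auto simp: I'_def mem)
  next
    fix b x assume b: "b \<in> B" and x: "x \<in> I'"
    have "\<exists>z\<in>I. norm (b * x - z) < e" if "e > 0" for e
    proof -
      have "e / (norm b + 1) > 0" using that by (simp add: add_nonneg_pos)
      then obtain p where p: "p \<in> I" "norm (x - p) < e / (norm b + 1)"
        using x unfolding I'_def by blast
      have "norm (b * x - b * p) \<le> norm b * norm (x - p)"
        by (simp add: norm_mult_ineq flip: right_diff_distrib)
      also have "\<dots> \<le> (norm b + 1) * norm (x - p)" by (simp add: distrib_right)
      also have "\<dots> < e" using p(2) by (simp add: pos_less_divide_eq add_nonneg_pos mult.commute)
      finally show ?thesis using ideal(5) b p(1) by blast
    qed
    then show "b * x \<in> I'" using b x by (auto simp: I'_def mem)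
  qed
  moreover have "I \<subseteq> I'"
  proof
    fix x assume "x \<in> I"
    then show "x \<in> I'" using ideal(1) unfolding I'_def by (auto intro!: bexI[of _ x])
  qed
  ultimately have "I' = I" by (rule maximalD)
  then show ?thesis using assms by (auto simp: I'_def)
qed

lemma maximal_ideal_prime:
  assumes "x \<in> B" "y \<in> B" "x * y \<in> I" "x \<notin> I"
  shows "y \<in> I"
proof -
  define I' where "I' = {i + b * x |i b. i \<in> I \<and> b \<in> B}"
  have mem': "i + b * x \<in> I'" if "i \<in> I" "b \<in> B" for i b
    using that by (auto simp: I'_def)
  have sub: "I \<subseteq> I'"
    using mem'[OF _ zero_mem] by auto
  have "x \<in> I'" using mem'[OF ideal(2) one_mem] by simp
  then have "I' \<noteq> I" using assms(4) by blast
  then have "\<not> proper_ideal I'" using maximalD sub by blast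
  moreover have "I' \<subseteq> B" using assms(1) ideal(1) by (auto simp: I'_def intro!: mem)
  moreover have "0 \<in> I'" using sub ideal(2) by blast
  moreover have "u + v \<in> I'" if "u \<in> I'" "v \<in> I'" for u v
  proof -
    obtain i b j c where *: "i \<in> I" "b \<in> B" "u = i + b * x" "j \<in> I" "c \<in> B" "v = j + c * x"
      using \<open>u \<in> I'\<close> \<open>v \<in> I'\<close> unfolding I'_def by blast
    then have "u + v = (i + j) + (b + c) * x" by (simp add: algebra_simps)
    then show ?thesis using * mem' ideal(4) add_mem by metis
  qed
  moreover have "c * u \<in> I'" if "c \<in> B" "u \<in> I'" for c u
  proof -
    obtain i b where *: "i \<in> I" "b \<in> B" "u = i + b * x"
      using \<open>u \<in> I'\<close> unfolding I'_def by blast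
    then have "c * u = c * i + (c * b) * x" by (simp add: algebra_simps)
    then show ?thesis using * that(1) mem' ideal(5) mult_mem by metis
  qed
  ultimately have "1 \<in> I'" unfolding proper_ideal_def by blast
  then obtain i b where *: "i \<in> I" "b \<in> B" "1 = i + b * x" unfolding I'_def by blast
  then have "y = (i + b * x) * y" by simp
  then have "y = i * y + b * (x * y)" by (simp only: distrib_right mult.assoc)
  moreover have "i * y = y * i" using * ideal(1) assms by (intro commute) auto
  ultimately show ?thesis using ideal(4,5) * assms by metis
qed

text \<open>For every real l the positive part p l and the negative part n l of h - l have product 0, so one of
  them is in the prime ideal I. Let s be the infimum of the l with p l \<in> I. Both parts depend
  continuously on l and I is closed, so p s and n s are in I, and so is h - s. This argument takes the
  place of the Gelfand--Mazur theorem.\<close>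

lemma self_adjoint_mod_maximal_ideal:
  assumes h: "h \<in> B" "star h = h"
  obtains l :: real where "h - l *\<^sub>R 1 \<in> I"
proof -
  define M where "M = norm h + 1"
  have M: "norm h < M" "0 < M" by (auto simp: M_def add_nonneg_pos)
  define p where "p l = cfc M h (\<lambda>t. max (t - l) 0)" for l
  define n where "n l = cfc M h (\<lambda>t. max (l - t) 0)" for l
  have pB: "p l \<in> B" "n l \<in> B" for l
    unfolding p_def n_def
    by (intro cfc_mem[OF h(2) M(1) cstar_subalgebra_axioms h(1)] continuous_intros)+
  have "p l * n l = 0" for l
  proof -
    have "p l * n l = cfc M h (\<lambda>t. max (t - l) 0 * max (l - t) 0)"
      unfolding p_def n_def by (intro cfc_mult[OF h(2) M(1), symmetric] continuous_intros)
    also have "\<dots> = cfc M h (\<lambda>t. 0)"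
      by (rule arg_cong[where f = "cfc M h"]) (auto simp: max_def fun_eq_iff)
    finally show ?thesis by (simp add: cfc_const[OF h(2) M(1)])
  qed
  then have pn: "p l \<in> I \<or> n l \<in> I" for l
    using maximal_ideal_prime[OF pB] ideal(2) by metis
  have diff: "p l - n l = h - l *\<^sub>R 1" for l
  proof -
    have "p l - n l = cfc M h (\<lambda>t. max (t - l) 0 - max (l - t) 0)"
      unfolding p_def n_def by (intro cfc_diff[OF h(2) M(1), symmetric] continuous_intros)
    also have "\<dots> = cfc M h (\<lambda>t. t - l)"
      by (rule arg_cong[where f = "cfc M h"]) (auto simp: max_def fun_eq_iff)
    also have "\<dots> = h - l *\<^sub>R 1"
      by (subst cfc_diff[OF h(2) M(1)]) (auto simp: cfc_const[OF h(2) M(1)] cfc_ident[OF h(2) M(1)]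
          intro: continuous_intros)
    finally show ?thesis .
  qed
  have lip: "norm (p l - p l') \<le> \<bar>l - l'\<bar>" "norm (n l - n l') \<le> \<bar>l - l'\<bar>" for l l'
    unfolding p_def n_def
    by (rule norm_cfc_diff_le[OF h(2) M(1)]; (intro continuous_intros)?; auto)+
  have ends: "p M = 0" "n (- M) = 0"
  proof -
    have "p M = cfc M h (\<lambda>t. 0)"
      unfolding p_def by (rule cfc_cong[OF h(2) M(1)]) (intro continuous_intros | simp add: max_def)+
    moreover have "n (- M) = cfc M h (\<lambda>t. 0)"
      unfolding n_def by (rule cfc_cong[OF h(2) M(1)]) (intro continuous_intros | simp add: max_def)+
    ultimately show "p M = 0" "n (- M) = 0" by (simp_all add: cfc_const[OF h(2) M(1)])
  qed
  define S where "S = {l \<in> {-M..M}. p l \<in> I}"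
  have S: "M \<in> S" "bdd_below S" using M ends ideal(2) by (auto simp: S_def intro!: bdd_belowI[of _ "-M"])
  define s where "s = Inf S"
  have sM: "- M \<le> s" unfolding s_def using S by (intro cInf_greatest) (auto simp: S_def)
  have "p s \<in> I"
  proof (rule maximal_ideal_closed[OF pB(1)])
    fix e :: real assume "e > 0"
    then obtain l where l: "l \<in> S" "l < s + e"
      using cInf_lessD[of S "s + e"] S unfolding s_def by auto
    have "s \<le> l" unfolding s_def using l S by (intro cInf_lower)
    then have "norm (p s - p l) < e" using lip(1)[of s l] l by linarith
    then show "\<exists>y\<in>I. norm (p s - y) < e" using l by (auto simp: S_def)
  qed
  moreover have "n s \<in> I"
  proof (cases "s = - M")
    case True
    then show ?thesis using ends ideal(2) by simp
  next
    case False
    show ?thesis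
    proof (rule maximal_ideal_closed[OF pB(2)])
      fix e :: real assume e: "e > 0"
      \<comment> \<open>Below \<open>s\<close> the positive part is not in \<open>I\<close>, so the negative part is.\<close>
      define l where "l = max (- M) (s - e / 2)"
      have l: "l < s" "- M \<le> l" "\<bar>s - l\<bar> < e"
        using e sM False by (auto simp: l_def max_def)
      have "s \<le> M" unfolding s_def using S by (intro cInf_lower)
      have "l \<notin> S"
        using cInf_lower[OF _ S(2), of l] l(1) unfolding s_def by auto
      then have "p l \<notin> I" using l \<open>s \<le> M\<close> by (simp add: S_def)
      then have "n l \<in> I" using pn by blast
      moreover have "norm (n s - n l) < e" using lip(2)[of s l] l(3) by linarith
      ultimately show "\<exists>y\<in>I. norm (n s - y) < e" by blast
    qed
  qed
  ultimately show ?thesis using that[of s] ideal_diff diff by metis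
qed

lemma maximal_ideal_eq_kernel:
  obtains \<omega> where "\<omega> \<in> characters B" "\<And>x. x \<in> I \<Longrightarrow> \<omega> x = 0"
proof -
  have ex: "\<exists>c. b - c *\<^sub>C 1 \<in> I" if b: "b \<in> B" for b
  proof -
    define h k where "h = (1/2) *\<^sub>R (b + star b)" and "k = (1/2) *\<^sub>R (\<i> *\<^sub>C (star b - b))"
    have "h \<in> B" "star h = h" using b
      by (auto simp: h_def star_scaleR star_add star_star add.commute intro!: mem)
    then obtain l where l: "h - l *\<^sub>R 1 \<in> I" using self_adjoint_mod_maximal_ideal by metis
    have "k \<in> B" using b by (auto simp: k_def intro!: mem)
    moreover have "star k = k"
      by (simp add: k_def star_scaleR star_scaleC star_diff star_star scaleC_minus_left scaleC_diff)
    ultimately obtain m where m: "k - m *\<^sub>R 1 \<in> I" using self_adjoint_mod_maximal_ideal by metis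
    have "\<i> *\<^sub>C k = (1/2) *\<^sub>R (b - star b)"
      unfolding k_def by (simp add: scaleC_of_real[symmetric] scaleC_scaleC)
        (simp add: mult.commute[of \<i>] scaleC_diff scaleC_minus_left scaleC_i_i flip: scaleC_scaleC)
    then have "h + \<i> *\<^sub>C k = (1/2) *\<^sub>R (b + b)"
      by (simp add: h_def flip: scaleR_add_right)
    then have b_eq: "h + \<i> *\<^sub>C k = b" by (simp flip: scaleR_2)
    have "(h - l *\<^sub>R 1) + \<i> *\<^sub>C (k - m *\<^sub>R 1) \<in> I" by (intro ideal(4) ideal_scaleC l m)
    also have "(h - l *\<^sub>R 1) + \<i> *\<^sub>C (k - m *\<^sub>R 1) = b - (of_real l + \<i> * of_real m) *\<^sub>C 1"
      by (simp add: scaleC_diff scaleC_add_left scaleC_of_real b_eq[symmetric] flip: scaleC_scaleC)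
    finally show ?thesis by blast
  qed
  have uniq: "c = d" if "b - c *\<^sub>C 1 \<in> I" "b - d *\<^sub>C 1 \<in> I" for b c d
  proof (rule ccontr)
    assume "c \<noteq> d"
    have "(b - c *\<^sub>C 1) - (b - d *\<^sub>C 1) \<in> I" by (rule ideal_diff[OF that])
    then have "(d - c) *\<^sub>C 1 \<in> I"
      using scaleC_add_left[of "d - c" c "1 :: 'a"] by (simp add: algebra_simps)
    then have "(1 / (d - c)) *\<^sub>C (d - c) *\<^sub>C 1 \<in> I" by (rule ideal_scaleC)
    then show False using \<open>c \<noteq> d\<close> ideal(3) by (simp add: scaleC_scaleC)
  qed
  define \<omega> where "\<omega> = restrict (\<lambda>b. THE c. b - c *\<^sub>C 1 \<in> I) B"
  have \<omega>I: "\<omega> b = c" if "b \<in> B" "b - c *\<^sub>C 1 \<in> I" for b c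
    unfolding \<omega>_def using that uniq by (auto intro!: the_equality)
  have \<omega>: "b - \<omega> b *\<^sub>C 1 \<in> I" if "b \<in> B" for b
    using ex[OF that] \<omega>I[OF that] by metis
  have "\<omega> \<in> characters B"
    unfolding characters_def linear_functional_def
  proof (intro CollectI conjI ballI allI)
    show "\<omega> \<in> extensional B" by (simp add: \<omega>_def)
    have "\<omega> 1 = 1" by (rule \<omega>I[OF one_mem]) (simp add: ideal(2))
    then show "\<exists>x\<in>B. \<omega> x \<noteq> 0" using one_mem by force
  next
    fix x y assume xy: "x \<in> B" "y \<in> B"
    show "\<omega> (x + y) = \<omega> x + \<omega> y"
      using ideal(4)[OF \<omega>[OF xy(1)] \<omega>[OF xy(2)]]
      by (intro \<omega>I add_mem xy) (simp add: scaleC_add_left algebra_simps)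
    have "y * (x - \<omega> x *\<^sub>C 1) + \<omega> x *\<^sub>C (y - \<omega> y *\<^sub>C 1) \<in> I"
      by (intro ideal(4,5) ideal_scaleC \<omega> xy)
    also have "y * (x - \<omega> x *\<^sub>C 1) + \<omega> x *\<^sub>C (y - \<omega> y *\<^sub>C 1) = x * y - (\<omega> x * \<omega> y) *\<^sub>C 1"
      by (simp add: right_diff_distrib scaleC_mult_right scaleC_diff scaleC_scaleC commute xy)
    finally show "\<omega> (x * y) = \<omega> x * \<omega> y" by (intro \<omega>I mult_mem xy)
  next
    fix c x assume x: "x \<in> B"
    show "\<omega> (c *\<^sub>C x) = c * \<omega> x"
      using ideal_scaleC[OF \<omega>[OF x], of c]
      by (intro \<omega>I scaleC_mem x) (simp add: scaleC_diff scaleC_scaleC)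
  qed
  moreover have "\<omega> x = 0" if "x \<in> I" for x
    using that ideal(1) by (intro \<omega>I) auto
  ultimately show ?thesis using that by blast
qed

end

end

text \<open>With r = \<parallel>d\<parallel>, the hypothesis gives \<parallel>v\<parallel> \<le> \<parallel>b\<parallel> \<parallel>(r^2 - d^* d) v\<parallel> for all v. Expanding the right side
  bounds \<parallel>d v\<parallel> away from r \<parallel>v\<parallel>, uniformly in v.\<close>

lemma norm_gap_invertible:
  fixes b d :: "'h::chilbert_space bounded_op"
  assumes inv: "b * ((norm d)\<^sup>2 *\<^sub>R 1 - star d * d) = 1"
  shows "d = 0"
proof (rule ccontr)
  assume "d \<noteq> 0"
  then have r: "norm d > 0" by simp
  define r where "r = norm d"
  define h where "h = star d * d"
  have "b \<noteq> 0"
  proof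
    assume "b = 0"
    then have "(1 :: 'h bounded_op) = 0" using inv by simp
    then have "d = 0" by (metis mult_1 mult_zero_left)
    then show False using \<open>d \<noteq> 0\<close> by simp
  qed
  define K where "K = (norm b)\<^sup>2"
  have K: "K > 0" using \<open>b \<noteq> 0\<close> by (simp add: K_def)
  have key: "(norm (op_apply d x))\<^sup>2 \<le> (r\<^sup>2 - 1 / (K * r\<^sup>2)) * (norm x)\<^sup>2" for x
  proof -
    have "norm x = norm (op_apply b (op_apply (r\<^sup>2 *\<^sub>R 1 - h) x))"
      using inv by (simp add: r_def h_def op_one flip: op_mult)
    also have "\<dots> \<le> norm b * norm (op_apply (r\<^sup>2 *\<^sub>R 1 - h) x)" by (rule norm_op_apply)
    finally have "(norm x)\<^sup>2 \<le> (norm b * norm (op_apply (r\<^sup>2 *\<^sub>R 1 - h) x))\<^sup>2"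
      by (rule power_mono) simp
    then have 1: "(norm x)\<^sup>2 \<le> K * (norm (op_apply (r\<^sup>2 *\<^sub>R 1 - h) x))\<^sup>2"
      by (simp add: K_def power_mult_distrib)
    have "norm (op_apply h x) \<le> r * norm (op_apply d x)"
      using norm_op_apply[of "star d" "op_apply d x"] by (simp add: h_def op_mult norm_star r_def)
    then have hx: "(norm (op_apply h x))\<^sup>2 \<le> r\<^sup>2 * (norm (op_apply d x))\<^sup>2"
      using power_mono[of _ _ 2] by (fastforce simp: power_mult_distrib)
    have "(norm (op_apply (r\<^sup>2 *\<^sub>R 1 - h) x))\<^sup>2 =
        r\<^sup>2 * r\<^sup>2 * (norm x)\<^sup>2 - 2 * r\<^sup>2 * inner (op_apply h x) x + (norm (op_apply h x))\<^sup>2"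
      by (simp add: op_diff op_scaleR op_one power2_norm_eq_inner inner_diff_left inner_diff_right
          inner_commute algebra_simps)
    also have "inner (op_apply h x) x = (norm (op_apply d x))\<^sup>2"
      by (simp add: h_def norm_op_apply_power2)
    finally have "(norm (op_apply (r\<^sup>2 *\<^sub>R 1 - h) x))\<^sup>2 \<le>
        r\<^sup>2 * r\<^sup>2 * (norm x)\<^sup>2 - r\<^sup>2 * (norm (op_apply d x))\<^sup>2"
      using hx by simp
    from order_trans[OF 1 mult_left_mono[OF this, of K]] K
    have "K * r\<^sup>2 * (norm (op_apply d x))\<^sup>2 \<le> (K * r\<^sup>2 * r\<^sup>2 - 1) * (norm x)\<^sup>2"
      by (simp add: algebra_simps)
    then have "(norm (op_apply d x))\<^sup>2 \<le> (K * r\<^sup>2 * r\<^sup>2 - 1) * (norm x)\<^sup>2 / (K * r\<^sup>2)"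
      using K r by (simp add: r_def pos_le_divide_eq mult.commute)
    also have "\<dots> = (r\<^sup>2 - 1 / (K * r\<^sup>2)) * (norm x)\<^sup>2"
      using K r by (simp add: r_def field_simps)
    finally show ?thesis .
  qed
  define q where "q = r\<^sup>2 - 1 / (K * r\<^sup>2)"
  have "norm d \<le> sqrt (max 0 q)"
  proof (rule norm_op_bound)
    fix x
    have "(norm (op_apply d x))\<^sup>2 \<le> max 0 q * (norm x)\<^sup>2"
      using key[of x] mult_right_mono[of q "max 0 q" "(norm x)\<^sup>2"] by (simp add: q_def)
    then have "sqrt ((norm (op_apply d x))\<^sup>2) \<le> sqrt (max 0 q * (norm x)\<^sup>2)" by (rule real_sqrt_le_mono)
    then show "norm (op_apply d x) \<le> sqrt (max 0 q) * norm x" by (simp add: real_sqrt_mult)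
  qed simp
  then have "r\<^sup>2 \<le> (sqrt (max 0 q))\<^sup>2" unfolding r_def by (rule power_mono) simp
  then have "r\<^sup>2 \<le> max 0 q" by simp
  moreover have "q < r\<^sup>2" using K r by (simp add: q_def r_def)
  ultimately show False using r by (simp add: r_def max_def split: if_splits)
qed

text \<open>By \<open>norm_gap_invertible\<close> the ideal generated by \<parallel>d\<parallel>^2 - d^* d is proper. A character that vanishes on it takes a
  value of modulus \<parallel>d\<parallel> at d.\<close>

lemma ex_character_nonzero:
  fixes B :: "'h::chilbert_space bounded_op set"
  assumes B: "commutative_cstar B" and d: "d \<in> B" "d \<noteq> 0"
  obtains \<omega> where "\<omega> \<in> characters B" "\<omega> d \<noteq> 0"
proof -
  interpret commutative_cstar B by fact
  define k where "k = (norm d)\<^sup>2 *\<^sub>R 1 - star d * d"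
  have k: "k \<in> B" using d by (auto simp: k_def intro!: mem)
  have "proper_ideal ((\<lambda>b. b * k) ` B)"
    unfolding proper_ideal_def
  proof (intro conjI ballI)
    show "1 \<notin> (\<lambda>b. b * k) ` B"
      using norm_gap_invertible[of _ d] d(2) unfolding k_def by force
    show "0 \<in> (\<lambda>b. b * k) ` B" using zero_mem by force
    show "(\<lambda>b. b * k) ` B \<subseteq> B" using k by (auto intro: mem)
  next
    fix x y assume "x \<in> (\<lambda>b. b * k) ` B" "y \<in> (\<lambda>b. b * k) ` B"
    then show "x + y \<in> (\<lambda>b. b * k) ` B" by (auto simp: add_mem simp flip: distrib_right)
  next
    fix b x assume "b \<in> B" "x \<in> (\<lambda>b. b * k) ` B"
    then show "b * x \<in> (\<lambda>b. b * k) ` B" by (auto simp: mult_mem simp flip: mult.assoc)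
  qed
  then obtain I where I: "maximal_ideal I" "(\<lambda>b. b * k) ` B \<subseteq> I" by (rule ex_maximal_ideal)
  obtain \<omega> where \<omega>: "\<omega> \<in> characters B" "\<And>x. x \<in> I \<Longrightarrow> \<omega> x = 0"
    using maximal_ideal_eq_kernel[OF I(1)] by blast
  interpret character B \<omega> using \<omega>(1) by unfold_locales
  have "1 * k \<in> I" using I(2) one_mem by blast
  then have "\<omega> k = 0" using \<omega>(2) by simp
  then have "of_real ((norm d)\<^sup>2) = \<omega> (star d) * \<omega> d"
    using d by (simp add: k_def char_diff char_scaleR char_one char_mult mem)
  then have "\<omega> d \<noteq> 0" using d by auto
  then show ?thesis using that \<omega>(1) by blast
qed

section \<open>The Hahn--Banach theorem\<close>

definition sublinear :: "('v::real_vector \<Rightarrow> real) \<Rightarrow> bool" where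
  "sublinear p \<longleftrightarrow> (\<forall>x y. p (x + y) \<le> p x + p y) \<and> (\<forall>t>0. \<forall>x. p (t *\<^sub>R x) \<le> t * p x)"

lemma sublinear_scaleR:
  assumes "sublinear p" "t \<ge> 0"
  shows "p (t *\<^sub>R x) = t * p x"
proof (cases "t = 0")
  case True
  have "p (2 *\<^sub>R 0) \<le> 2 * p 0" "p ((1/2) *\<^sub>R 0) \<le> (1/2) * p 0"
    using assms(1) unfolding sublinear_def by (meson zero_less_numeral half_gt_zero zero_less_one)+
  then show ?thesis using True by simp
next
  case False
  then have t: "t > 0" using assms(2) by simp
  have "p ((1 / t) *\<^sub>R t *\<^sub>R x) \<le> (1 / t) * p (t *\<^sub>R x)"
    using assms(1) t unfolding sublinear_def by (meson zero_less_divide_1_iff)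
  then have "t * p x \<le> p (t *\<^sub>R x)" using t by (simp add: field_simps)
  then show ?thesis using assms(1) t unfolding sublinear_def by (meson antisym)
qed

lemma sublinear_add: "sublinear p \<Longrightarrow> p (x + y) \<le> p x + p y"
  by (simp add: sublinear_def)

lemma sublinear_zero: "sublinear p \<Longrightarrow> p 0 = 0"
  using sublinear_scaleR[of p 0 0] by simp

text \<open>Sublinear functions arise below as infima over a half-line, over a chain and over a subspace. The index k
  may depend on the arguments, which covers all three.\<close>

lemma sublinear_INF:
  assumes "I \<noteq> {}" and bdd: "\<And>x. bdd_below ((\<lambda>i. q i x) ` I)"
    and add: "\<And>i j x y. i \<in> I \<Longrightarrow> j \<in> I \<Longrightarrow> \<exists>k\<in>I. q k (x + y) \<le> q i x + q j y"
    and scale: "\<And>i t x. i \<in> I \<Longrightarrow> t > 0 \<Longrightarrow> \<exists>k\<in>I. q k (t *\<^sub>R x) \<le> t * q i x"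
  shows "sublinear (\<lambda>x. INF i\<in>I. q i x)"
  unfolding sublinear_def
proof (intro conjI allI impI)
  fix x y
  let ?u = "\<lambda>x. INF i\<in>I. q i x"
  have le: "?u (x + y) \<le> q i x + q j y" if "i \<in> I" "j \<in> I" for i j
    using add[OF that, of x y] cINF_lower[OF bdd] by (meson order_trans)
  have "?u (x + y) - q j y \<le> ?u x" if "j \<in> I" for j
    using le that by (intro cINF_greatest[OF assms(1)]) (simp add: diff_le_eq)
  then have "?u (x + y) - ?u x \<le> ?u y"
    by (intro cINF_greatest[OF assms(1)]) (simp add: algebra_simps)
  then show "?u (x + y) \<le> ?u x + ?u y" by simp
next
  fix t :: real and x assume t: "t > 0"
  let ?u = "\<lambda>x. INF i\<in>I. q i x"
  have "?u (t *\<^sub>R x) \<le> t * q i x" if "i \<in> I" for i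
    using scale[OF that t, of x] cINF_lower[OF bdd] by (meson order_trans)
  then have "?u (t *\<^sub>R x) / t \<le> ?u x"
    using t by (intro cINF_greatest[OF assms(1)]) (simp add: divide_le_eq mult.commute)
  then show "?u (t *\<^sub>R x) \<le> t * ?u x" using t by (simp add: divide_le_eq mult.commute)
qed

text \<open>The witness p'(y) is the infimum of p(y + t x) - t p(x) over t \<ge> 0. If p is minimal, then p' = p, and the last
  inequality makes p additive. For general p it forces linear functionals below p' to take the value
  p(x) at x.\<close>

lemma sublinear_lower:
  assumes p: "sublinear p"
  obtains p' where "sublinear p'" "\<And>y. p' y \<le> p y" "\<And>y. p' y \<le> p (y + x) - p x"
proof -
  define q where "q t y = p (y + t *\<^sub>R x) - t * p x" for t y
  have bdd: "bdd_below ((\<lambda>t. q t y) ` {0..})" for y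
  proof (rule bdd_belowI2)
    fix t :: real assume "t \<in> {0..}"
    then have "t * p x = p ((y + t *\<^sub>R x) + - y)" using sublinear_scaleR[OF p] by simp
    also have "\<dots> \<le> p (y + t *\<^sub>R x) + p (- y)" by (rule sublinear_add[OF p])
    finally show "- p (- y) \<le> q t y" by (simp add: q_def)
  qed
  define p' where "p' y = (INF t\<in>{0..}. q t y)" for y
  have "sublinear p'"
    unfolding p'_def
  proof (rule sublinear_INF[OF _ bdd])
    fix s t :: real and y z assume "s \<in> {0..}" "t \<in> {0..}"
    moreover have "q (s + t) (y + z) \<le> q s y + q t z"
      using sublinear_add[OF p, of "y + s *\<^sub>R x" "z + t *\<^sub>R x"]
      by (simp add: q_def algebra_simps)
    ultimately show "\<exists>k\<in>{0..}. q k (y + z) \<le> q s y + q t z" by (intro bexI[of _ "s + t"]) auto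
  next
    fix s t :: real and y assume "s \<in> {0..}" "t > 0"
    moreover have "q (t * s) (t *\<^sub>R y) = t * q s y"
      using sublinear_scaleR[OF p, of t "y + s *\<^sub>R x"] \<open>t > 0\<close>
      by (simp add: q_def algebra_simps)
    ultimately show "\<exists>k\<in>{0..}. q k (t *\<^sub>R y) \<le> t * q s y" by (intro bexI[of _ "t * s"]) auto
  qed auto
  moreover have "p' y \<le> q t y" if "t \<ge> 0" for t y
    unfolding p'_def using that by (intro cINF_lower bdd) auto
  from this[of 0] this[of 1] have "p' y \<le> p y" "p' y \<le> p (y + x) - p x" for y
    by (simp_all add: q_def)
  ultimately show ?thesis using that by blast
qed

text \<open>A minimal sublinear function below p, which exists by Zorn's lemma, is linear.\<close>

lemma ex_linear_below_sublinear:
  assumes p: "sublinear p"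
  obtains f where "linear f" "\<And>x. f x \<le> p x"
proof -
  define S where "S = {q. sublinear q \<and> q \<le> p}"
  define P :: "('a \<Rightarrow> real) \<Rightarrow> ('a \<Rightarrow> real) \<Rightarrow> bool" where "P q q' \<longleftrightarrow> q' \<le> q" for q q'
  have "\<exists>m\<in>S. \<forall>a\<in>S. P m a \<longrightarrow> a = m"
  proof (rule predicate_Zorn)
    show "partial_order_on S (relation_of P S)"
      by (rule partial_order_on_relation_ofI) (auto simp: P_def)
  next
    fix C assume C: "C \<in> Chains (relation_of P S)"
    then have CS: "C \<subseteq> S" and tot: "q \<le> q' \<or> q' \<le> q" if "q \<in> C" "q' \<in> C" for q q'
      using that by (auto simp: Chains_def relation_of_def P_def)
    show "\<exists>u\<in>S. \<forall>a\<in>C. P a u"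
    proof (cases "C = {}")
      case True
      then show ?thesis using p by (auto simp: S_def)
    next
      case False
      have CS: "sublinear q" "q \<le> p" if "q \<in> C" for q
        using C that by (auto simp: Chains_def relation_of_def S_def)
      have bdd: "bdd_below ((\<lambda>q. q x) ` C)" for x
      proof (rule bdd_belowI2)
        fix q assume q: "q \<in> C"
        have "q x + q (- x) \<ge> 0"
          using sublinear_add[OF CS(1)[OF q], of x "- x"] sublinear_zero[OF CS(1)[OF q]] by simp
        moreover have "q (- x) \<le> p (- x)" using CS(2)[OF q] by (simp add: le_fun_def)
        ultimately show "- p (- x) \<le> q x" by linarith
      qed
      define u where "u x = (INF q\<in>C. q x)" for x
      have "sublinear u"
        unfolding u_def
      proof (rule sublinear_INF[OF False bdd])
        fix q q' x y assume qq: "q \<in> C" "q' \<in> C"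
        from tot[OF this] show "\<exists>k\<in>C. k (x + y) \<le> q x + q' y"
        proof
          assume "q \<le> q'"
          then have "q (x + y) \<le> q x + q' y"
            using sublinear_add[OF CS(1)[OF qq(1)], of x y] le_funD[of q q' y] by linarith
          then show ?thesis using qq by blast
        next
          assume "q' \<le> q"
          then have "q' (x + y) \<le> q x + q' y"
            using sublinear_add[OF CS(1)[OF qq(2)], of x y] le_funD[of q' q x] by linarith
          then show ?thesis using qq by blast
        qed
      next
        fix q t x assume "q \<in> C" "(t::real) > 0"
        then show "\<exists>k\<in>C. k (t *\<^sub>R x) \<le> t * q x"
          using CS(1) by (intro bexI[of _ q]) (auto simp: sublinear_def)
      qed
      moreover have u: "u \<le> q" if "q \<in> C" for q
        unfolding u_def le_fun_def using that by (auto intro: cINF_lower bdd)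
      moreover have "u \<le> p" using False u CS(2) by (meson ex_in_conv order_trans)
      ultimately show ?thesis by (auto simp: S_def P_def)
    qed
  qed
  then obtain f where f: "sublinear f" "f \<le> p"
    and min: "\<And>q. sublinear q \<Longrightarrow> q \<le> f \<Longrightarrow> q = f"
    by (auto simp: S_def P_def)
  have add: "f (y + x) = f y + f x" for x y
  proof -
    obtain q where q: "sublinear q" "\<And>y. q y \<le> f y" "\<And>y. q y \<le> f (y + x) - f x"
      using sublinear_lower[OF f(1)] by metis
    then have "q = f" by (intro min) (auto simp: le_fun_def)
    then show ?thesis using q(3)[of y] sublinear_add[OF f(1), of y x] by simp
  qed
  have neg: "f (- x) = - f x" for x
    using add[of x "- x"] sublinear_zero[OF f(1)] by simp
  have "f (t *\<^sub>R x) = t * f x" for t x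
  proof (cases "t \<ge> 0")
    case False
    then have "f (- ((- t) *\<^sub>R x)) = - ((- t) * f x)"
      unfolding neg using sublinear_scaleR[OF f(1), of "- t" x] by simp
    then show ?thesis by simp
  qed (rule sublinear_scaleR[OF f(1)])
  then have "linear f" using add by (intro linearI) auto
  then show ?thesis using that f(2) by (auto simp: le_fun_def)
qed

text \<open>Hahn--Banach for the seminorm p that measures the distance from N.\<close>

lemma ex_functional_vanishing_on:
  fixes x0 :: "'v::real_normed_vector"
  assumes N: "subspace N" and far: "\<And>n. n \<in> N \<Longrightarrow> 1 \<le> norm (x0 - n)" and "norm x0 \<le> 1"
  obtains f where "linear f" "\<And>x. f x \<le> norm x" "\<And>n. n \<in> N \<Longrightarrow> f n = 0" "f x0 = 1"
proof -
  define p where "p x = (INF n\<in>N. norm (x - n))" for x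
  have bdd: "bdd_below ((\<lambda>n. norm (x - n)) ` N)" for x
    by (rule bdd_belowI2[of _ 0]) simp
  have "sublinear p"
    unfolding p_def
  proof (rule sublinear_INF[OF _ bdd])
    show "N \<noteq> {}" using subspace_0[OF N] by blast
  next
    fix m n x y assume "m \<in> N" "n \<in> N"
    moreover have "norm (x + y - (m + n)) \<le> norm (x - m) + norm (y - n)"
      using norm_triangle_ineq[of "x - m" "y - n"] by (simp add: algebra_simps)
    ultimately show "\<exists>k\<in>N. norm (x + y - k) \<le> norm (x - m) + norm (y - n)"
      using subspace_add[OF N] by blast
  next
    fix n x and t :: real assume "n \<in> N" "t > 0"
    moreover have "norm (t *\<^sub>R x - t *\<^sub>R n) = t * norm (x - n)"
      using \<open>t > 0\<close> by (simp flip: scaleR_diff_right)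
    ultimately show "\<exists>k\<in>N. norm (t *\<^sub>R x - k) \<le> t * norm (x - n)"
      using subspace_mul[OF N, of n t] by (intro bexI[of _ "t *\<^sub>R n"]) simp_all
  qed
  \<comment> \<open>The last inequality at \<open>y = - x0\<close> will give \<open>f(x0) \<ge> p(x0) \<ge> 1\<close>.\<close>
  then obtain p' where p': "sublinear p'" "\<And>y. p' y \<le> p y" "\<And>y. p' y \<le> p (y + x0) - p x0"
    using sublinear_lower[OF \<open>sublinear p\<close>, of x0] by blast
  obtain f where f: "linear f" "\<And>x. f x \<le> p' x" using ex_linear_below_sublinear[OF p'(1)] by metis
  have pn: "p x \<le> norm (x - n)" if "n \<in> N" for x n
    unfolding p_def by (rule cINF_lower[OF bdd that])
  have le: "f x \<le> norm (x - n)" if "n \<in> N" for x n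
    using f(2)[of x] p'(2)[of x] pn[OF that, of x] by linarith
  have le_norm: "f x \<le> norm x" for x
    using le[OF subspace_0[OF N]] by simp
  have "f n = 0" if "n \<in> N" for n
    using le[OF that, of n] le[OF subspace_neg[OF N that], of "- n"] linear_neg[OF f(1), of n] by simp
  moreover have "f x0 = 1"
  proof -
    have "1 \<le> p x0" unfolding p_def
      using subspace_0[OF N] far by (intro cINF_greatest) auto
    moreover have "p 0 \<le> 0" using pn[OF subspace_0[OF N], of 0] by simp
    ultimately have "f (- x0) \<le> -1" using f(2)[of "- x0"] p'(3)[of "- x0"] by simp
    then show ?thesis using linear_neg[OF f(1), of x0] le_norm[of x0] assms(3) by simp
  qed
  ultimately show ?thesis using that f(1) le_norm by blast
qed

section \<open>States\<close>

locale state_on = cstar_subalgebra C for C :: "'a::cstar_algebra set" +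
  fixes \<phi> :: "'a \<Rightarrow> complex"
  assumes state: "state C \<phi>"
begin

lemma state_add: "x \<in> C \<Longrightarrow> y \<in> C \<Longrightarrow> \<phi> (x + y) = \<phi> x + \<phi> y"
  and state_scaleC: "x \<in> C \<Longrightarrow> \<phi> (c *\<^sub>C x) = c * \<phi> x"
  and state_one: "\<phi> 1 = 1"
  using state by (auto simp: state_def linear_functional_def)

lemma state_scaleR: "x \<in> C \<Longrightarrow> \<phi> (r *\<^sub>R x) = of_real r * \<phi> x"
  using state_scaleC[of x "of_real r"] by (simp add: scaleC_of_real)

lemma state_diff: "x \<in> C \<Longrightarrow> y \<in> C \<Longrightarrow> \<phi> (x - y) = \<phi> x - \<phi> y"
  using state_add[of "x - y" y] by (simp add: mem)

lemma state_pos: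
  assumes "x \<in> C"
  shows "Im (\<phi> (star x * x)) = 0" "0 \<le> Re (\<phi> (star x * x))"
proof -
  have "\<phi> (star x * x) \<in> \<real>\<^sub>\<ge>\<^sub>0"
    using state assms by (auto simp: state_def positive_elements_def)
  then show "Im (\<phi> (star x * x)) = 0" "0 \<le> Re (\<phi> (star x * x))"
    by (auto simp: complex_nonneg_Reals_iff)
qed

lemma state_expand:
  assumes "x \<in> C" "y \<in> C"
  shows "\<phi> (star (x + c *\<^sub>C y) * (x + c *\<^sub>C y)) =
    \<phi> (star x * x) + c * \<phi> (star x * y) + cnj c * \<phi> (star y * x) + of_real ((cmod c)\<^sup>2) * \<phi> (star y * y)"
proof -
  have "star (x + c *\<^sub>C y) * (x + c *\<^sub>C y) =
      (star x * x + c *\<^sub>C (star x * y)) + (cnj c *\<^sub>C (star y * x) + (cnj c * c) *\<^sub>C (star y * y))"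
    by (simp add: star_add star_scaleC distrib_left distrib_right scaleC_mult_left scaleC_mult_right
        scaleC_scaleC scaleC_add_right mult.commute add.assoc)
  moreover have "cnj c * c = of_real ((cmod c)\<^sup>2)"
    by (simp add: complex_norm_square[symmetric] mult.commute del: of_real_power)
  ultimately show ?thesis
    using assms by (simp add: state_add state_scaleC mem)
qed

text \<open>The value at (x + c)^* (x + c) is real for c = 1 and for c = i.\<close>

lemma state_star:
  assumes x: "x \<in> C"
  shows "\<phi> (star x) = cnj (\<phi> x)"
proof -
  have "Im (c * \<phi> (star x) + cnj c * \<phi> x) = 0" for c
  proof -
    have "Im (\<phi> (star (x + c *\<^sub>C 1) * (x + c *\<^sub>C 1))) = 0"
      by (intro state_pos mem x)
    then show ?thesis
      unfolding state_expand[OF x one_mem] using state_pos[OF x] by (simp add: star_one state_one)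
  qed
  from this[of 1] this[of \<i>] show ?thesis by (simp add: complex_eq_iff)
qed

text \<open>The Cauchy--Schwarz inequality before t is chosen: t = 1 and y = 1 bound the norm of a state, and large
  t gives \<open>state_null\<close>.\<close>

lemma state_quadratic:
  assumes xy: "x \<in> C" "y \<in> C"
  shows "0 \<le> Re (\<phi> (star x * x)) - 2 * t * (cmod (\<phi> (star x * y)))\<^sup>2
    + t\<^sup>2 * (cmod (\<phi> (star x * y)))\<^sup>2 * Re (\<phi> (star y * y))"
proof -
  define \<beta> where "\<beta> = \<phi> (star x * y)"
  define c where "c = - of_real t * cnj \<beta>"
  have yx: "\<phi> (star y * x) = cnj \<beta>"
    using state_star[of "star x * y"] xy by (simp add: \<beta>_def star_mult star_star mem)
  have "0 \<le> Re (\<phi> (star (x + c *\<^sub>C y) * (x + c *\<^sub>C y)))"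
    by (intro state_pos mem xy)
  also have "\<dots> = Re (\<phi> (star x * x)) + Re (c * \<beta>) + Re (cnj c * cnj \<beta>)
      + Re (of_real ((cmod c)\<^sup>2) * \<phi> (star y * y))"
    unfolding state_expand[OF xy] yx \<beta>_def[symmetric] by (simp only: plus_complex.sel)
  also have "Re (c * \<beta>) = - (t * (cmod \<beta>)\<^sup>2)"
    unfolding cmod_power2 c_def by (simp add: power2_eq_square algebra_simps)
  also have "Re (cnj c * cnj \<beta>) = - (t * (cmod \<beta>)\<^sup>2)"
    unfolding cmod_power2 c_def by (simp add: power2_eq_square algebra_simps)
  also have "Re (of_real ((cmod c)\<^sup>2) * \<phi> (star y * y)) = t\<^sup>2 * (cmod \<beta>)\<^sup>2 * Re (\<phi> (star y * y))"
    unfolding c_def by (simp add: norm_mult power_mult_distrib del: of_real_power of_real_mult)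
  finally show ?thesis by (simp add: \<beta>_def)
qed

lemma state_null:
  assumes "x \<in> C" "y \<in> C" "\<phi> (star y * y) = 0"
  shows "\<phi> (x * y) = 0"
proof (rule ccontr)
  assume nz: "\<phi> (x * y) \<noteq> 0"
  define q where "q = (cmod (\<phi> (x * y)))\<^sup>2"
  have "0 \<le> Re (\<phi> (star (star x) * star x)) - 2 * t * q" for t
    using state_quadratic[OF star_mem[OF assms(1)] assms(2), of t] assms(3)
    by (simp add: q_def star_star)
  from this[of "(Re (\<phi> (star (star x) * star x)) + 1) / (2 * q)"] nz
  show False by (simp add: q_def)
qed

text \<open>For r > \<parallel>x\<parallel> the element r^2 - x^* x is a square, hence \<phi>(x^* x) \<le> r^2.\<close>

lemma norm_state_le:
  assumes x: "x \<in> C"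
  shows "cmod (\<phi> x) \<le> norm x"
proof (rule field_le_epsilon)
  fix e :: real assume "e > 0"
  define r where "r = norm x + e"
  have r: "norm x < r" "0 < r" using \<open>e > 0\<close> norm_ge_zero[of x] by (auto simp: r_def simp del: norm_ge_zero)
  from x r(1) obtain y where y: "y \<in> C" "star y = y" "y * y = r\<^sup>2 *\<^sub>R 1 - star x * x"
    by (rule sqrt_norm_diff)
  have "0 \<le> Re (\<phi> (r\<^sup>2 *\<^sub>R 1 - star x * x))" using state_pos(2)[OF y(1)] y by simp
  then have "Re (\<phi> (star x * x)) \<le> r\<^sup>2"
    using x by (simp add: state_diff state_one state_scaleR mem flip: of_real_power)
  moreover have "0 \<le> Re (\<phi> (star x * x)) - (cmod (\<phi> (star x)))\<^sup>2"
    using state_quadratic[OF x one_mem, of 1] by (simp add: star_one state_one)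
  ultimately have "(cmod (\<phi> x))\<^sup>2 \<le> r\<^sup>2" by (simp add: state_star x)
  then show "cmod (\<phi> x) \<le> norm x + e"
    unfolding r_def[symmetric] by (rule power2_le_imp_le) (use r in simp)
qed

text \<open>The element d = b - \<omega>(b) has \<phi>(d^* d) = \<bar>\<omega>(d)\<bar>^2 = 0, so \<phi> vanishes on all multiples of d: the algebra B is
  in the multiplicative domain of \<phi>.\<close>

lemma state_mult_character:
  assumes B: "cstar_subalgebra B" "B \<subseteq> C" "\<omega> \<in> characters B"
    and ext: "\<And>b. b \<in> B \<Longrightarrow> \<phi> b = \<omega> b" and b: "b \<in> B" and x: "x \<in> C"
  shows "\<phi> (x * b) = \<phi> x * \<omega> b" "\<phi> (b * x) = \<omega> b * \<phi> x"
proof -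
  interpret \<omega>: character B \<omega> using B by (simp add: character_def character_axioms_def)
  have right: "\<phi> (x * b) = \<phi> x * \<omega> b" if b: "b \<in> B" and x: "x \<in> C" for x b
  proof -
    define d where "d = b - \<omega> b *\<^sub>C 1"
    have d: "d \<in> B" using b by (auto simp: d_def intro: \<omega>.mem)
    have "\<omega> d = 0" using b by (simp add: d_def \<omega>.char_diff \<omega>.char_scaleC \<omega>.char_one \<omega>.mem)
    then have "\<phi> (star d * d) = 0" using d by (simp add: ext \<omega>.char_mult \<omega>.mem)
    then have "\<phi> (x * d) = 0" by (rule state_null[OF x, rotated]) (use d B(2) in auto)
    moreover have "x * d = x * b - \<omega> b *\<^sub>C x" by (simp add: d_def right_diff_distrib scaleC_mult_right)
    ultimately show ?thesis using x b B(2) by (auto simp: state_diff state_scaleC mem)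
  qed
  show "\<phi> (x * b) = \<phi> x * \<omega> b" by (rule right[OF b x])
  have bC: "b \<in> C" using b B(2) by blast
  have "\<phi> (star x * star b) = \<phi> (star x) * \<omega> (star b)"
    by (rule right[OF \<omega>.star_mem[OF b] star_mem[OF x]])
  then have "cnj (\<phi> (b * x)) = cnj (\<phi> x) * cnj (\<omega> b)"
    using x b bC by (simp add: \<omega>.char_star state_star mem flip: star_mult)
  then show "\<phi> (b * x) = \<omega> b * \<phi> x"
    by (metis complex_cnj_cancel_iff complex_cnj_mult mult.commute)
qed

end

text \<open>For real t, f(1 + i t h) = 1 + t f(i h) is at most \<parallel>1 + i t h\<parallel> \<le> \<surd>(1 + t^2 \<parallel>h\<parallel>^2), which differs from 1 only
  in second order.\<close>

lemma functional_imaginary_zero: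
  fixes f :: "'a::cstar_algebra \<Rightarrow> real"
  assumes f: "linear f" "\<And>x. f x \<le> norm x" "f 1 = 1" and h: "star h = h"
  shows "f (\<i> *\<^sub>C h) = 0"
proof -
  define a where "a = f (\<i> *\<^sub>C h)"
  define H where "H = (norm h)\<^sup>2"
  \<comment> \<open>Small enough for the linear term \<open>2 t a\<close> to exceed \<open>t\<^sup>2 H\<close>, and of the sign of \<open>a\<close>.\<close>
  define t where "t = a / (H + 1)"
  have H: "H \<ge> 0" by (simp add: H_def)
  define k where "k = 1 + (of_real t * \<i>) *\<^sub>C h"
  have sk: "star k = 1 - (of_real t * \<i>) *\<^sub>C h"
    by (simp add: k_def star_add star_one star_scaleC h scaleC_minus_left)
  have "(of_real t * \<i>) *\<^sub>C (of_real t * \<i>) *\<^sub>C (h * h) = - (t\<^sup>2 *\<^sub>R (h * h))"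
    using scaleC_of_real[of "- t\<^sup>2" "h * h"] by (simp add: scaleC_scaleC power2_eq_square algebra_simps)
  then have "star k * k = 1 + t\<^sup>2 *\<^sub>R (h * h)"
    unfolding sk by (simp add: k_def algebra_simps scaleC_mult_left scaleC_mult_right scaleC_diff scaleC_add_right)
  then have "(norm k)\<^sup>2 \<le> norm (1::'a) + norm (t\<^sup>2 *\<^sub>R (h * h))"
    using cstar_identity[of k] norm_triangle_ineq by metis
  moreover have "norm (t\<^sup>2 *\<^sub>R (h * h)) = t\<^sup>2 * H"
    using cstar_identity[of h] by (simp add: h H_def)
  ultimately have "(norm k)\<^sup>2 \<le> 1 + t\<^sup>2 * H" using norm_one_le[where 'a='a] by linarith
  moreover have "1 + t * a \<le> norm k"
  proof -
    have "(of_real t * \<i>) *\<^sub>C h = t *\<^sub>R (\<i> *\<^sub>C h)" by (simp add: scaleC_of_real flip: scaleC_scaleC)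
    then have "f k = 1 + t * a"
      using f(1,3) by (simp add: k_def linear_add linear_scale a_def)
    then show ?thesis using f(2)[of k] by simp
  qed
  moreover have ta: "0 \<le> t * a" using H by (simp add: t_def)
  ultimately have "(1 + t * a)\<^sup>2 \<le> 1 + t\<^sup>2 * H"
    using power_mono[of "1 + t * a" "norm k" 2] by linarith
  then have "2 * (t * a) \<le> t\<^sup>2 * H"
    using zero_le_power2[of "t * a"] unfolding power2_sum[of 1 "t * a"]
    by (simp only: mult_1_right one_power2)
  also have "t\<^sup>2 * H \<le> t\<^sup>2 * (H + 1)" by (intro mult_left_mono) auto
  also have "\<dots> = t * a" using H by (simp add: t_def power2_eq_square)
  finally have "t * a = 0" using ta by linarith
  then show ?thesis using H by (auto simp: t_def a_def)
qed

text \<open>A functional whose norm is its value at 1 is positive: for r \<ge> \<parallel>x\<parallel>^2 one has \<parallel>r - x^* x\<parallel> \<le> r, hence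
  r - f(x^* x) \<le> r.\<close>

lemma state_of_real_functional:
  fixes C :: "'h::chilbert_space bounded_op set"
  assumes C: "cstar_subalgebra C" and f: "linear f" "\<And>x. f x \<le> norm x" "f 1 = 1"
  shows "state C (restrict (\<lambda>x. Complex (f x) (- f (\<i> *\<^sub>C x))) C)"
proof -
  interpret cstar_subalgebra C by fact
  interpret f: linear f by fact
  have fc: "f (c *\<^sub>C x) = Re c * f x + Im c * f (\<i> *\<^sub>C x)" for c x
  proof -
    have "c *\<^sub>C x = Re c *\<^sub>R x + Im c *\<^sub>R (\<i> *\<^sub>C x)"
      by (subst complex_eq[of c])
        (simp add: scaleC_add_left scaleC_of_real mult.commute[of \<i>] flip: scaleC_scaleC)
    then show ?thesis by (simp add: f.add f.scale)
  qed
  have pos: "0 \<le> f (star x * x)" for x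
  proof -
    define r where "r = (norm x)\<^sup>2 + 1"
    define h where "h = star x * x"
    have r: "r > 0" by (simp add: r_def add_nonneg_pos)
    have "norm (r *\<^sub>R 1 - h) \<le> r"
    proof (rule norm_op_bound)
      fix v
      have hv: "(norm (op_apply h v))\<^sup>2 \<le> (norm x * norm (op_apply x v))\<^sup>2"
        using norm_op_apply[of "star x" "op_apply x v"]
        by (intro power_mono) (simp_all add: h_def op_mult norm_star)
      have in_h: "inner (op_apply h v) v = (norm (op_apply x v))\<^sup>2"
        by (simp add: h_def norm_op_apply_power2)
      have "(norm (op_apply (r *\<^sub>R 1 - h) v))\<^sup>2 =
          r * (r * (norm v)\<^sup>2) - 2 * (r * inner (op_apply h v) v) + (norm (op_apply h v))\<^sup>2"
        by (simp add: op_diff op_scaleR op_one power2_norm_eq_inner inner_diff_left inner_diff_right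
            inner_commute algebra_simps)
      also have "\<dots> = (r * norm v)\<^sup>2 - 2 * r * (norm (op_apply x v))\<^sup>2 + (norm (op_apply h v))\<^sup>2"
        unfolding in_h by (simp add: power2_eq_square)
      also have "\<dots> \<le> (r * norm v)\<^sup>2 - 2 * r * (norm (op_apply x v))\<^sup>2 + r * (norm (op_apply x v))\<^sup>2"
        using hv zero_le_power2[of "norm (op_apply x v)"]
        unfolding r_def power_mult_distrib distrib_right by linarith
      also have "\<dots> \<le> (r * norm v)\<^sup>2" using r by simp
      finally show "norm (op_apply (r *\<^sub>R 1 - h) v) \<le> r * norm v"
        by (rule power2_le_imp_le) (use r in simp)
    qed (use r in simp)
    then have "f (r *\<^sub>R 1 - h) \<le> r" using f(2) order_trans by blast
    then show ?thesis by (simp add: f.diff f.scale f(3) h_def)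
  qed
  have im: "f (\<i> *\<^sub>C (star x * x)) = 0" for x
    by (rule functional_imaginary_zero[OF f]) (simp add: star_mult star_star)
  have im1: "f (\<i> *\<^sub>C 1) = 0" by (rule functional_imaginary_zero[OF f]) (simp add: star_one)
  define \<phi> where "\<phi> = restrict (\<lambda>x. Complex (f x) (- f (\<i> *\<^sub>C x))) C"
  have \<phi>: "\<phi> x = Complex (f x) (- f (\<i> *\<^sub>C x))" if "x \<in> C" for x using that by (simp add: \<phi>_def)
  have "state C \<phi>"
    unfolding state_def linear_functional_def
  proof (intro conjI ballI allI)
    show "\<phi> (x + y) = \<phi> x + \<phi> y" if "x \<in> C" "y \<in> C" for x y
      using that by (simp add: \<phi> add_mem f.add scaleC_add_right complex_eq_iff)
  next
    fix x c assume x: "x \<in> C"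
    have "f (\<i> *\<^sub>C c *\<^sub>C x) = Re (\<i> * c) * f x + Im (\<i> * c) * f (\<i> *\<^sub>C x)"
      unfolding scaleC_scaleC by (rule fc)
    then show "\<phi> (c *\<^sub>C x) = c * \<phi> x"
      using x by (simp add: \<phi> scaleC_mem fc[of c x] complex_eq_iff algebra_simps)
  next
    fix x assume "x \<in> positive_elements C"
    then obtain y where "y \<in> C" "x = star y * y" by (auto simp: positive_elements_def)
    then show "\<phi> x \<in> \<real>\<^sub>\<ge>\<^sub>0"
      by (simp add: \<phi> mem complex_nonneg_Reals_iff pos im)
  qed (simp_all add: \<phi> \<phi>_def mem im1 f(3) complex_eq_iff)
  then show ?thesis by (simp add: \<phi>_def)
qed

section \<open>Extending a character to a state that vanishes on an ideal\<close>

text \<open>The existence half of the argument described at the beginning. L consists of the x with x^* x \<le> h for some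
  h \<in> B with \<omega>(h) = 0; compared with the left ideal generated by the kernel of \<omega>, it has the advantage that a
  single h controls every element.\<close>

lemma ex_state_extension_vanishing_on_ideal:
  fixes B C :: "'h::chilbert_space bounded_op set"
  assumes C: "cstar_subalgebra C" and B: "cstar_subalgebra B" "B \<subseteq> C"
    and \<omega>: "\<omega> \<in> characters B" and J: "two_sided_ideal C J" "J \<inter> B = {0}"
  obtains \<phi> where "state C \<phi>" "\<And>b. b \<in> B \<Longrightarrow> \<phi> b = \<omega> b" "\<And>j. j \<in> J \<Longrightarrow> \<phi> j = 0"
proof -
  interpret C: cstar_subalgebra C by fact
  interpret \<omega>: character B \<omega> using B \<omega> by (simp add: character_def character_axioms_def)
  define L where "L = {x \<in> C. \<exists>h\<in>B. star h = h \<and> \<omega> h = 0 \<and>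
    (\<forall>v. (norm (op_apply x v))\<^sup>2 \<le> inner (op_apply h v) v)}"
  define N where "N = {x + j |x j. x \<in> L \<and> j \<in> J}"
  have L_add: "x + y \<in> L" if xy: "x \<in> L" "y \<in> L" for x y
  proof -
    obtain h k where h: "h \<in> B" "star h = h" "\<omega> h = 0" "\<And>v. (norm (op_apply x v))\<^sup>2 \<le> inner (op_apply h v) v"
      and k: "k \<in> B" "star k = k" "\<omega> k = 0" "\<And>v. (norm (op_apply y v))\<^sup>2 \<le> inner (op_apply k v) v"
      using xy unfolding L_def by auto
    have "(norm (op_apply (x + y) v))\<^sup>2 \<le> inner (op_apply (2 *\<^sub>R (h + k)) v) v" for v
    proof -
      have "(norm (op_apply (x + y) v))\<^sup>2 \<le> (norm (op_apply x v) + norm (op_apply y v))\<^sup>2"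
        unfolding op_add by (intro power_mono norm_triangle_ineq) auto
      also have "\<dots> \<le> 2 * ((norm (op_apply x v))\<^sup>2 + (norm (op_apply y v))\<^sup>2)"
        using zero_le_power2[of "norm (op_apply x v) - norm (op_apply y v)"]
        by (simp add: power2_sum power2_diff)
      also have "\<dots> \<le> 2 * (inner (op_apply h v) v + inner (op_apply k v) v)"
        using h(4)[of v] k(4)[of v] by simp
      finally show ?thesis by (simp add: op_scaleR op_add inner_add_left)
    qed
    moreover have "2 *\<^sub>R (h + k) \<in> B" "star (2 *\<^sub>R (h + k)) = 2 *\<^sub>R (h + k)" "\<omega> (2 *\<^sub>R (h + k)) = 0"
      using h k by (auto simp: star_scaleR star_add \<omega>.char_scaleR \<omega>.char_add \<omega>.mem)
    moreover have "x + y \<in> C" using xy by (auto simp: L_def C.mem)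
    ultimately show ?thesis unfolding L_def by blast
  qed
  have L_mult: "c * x \<in> L" if c: "c \<in> C" and x: "x \<in> L" for c x
  proof -
    obtain h where h: "h \<in> B" "star h = h" "\<omega> h = 0" "\<And>v. (norm (op_apply x v))\<^sup>2 \<le> inner (op_apply h v) v"
      using x unfolding L_def by auto
    have "(norm (op_apply (c * x) v))\<^sup>2 \<le> inner (op_apply ((norm c)\<^sup>2 *\<^sub>R h) v) v" for v
    proof -
      have "(norm (op_apply (c * x) v))\<^sup>2 \<le> (norm c * norm (op_apply x v))\<^sup>2"
        unfolding op_mult by (intro power_mono norm_op_apply) auto
      also have "\<dots> \<le> (norm c)\<^sup>2 * inner (op_apply h v) v"
        using h(4)[of v] by (simp add: power_mult_distrib mult_left_mono)
      finally show ?thesis by (simp add: op_scaleR)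
    qed
    moreover have "(norm c)\<^sup>2 *\<^sub>R h \<in> B" "star ((norm c)\<^sup>2 *\<^sub>R h) = (norm c)\<^sup>2 *\<^sub>R h" "\<omega> ((norm c)\<^sup>2 *\<^sub>R h) = 0"
      using h by (auto simp: star_scaleR \<omega>.char_scaleR \<omega>.mem)
    moreover have "c * x \<in> C" using c x by (auto simp: L_def C.mem)
    ultimately show ?thesis unfolding L_def by blast
  qed
  have ker_L: "d \<in> L" if d: "d \<in> B" "\<omega> d = 0" for d
    unfolding L_def
  proof (intro CollectI conjI bexI[of _ "star d * d"] allI)
    show "d \<in> C" using d B(2) by blast
    show "\<omega> (star d * d) = 0" using d by (simp add: \<omega>.char_mult \<omega>.mem)
    show "(norm (op_apply d v))\<^sup>2 \<le> inner (op_apply (star d * d) v) v" for v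
      by (simp add: norm_op_apply_power2)
  qed (use d in \<open>auto simp: star_mult star_star intro: \<omega>.mem\<close>)
  have "0 \<in> L" by (rule ker_L) (simp_all add: \<omega>.mem \<omega>.char_zero)
  have J': "J \<subseteq> C" "0 \<in> J" "\<And>x y. x \<in> J \<Longrightarrow> y \<in> J \<Longrightarrow> x + y \<in> J"
    "\<And>a x. x \<in> J \<Longrightarrow> a \<in> C \<Longrightarrow> a * x \<in> J" "\<And>a x. x \<in> J \<Longrightarrow> a \<in> C \<Longrightarrow> x * a \<in> J"
    using J(1) by (auto simp: two_sided_ideal_def)
  have LN: "x \<in> N" if "x \<in> L" for x
    using that J'(2) unfolding N_def by force
  have JN: "j \<in> N" if "j \<in> J" for j
    using that \<open>0 \<in> L\<close> unfolding N_def by force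
  have N_add: "x + y \<in> N" if "x \<in> N" "y \<in> N" for x y
  proof -
    obtain a i b j where *: "a \<in> L" "i \<in> J" "x = a + i" "b \<in> L" "j \<in> J" "y = b + j"
      using \<open>x \<in> N\<close> \<open>y \<in> N\<close> unfolding N_def by blast
    then have "x + y = (a + b) + (i + j)" by simp
    then show ?thesis unfolding N_def using * L_add J'(3) by blast
  qed
  have N_mult: "c * x \<in> N" if "c \<in> C" "x \<in> N" for c x
  proof -
    obtain a i where *: "a \<in> L" "i \<in> J" "x = a + i"
      using \<open>x \<in> N\<close> unfolding N_def by blast
    then have "c * x = c * a + c * i" by (simp add: distrib_left)
    then show ?thesis unfolding N_def using * L_mult J'(4) \<open>c \<in> C\<close> by blast
  qed
  have NC: "N \<subseteq> C" using J'(1) by (auto simp: N_def L_def intro!: C.mem)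
  have "1 \<notin> N"
  proof
    assume "1 \<in> N"
    then obtain x j where xj: "x \<in> L" "j \<in> J" "1 = x + j" unfolding N_def by blast
    obtain h where h: "h \<in> B" "star h = h" "\<omega> h = 0" "\<And>v. (norm (op_apply x v))\<^sup>2 \<le> inner (op_apply h v) v"
      using xj(1) unfolding L_def by auto
    define M where "M = norm h + 1"
    have M: "norm h < M" by (simp add: M_def)
    \<comment> \<open>\<open>G\<close> is \<open>1\<close> on the support \<open>[-1/8, 1/8]\<close> of \<open>G'\<close> and vanishes outside \<open>[-1/4, 1/4]\<close>, so
        \<open>\<parallel>x g\<parallel>\<^sup>2 \<le> \<parallel>h g\<parallel> \<parallel>g\<parallel> \<le> 1/4\<close>.\<close>
    define G G' :: "real \<Rightarrow> real" where "G t = max 0 (min 1 (2 - 8 * \<bar>t\<bar>))" and "G' t = max 0 (1 - 8 * \<bar>t\<bar>)" for t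
    have cont: "continuous_on S G" "continuous_on S G'" for S
      unfolding G_def G'_def by (intro continuous_intros)+
    define g g' where "g = cfc M h G" and "g' = cfc M h G'"
    have gB: "g \<in> B" "g' \<in> B"
      unfolding g_def g'_def by (intro cfc_mem[OF h(2) M B(1) h(1)] cont)+
    have "g * g' = cfc M h (\<lambda>t. G t * G' t)"
      unfolding g_def g'_def by (intro cfc_mult[OF h(2) M, symmetric] cont)
    also have "\<dots> = g'"
      unfolding g'_def by (rule arg_cong[where f = "cfc M h"]) (auto simp: G_def G'_def fun_eq_iff max_def min_def)
    finally have gg': "g * g' = g'" .
    have "norm g \<le> 1"
      unfolding g_def by (rule norm_cfc_le[OF h(2) M cont(1)]) (auto simp: G_def)
    have "h * g = cfc M h (\<lambda>t. t * G t)"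
      unfolding g_def by (subst cfc_mult[OF h(2) M]) (auto simp: cfc_ident[OF h(2) M] intro: continuous_intros cont)
    also have "norm \<dots> \<le> 1 / 4"
    proof (rule norm_cfc_le[OF h(2) M])
      fix t :: real
      show "\<bar>t * G t\<bar> \<le> 1 / 4"
      proof (cases "\<bar>t\<bar> \<le> 1 / 4")
        case True
        have "\<bar>t\<bar> * \<bar>G t\<bar> \<le> 1 / 4 * 1" using True by (intro mult_mono) (auto simp: G_def)
        then show ?thesis by (simp add: abs_mult)
      next
        case False
        then have "G t = 0" by (simp add: G_def)
        then show ?thesis by simp
      qed
    qed (intro continuous_intros cont)
    finally have hg: "norm (h * g) \<le> 1 / 4" .
    have "norm (x * g) \<le> 1 / 2"
    proof (rule norm_op_bound)
      fix v
      have "(norm (op_apply (x * g) v))\<^sup>2 \<le> inner (op_apply (h * g) v) (op_apply g v)"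
        using h(4)[of "op_apply g v"] by (simp add: op_mult)
      also have "\<dots> \<le> norm (op_apply (h * g) v) * norm (op_apply g v)" by (rule norm_cauchy_schwarz)
      also have "\<dots> \<le> (1 / 4 * norm v) * (1 * norm v)"
        using order_trans[OF norm_op_apply[of "h * g" v] mult_right_mono[OF hg]]
          order_trans[OF norm_op_apply[of g v] mult_right_mono[OF \<open>norm g \<le> 1\<close>]]
        by (intro mult_mono) auto
      also have "\<dots> = (1 / 2 * norm v)\<^sup>2" by (simp add: power2_eq_square)
      finally show "norm (op_apply (x * g) v) \<le> 1 / 2 * norm v" by (rule power2_le_imp_le) simp
    qed simp
    moreover have "1 - x * g \<in> C" using xj(1) gB B(2) by (auto simp: L_def intro!: C.mem)
    ultimately obtain y where y: "y \<in> C" "y * (1 - x * g) = 1"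
      using C.inverse_near_one[of "1 - x * g"] by force
    have "(1 - x * g) * g' = 1 * g' - x * g'"
      by (simp add: left_diff_distrib mult.assoc gg')
    also have "\<dots> = j * g'" unfolding xj(3) by (simp add: distrib_right)
    finally have "(y * (1 - x * g)) * g' = y * (j * g')" by (simp add: mult.assoc)
    then have "g' = y * (j * g')" by (simp add: y)
    moreover have "y * (j * g') \<in> J" using J'(4,5) xj(2) y(1) gB(2) B(2) by blast
    ultimately have "g' \<in> J \<inter> B" using gB by simp
    then have "g' = 0" using J(2) by simp
    moreover have "\<omega> g' = of_real (G' (Re (\<omega> h)))"
      unfolding g'_def by (rule \<omega>.char_cfc[OF h(1,2) M cont(2)])
    ultimately show False by (simp add: h(3) G'_def \<omega>.char_zero)
  qed
  have far: "1 \<le> norm (1 - n)" if n: "n \<in> N" for n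
  proof (rule ccontr)
    assume "\<not> ?thesis"
    then obtain z where "z \<in> C" "z * n = 1"
      using C.inverse_near_one[of n] n NC by force
    then show False using N_mult n \<open>1 \<notin> N\<close> by metis
  qed
  have N_scaleC: "c *\<^sub>C x \<in> N" if "x \<in> N" for c x
    using N_mult[of "c *\<^sub>C 1" x] that by (simp add: C.mem scaleC_mult_left)
  have "subspace N"
    unfolding subspace_def
    using JN[OF J'(2)] N_add N_scaleC[of _ "of_real _"] by (auto simp: scaleC_of_real)
  then obtain f where f: "linear f" "\<And>x. f x \<le> norm x" "\<And>n. n \<in> N \<Longrightarrow> f n = 0" "f 1 = 1"
    using ex_functional_vanishing_on[OF _ far norm_one_le] by blast
  define \<phi> where "\<phi> = restrict (\<lambda>x. Complex (f x) (- f (\<i> *\<^sub>C x))) C"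
  have st: "state C \<phi>"
    unfolding \<phi>_def by (rule state_of_real_functional[OF C f(1,2,4)])
  interpret \<phi>: state_on C \<phi> using st by unfold_locales
  have \<phi>N: "\<phi> n = 0" if "n \<in> N" for n
    using that NC N_scaleC f(3) by (auto simp: \<phi>_def complex_eq_iff)
  have "\<phi> b = \<omega> b" if b: "b \<in> B" for b
  proof -
    have bC: "b \<in> C" using b B(2) by blast
    have "b - \<omega> b *\<^sub>C 1 \<in> L"
      by (rule ker_L) (use b in \<open>simp_all add: \<omega>.char_diff \<omega>.char_scaleC \<omega>.char_one \<omega>.mem\<close>)
    then have "\<phi> (b - \<omega> b *\<^sub>C 1) = 0" by (intro \<phi>N LN)
    then show ?thesis using bC by (simp add: \<phi>.state_diff \<phi>.state_scaleC \<phi>.state_one C.mem)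
  qed
  then show ?thesis using that st \<phi>N JN by blast
qed

section \<open>The algebra spanned by monomials\<close>

lemma cstar_subalgebra_closure:
  fixes S :: "'a::cstar_algebra set"
  assumes S: "star_subalgebra S"
  shows "cstar_subalgebra (closure S)"
proof
  have sub: "1 \<in> S" "\<And>x y. x \<in> S \<Longrightarrow> y \<in> S \<Longrightarrow> x + y \<in> S"
    "\<And>x y. x \<in> S \<Longrightarrow> y \<in> S \<Longrightarrow> x * y \<in> S" "\<And>c x. x \<in> S \<Longrightarrow> c *\<^sub>C x \<in> S"
    "\<And>x. x \<in> S \<Longrightarrow> star x \<in> S"
    using S by (auto simp: star_subalgebra_def)
  have 1: "x + y \<in> closure S" "x * y \<in> closure S" if x: "x \<in> closure S" and y: "y \<in> closure S" for x y
  proof -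
    obtain a where a: "\<And>n. a n \<in> S" "a \<longlonglongrightarrow> x" using x by (auto simp: closure_sequential)
    obtain b where b: "\<And>n. b n \<in> S" "b \<longlonglongrightarrow> y" using y by (auto simp: closure_sequential)
    show "x + y \<in> closure S" unfolding closure_sequential
      using a b sub by (intro exI[of _ "\<lambda>n. a n + b n"]) (auto intro: tendsto_add)
    show "x * y \<in> closure S" unfolding closure_sequential
      using a b sub by (intro exI[of _ "\<lambda>n. a n * b n"]) (auto intro: tendsto_mult)
  qed
  have image: "g x \<in> closure S" if "bounded_linear g" "g ` S \<subseteq> S" "x \<in> closure S" for g x
    using closure_bounded_linear_image_subset[OF that(1), of S] closure_mono[OF that(2)] that(3) by blast
  have 2: "c *\<^sub>C x \<in> closure S" "star x \<in> closure S" if x: "x \<in> closure S" for x c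
  proof -
    have "(*\<^sub>C) c ` S \<subseteq> S" "star ` S \<subseteq> S" using sub by auto
    then show "c *\<^sub>C x \<in> closure S" "star x \<in> closure S"
      using image[OF bounded_linear_scaleC[OF norm_scaleC] _ x] image[OF bounded_linear_star _ x] by blast+
  qed
  have "1 \<in> closure S" using sub(1) closure_subset by blast
  with 1 2 show "star_subalgebra (closure S)" unfolding star_subalgebra_def by simp
qed simp

definition monomials ::
  "(('x::topological_space \<Rightarrow>\<^sub>C complex) \<Rightarrow> 'a::star_algebra) \<Rightarrow> 'a \<Rightarrow> 'a set" where
  "monomials \<iota> \<delta> = {\<iota> f * unitary_power \<delta> n |f n. True}"

lemma monomialI: "\<iota> f * unitary_power \<delta> n \<in> monomials \<iota> \<delta>"
  by (auto simp: monomials_def)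

text \<open>The span is the real one; for monomials it is a complex subspace.\<close>

lemma span_scaleC:
  assumes "\<And>c g. g \<in> G \<Longrightarrow> c *\<^sub>C g \<in> span G" "x \<in> span G"
  shows "c *\<^sub>C x \<in> span (G :: 'a::complex_vector set)"
proof -
  have "subspace {x. c *\<^sub>C x \<in> span G}"
  proof -
    have "c *\<^sub>C r *\<^sub>R x = r *\<^sub>R c *\<^sub>C x" for r and x :: 'a
      by (simp add: scaleC_of_real[symmetric] scaleC_scaleC mult.commute)
    then show ?thesis by (auto simp: subspace_def scaleC_add_right span_zero span_add span_scale)
  qed
  then have "span G \<subseteq> {x. c *\<^sub>C x \<in> span G}" using assms(1) by (intro span_minimal) auto
  then show ?thesis using assms(2) by blast
qed

lemma span_mult:
  fixes G :: "'a::real_algebra set"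
  assumes G: "\<And>g h. g \<in> G \<Longrightarrow> h \<in> G \<Longrightarrow> g * h \<in> span G" and "x \<in> span G" "y \<in> span G"
  shows "x * y \<in> span G"
proof -
  have "span G \<subseteq> {y. g * y \<in> span G}" if "g \<in> G" for g
    using G that by (intro span_minimal) (auto simp: subspace_def distrib_left span_zero span_add span_scale)
  then have "span G \<subseteq> {x. x * y \<in> span G}"
    using assms(3) by (intro span_minimal) (auto simp: subspace_def distrib_right span_zero span_add span_scale)
  then show ?thesis using assms(2) by blast
qed

lemma star_subalgebra_span_monomials:
  fixes \<sigma> :: "'x::topological_space \<Rightarrow> 'x" and \<delta> :: "'a::star_algebra"
  assumes \<sigma>: "homeomorphism UNIV UNIV \<sigma> (inv \<sigma>)" and cov: "covariant_pair \<sigma> \<iota> \<delta>"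
  shows "star_subalgebra (span (monomials \<iota> \<delta>))"
proof -
  let ?G = "monomials \<iota> \<delta>"
  note iota = \<iota>_simps[OF \<sigma> cov]
  have u: "unitary_element \<delta>" by (rule unitary[OF \<sigma> cov])
  have mm: "g * h \<in> ?G" if gh: "g \<in> ?G" "h \<in> ?G" for g h
  proof -
    obtain f n f' m where *: "g = \<iota> f * unitary_power \<delta> n" "h = \<iota> f' * unitary_power \<delta> m"
      using gh by (auto simp: monomials_def)
    have "g * h = \<iota> f * (unitary_power \<delta> n * \<iota> f') * unitary_power \<delta> m"
      by (simp add: * mult.assoc)
    also have "\<dots> = \<iota> (f * cx_auto \<sigma> n f') * unitary_power \<delta> (n + m)"
      by (simp add: power_commute[OF \<sigma> cov] unitary_power_add[OF u] mult.assoc iota)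
    finally show ?thesis by (simp only: monomialI)
  qed
  have 1: "x * y \<in> span ?G" if "x \<in> span ?G" "y \<in> span ?G" for x y
    by (rule span_mult[OF _ that]) (rule span_base, rule mm)
  have cm: "c *\<^sub>C g \<in> ?G" if "g \<in> ?G" for c g
  proof -
    obtain f n where "g = \<iota> f * unitary_power \<delta> n" using \<open>g \<in> ?G\<close> by (auto simp: monomials_def)
    then have "c *\<^sub>C g = \<iota> (c *\<^sub>C f) * unitary_power \<delta> n" by (simp add: scaleC_mult_left iota)
    then show ?thesis by (simp only: monomialI)
  qed
  have 2: "c *\<^sub>C x \<in> span ?G" if "x \<in> span ?G" for c x
    by (rule span_scaleC[OF _ that]) (rule span_base, rule cm)
  have 3: "star x \<in> span ?G" if "x \<in> span ?G" for x
  proof -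
    have "star (\<iota> f * unitary_power \<delta> n) = \<iota> (cx_auto \<sigma> (- n) (star f)) * unitary_power \<delta> (- n)" for f n
      unfolding star_mult star_unitary_power \<iota>_simps(5)[OF \<sigma> cov, symmetric] by (rule power_commute[OF \<sigma> cov])
    then have "star g \<in> ?G" if "g \<in> ?G" for g
      using that by (auto simp: monomials_def)
    then have "span ?G \<subseteq> {x. star x \<in> span ?G}"
      by (intro span_minimal)
        (auto simp: subspace_def star_add star_zero star_scaleR span_zero span_add span_scale intro: span_base)
    then show ?thesis using that by blast
  qed
  have "1 \<in> ?G" using monomialI[of \<iota> 1 \<delta> 0] by (simp add: unitary_power_def iota)
  then have "1 \<in> span ?G" by (rule span_base)
  with 1 2 3 show ?thesis unfolding star_subalgebra_def by (simp add: span_add)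
qed

section \<open>The image of the crossed product and the commutant of the functions\<close>

locale crossed_product_rep =
  fixes \<sigma> :: "'x::t2_space \<Rightarrow> 'x" and A :: "'a::cstar_algebra set"
    and \<iota> :: "('x \<Rightarrow>\<^sub>C complex) \<Rightarrow> 'a" and \<delta> :: 'a
    and \<rho> :: "'a \<Rightarrow> 'h::chilbert_space bounded_op"
  assumes compact: "compact (UNIV :: 'x set)"
    and homeo: "homeomorphism UNIV UNIV \<sigma> (inv \<sigma>)"
    and cov_A: "covariant_pair \<sigma> \<iota> \<delta>"
    and A_gen: "A = cstar_generated (insert \<delta> (range \<iota>))"
    and hom_A: "unital_star_hom A \<rho>"
begin

sublocale A: star_rep A \<rho>
  unfolding star_rep_def star_rep_axioms_def using hom_A A_gen cstar_subalgebra_generated by simp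

lemma generators_mem: "\<iota> f \<in> A" "\<delta> \<in> A"
  using generated_subset[of "insert \<delta> (range \<iota>)"] by (auto simp: A_gen)

definition C :: "'h bounded_op set" where "C = \<rho> ` A"
definition \<pi> :: "('x \<Rightarrow>\<^sub>C complex) \<Rightarrow> 'h bounded_op" where "\<pi> f = \<rho> (\<iota> f)"
definition u :: "'h bounded_op" where "u = \<rho> \<delta>"
abbreviation U :: "int \<Rightarrow> 'h bounded_op" where "U n \<equiv> unitary_power u n"
definition B :: "'h bounded_op set" where "B = rep_commutant A \<iota> \<rho>"

sublocale C: cstar_subalgebra C
  unfolding C_def by (rule A.cstar_subalgebra_range)

lemma cov: "covariant_pair \<sigma> \<pi> u"
proof -
  note [simp] = \<iota>_simps[OF homeo cov_A] generators_mem
  have "unitary_element \<delta>" by (rule unitary[OF homeo cov_A])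
  then have "unitary_element u"
    by (simp add: unitary_element_def u_def A.rep_one flip: A.rep_star A.rep_mult[OF A.star_mem]
        A.rep_mult[OF _ A.star_mem])
  moreover have "u * \<pi> f * star u = \<pi> (cx_auto \<sigma> 1 f)" for f
  proof -
    have "\<delta> * \<iota> f * star \<delta> = \<iota> (cx_auto \<sigma> 1 f)" using cov_A by (simp add: covariant_pair_def)
    then show ?thesis
      by (simp add: u_def \<pi>_def A.mem flip: A.rep_star A.rep_mult)
  qed
  moreover have "unital_star_hom UNIV \<pi>"
    by (simp add: unital_star_hom_def \<pi>_def A.rep_one A.rep_add A.rep_mult A.rep_scaleC A.rep_star)
  ultimately show ?thesis by (simp add: covariant_pair_def)
qed

lemmas \<pi>_simps = \<iota>_simps[OF homeo cov]
lemmas U_\<pi> = power_commute[OF homeo cov]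
lemmas unitary_u = unitary[OF homeo cov]
lemmas U_add = unitary_power_add[OF unitary_u]

lemma \<pi>_diff: "\<pi> (f - g) = \<pi> f - \<pi> g"
  using \<pi>_simps(2)[of "f - g" g] by simp

lemma \<pi>_U: "\<pi> f * U n = U n * \<pi> (cx_auto \<sigma> (- n) f)"
  by (simp add: U_\<pi> cx_auto_simps(3)[OF homeo] flip: cx_auto_simps(4)[OF homeo])

lemma \<pi>_commute: "\<pi> f * \<pi> g = \<pi> g * \<pi> f"
proof -
  have "f * g = g * f" by (rule bcontfun_eqI) (simp add: times_bcontfun.rep_eq mult.commute)
  then show ?thesis by (simp flip: \<pi>_simps(3))
qed

lemma \<pi>_mem: "\<pi> f \<in> C" and u_mem: "u \<in> C"
  using generators_mem by (auto simp: C_def \<pi>_def u_def)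

lemma U_mem: "U n \<in> C"
  by (auto simp: unitary_power_def intro: C.mem u_mem)

lemma norm_U: "norm (U n) \<le> 1"
proof -
  have "star (U n) * U n = 1"
    by (simp add: star_unitary_power unitary_power_def[of _ 0] flip: U_add)
  then have "(norm (U n))\<^sup>2 \<le> 1\<^sup>2" using cstar_identity[of "U n"] norm_one_le[where 'a="'h bounded_op"] by simp
  then show ?thesis by (rule power2_le_imp_le) simp
qed

text \<open>The closure of the span of the monomials in \<iota> and \<delta> is a closed star-subalgebra that contains the
  generators of A, and \<rho> is continuous.\<close>

lemma C_subset_closure_monomials: "C \<subseteq> closure (span (monomials \<pi> u))"
proof
  fix c assume "c \<in> C"
  then obtain a where a: "a \<in> A" "c = \<rho> a" by (auto simp: C_def)
  have "\<rho> (unitary_power \<delta> n) = U n \<and> unitary_power \<delta> n \<in> A" for n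
  proof -
    have "\<rho> (v ^ k) = \<rho> v ^ k" if "v \<in> A" for v k
      using that by (induction k) (simp_all add: A.rep_one A.rep_mult A.mem)
    then show ?thesis
      using generators_mem by (simp add: unitary_power_def u_def A.rep_star A.mem)
  qed
  then have mono: "g \<in> A" "\<rho> g \<in> monomials \<pi> u" if "g \<in> monomials \<iota> \<delta>" for g
    using that generators_mem
    by (auto simp: monomials_def A.rep_mult \<pi>_def intro!: A.mult_mem) blast
  have span: "x \<in> A \<and> \<rho> x \<in> span (monomials \<pi> u)" if "x \<in> span (monomials \<iota> \<delta>)" for x
    using that
  proof (induction rule: span_induct_alt)
    case base
    then show ?case by (simp add: A.rep_zero A.mem span_zero)
  next
    case (step c x y)
    then show ?case
      using mono[of x] by (simp add: A.rep_add A.rep_scaleR A.mem span_add span_scale span_base)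
  qed
  have "insert \<delta> (range \<iota>) \<subseteq> span (monomials \<iota> \<delta>)"
  proof -
    have "\<iota> f \<in> monomials \<iota> \<delta>" for f
      using monomialI[of \<iota> f \<delta> 0] by (simp add: unitary_power_def)
    moreover have "\<delta> \<in> monomials \<iota> \<delta>"
      using monomialI[of \<iota> 1 \<delta> 1] by (simp add: unitary_power_def \<iota>_simps[OF homeo cov_A])
    ultimately show ?thesis by (auto intro: span_base)
  qed
  then have "A \<subseteq> closure (span (monomials \<iota> \<delta>))"
    unfolding A_gen using closure_subset
    by (intro generated_least cstar_subalgebra_closure star_subalgebra_span_monomials[OF homeo cov_A]) blast
  then obtain x where x: "\<And>n. x n \<in> span (monomials \<iota> \<delta>)" "x \<longlonglongrightarrow> a"
    using a(1) closure_sequential by blast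
  have "(\<lambda>n. \<rho> (x n)) \<longlonglongrightarrow> c"
    unfolding a(2) by (rule A.rep_tendsto[OF _ a(1) x(2)]) (use span x(1) in blast)
  then show "c \<in> closure (span (monomials \<pi> u))"
    unfolding closure_sequential using span x(1) by (intro exI[of _ "\<lambda>n. \<rho> (x n)"]) simp
qed

lemma B_eq: "B = C \<inter> commutant (range \<pi>)"
proof -
  have "\<rho> (a * \<iota> f) = \<rho> (\<iota> f * a) \<longleftrightarrow> \<rho> a * \<pi> f = \<pi> f * \<rho> a" if "a \<in> A" for a f
    using that generators_mem by (simp add: A.rep_mult \<pi>_def)
  then show ?thesis unfolding B_def rep_commutant_def C_def commutant_def by auto
qed

lemma cstar_subalgebra_B: "cstar_subalgebra B"
  unfolding B_eq
  by (intro cstar_subalgebra_Int C.cstar_subalgebra_axioms cstar_subalgebra_commutant)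
    (auto simp flip: \<pi>_simps(5))

sublocale B: cstar_subalgebra B
  by (rule cstar_subalgebra_B)

lemma B_subset: "B \<subseteq> C" by (simp add: B_eq)

lemma B_commute: "b \<in> B \<Longrightarrow> b * \<pi> f = \<pi> f * b"
  by (auto simp: B_eq commutant_def)

lemma B_I: "c \<in> C \<Longrightarrow> (\<And>f. c * \<pi> f = \<pi> f * c) \<Longrightarrow> c \<in> B"
  by (auto simp: B_eq commutant_def)

lemma \<pi>_mem_B: "\<pi> f \<in> B"
  by (intro B_I \<pi>_mem \<pi>_commute)

lemma apply_Bcontfun: "continuous_on UNIV f \<Longrightarrow> apply_bcontfun (Bcontfun f) = f"
  for f :: "'x \<Rightarrow> complex"
  by (rule Bcontfun_inverse)
    (auto simp: bcontfun_def intro!: compact_imp_bounded compact_continuous_image compact)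

abbreviation val :: "('x \<Rightarrow>\<^sub>C complex) \<Rightarrow> 'x \<Rightarrow> complex" where "val \<equiv> apply_bcontfun"

text \<open>The function r^2 - \<bar>f\<bar>^2 is the square of a continuous function.\<close>

lemma norm_\<pi>_le:
  assumes f: "\<And>x. cmod (val f x) \<le> r"
  shows "norm (\<pi> f) \<le> r"
proof -
  have r: "0 \<le> r" using order_trans[OF norm_ge_zero f] .
  define g :: "'x \<Rightarrow>\<^sub>C complex" where
    "g = Bcontfun (\<lambda>x. of_real (sqrt (r\<^sup>2 - (cmod (val f x))\<^sup>2)))"
  have "continuous_on UNIV (\<lambda>x. complex_of_real (sqrt (r\<^sup>2 - (cmod (val f x))\<^sup>2)))"
    by (intro continuous_intros continuous_on_apply_bcontfun)
  then have g: "val g x = of_real (sqrt (r\<^sup>2 - (cmod (val f x))\<^sup>2))" for x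
    by (simp add: g_def apply_Bcontfun)
  have "star f * f + star g * g = of_real (r\<^sup>2) *\<^sub>C 1"
  proof (rule bcontfun_eqI)
    fix x
    have "(cmod (val f x))\<^sup>2 \<le> r\<^sup>2" using f by (intro power_mono) auto
    then have "val (star g * g) x = of_real (r\<^sup>2 - (cmod (val f x))\<^sup>2)"
      by (simp add: times_bcontfun.rep_eq star_bcontfun.rep_eq g star_complex_def flip: of_real_mult)
    moreover have "val (star f * f) x = of_real ((cmod (val f x))\<^sup>2)"
      by (simp add: times_bcontfun.rep_eq star_bcontfun.rep_eq star_complex_def mult.commute
          complex_norm_square[symmetric] del: of_real_power)
    ultimately show "val (star f * f + star g * g) x = val (of_real (r\<^sup>2) *\<^sub>C 1) x"
      by (simp add: plus_bcontfun.rep_eq scaleC_bcontfun.rep_eq one_bcontfun.rep_eq scaleC_complex_def)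
  qed
  then have "\<pi> (star f * f + star g * g) = \<pi> (of_real (r\<^sup>2) *\<^sub>C 1)" by simp
  then have "star (\<pi> f) * \<pi> f + star (\<pi> g) * \<pi> g = of_real (r\<^sup>2) *\<^sub>C 1"
    unfolding \<pi>_simps .
  then have "star (\<pi> f) * \<pi> f + star (\<pi> g) * \<pi> g = r\<^sup>2 *\<^sub>R 1"
    unfolding scaleC_of_real .
  then show ?thesis using r by (rule norm_le_of_sum_squares)
qed

end

section \<open>The commutant is commutative\<close>

context crossed_product_rep
begin

text \<open>Such functions, applied on the right, concentrate an element of C at the point x.\<close>

definition peak :: "'x \<Rightarrow> ('x \<Rightarrow>\<^sub>C complex) set" where
  "peak x = {p. val p x = 1 \<and> (\<forall>y. cmod (val p y) \<le> 1)}"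

lemma peak_mult: "p \<in> peak x \<Longrightarrow> q \<in> peak x \<Longrightarrow> p * q \<in> peak x"
  by (simp add: peak_def times_bcontfun.rep_eq norm_mult mult_le_one)

lemma peak_one: "1 \<in> peak x"
  by (simp add: peak_def one_bcontfun.rep_eq)

lemma norm_\<pi>_peak: "p \<in> peak x \<Longrightarrow> norm (\<pi> p) \<le> 1"
  by (rule norm_\<pi>_le) (simp add: peak_def)

lemma ex_peak_vanishing:
  assumes "y \<noteq> x"
  obtains p where "p \<in> peak x" "val p y = 0"
proof -
  have "\<exists>U V. openin euclidean U \<and> openin euclidean V \<and> a \<in> U \<and> b \<in> V \<and> disjnt U V"
    if "a \<noteq> b" for a b :: 'x
    using hausdorff[OF that] by (auto simp: disjnt_def)
  then have "Hausdorff_space (euclidean :: 'x topology)"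
    unfolding Hausdorff_space_def by simp
  then have "normal_space (euclidean :: 'x topology)"
    using compact by (intro compact_Hausdorff_or_regular_imp_normal_space) (auto simp: compact_space_def)
  then obtain f :: "'x \<Rightarrow> real" where f: "continuous_map euclidean (top_of_set {0..1}) f" "f ` {y} \<subseteq> {0}" "f ` {x} \<subseteq> {1}"
    using Urysohn_lemma[of euclidean "{y}" "{x}" 0 1] assms by (auto simp: disjnt_def)
  then have c: "continuous_on UNIV f" and r: "f z \<in> {0..1}" for z
    by (auto simp: continuous_map_in_subtopology)
  define p :: "'x \<Rightarrow>\<^sub>C complex" where "p = Bcontfun (\<lambda>z. of_real (f z))"
  have "val p z = of_real (f z)" for z
    unfolding p_def by (subst apply_Bcontfun) (auto intro: continuous_intros c)
  then show ?thesis using that[of p] f r by (auto simp: peak_def)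
qed

text \<open>This is the closed left ideal of C generated by the functions that vanish at x. Two elements of C that
  differ by an element of K x act in the same way on vectors v with \<pi>(f) v = f(x) v for all f; as
  such vectors need not exist, they are replaced by norms.\<close>

definition K :: "'x \<Rightarrow> 'h bounded_op set" where
  "K x = {c \<in> C. \<forall>e>0. \<exists>p\<in>peak x. norm (c * \<pi> p) < e}"

lemma K_I: "c \<in> C \<Longrightarrow> (\<And>e. e > 0 \<Longrightarrow> \<exists>p\<in>peak x. norm (c * \<pi> p) < e) \<Longrightarrow> c \<in> K x"
  by (simp add: K_def)

lemma K_D: "c \<in> K x \<Longrightarrow> e > 0 \<Longrightarrow> \<exists>p\<in>peak x. norm (c * \<pi> p) < e"
  by (simp add: K_def)

lemma K_C: "c \<in> K x \<Longrightarrow> c \<in> C"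
  by (simp add: K_def)

lemma norm_mult_peak: "p \<in> peak x \<Longrightarrow> norm (c * \<pi> p) \<le> norm c"
  using norm_mult_ineq[of c "\<pi> p"] mult_left_mono[OF norm_\<pi>_peak[of p x], of "norm c"] by simp

lemma K_zero: "0 \<in> K x"
  by (rule K_I[OF C.zero_mem]) (use peak_one in auto)

lemma K_add:
  assumes "c \<in> K x" "d \<in> K x"
  shows "c + d \<in> K x"
proof (rule K_I)
  show "c + d \<in> C" using assms K_C C.add_mem by blast
  fix e :: real assume "e > 0"
  then have e: "e / 2 > 0" by simp
  obtain p where p: "p \<in> peak x" "norm (c * \<pi> p) < e / 2" using K_D[OF assms(1) e] by blast
  obtain q where q: "q \<in> peak x" "norm (d * \<pi> q) < e / 2" using K_D[OF assms(2) e] by blast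
  have "norm ((c + d) * \<pi> (p * q)) \<le> norm ((c * \<pi> p) * \<pi> q) + norm ((d * \<pi> q) * \<pi> p)"
  proof -
    have "(c + d) * \<pi> (p * q) = (c * \<pi> p) * \<pi> q + (d * \<pi> q) * \<pi> p"
      by (simp add: \<pi>_simps(3) distrib_right mult.assoc \<pi>_commute[of q p])
    then show ?thesis by (simp only: norm_triangle_ineq)
  qed
  also have "\<dots> \<le> norm (c * \<pi> p) + norm (d * \<pi> q)"
    by (intro add_mono norm_mult_peak[OF q(1)] norm_mult_peak[OF p(1)])
  also have "\<dots> < e" using p q by simp
  finally show "\<exists>p\<in>peak x. norm ((c + d) * \<pi> p) < e" using peak_mult p q by blast
qed

text \<open>The common part of the closure properties of K x under multiplication from the left by C and from the
  right by B and by certain powers of u.\<close>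

lemma K_bounded:
  assumes k: "k \<in> K x" and c: "c \<in> C" and "M \<ge> 0"
    and le: "\<And>p. p \<in> peak x \<Longrightarrow> \<exists>q\<in>peak x. norm (c * \<pi> q) \<le> M * norm (k * \<pi> p)"
  shows "c \<in> K x"
proof (rule K_I[OF c])
  fix e :: real assume "e > 0"
  then have "e / (M + 1) > 0" using \<open>M \<ge> 0\<close> by simp
  from K_D[OF k this] obtain p where p: "p \<in> peak x" "norm (k * \<pi> p) < e / (M + 1)" by blast
  then obtain q where q: "q \<in> peak x" "norm (c * \<pi> q) \<le> M * norm (k * \<pi> p)" using le by blast
  have "M * norm (k * \<pi> p) \<le> (M + 1) * norm (k * \<pi> p)" by (intro mult_right_mono) auto
  also have "\<dots> < e" using p(2) \<open>M \<ge> 0\<close> by (simp add: pos_less_divide_eq mult.commute)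
  finally show "\<exists>p\<in>peak x. norm (c * \<pi> p) < e" using q by force
qed

lemma K_left:
  assumes "k \<in> K x" "a \<in> C"
  shows "a * k \<in> K x"
proof (rule K_bounded[OF assms(1)])
  show "a * k \<in> C" using assms K_C C.mult_mem by blast
  show "\<exists>q\<in>peak x. norm (a * k * \<pi> q) \<le> norm a * norm (k * \<pi> p)" if "p \<in> peak x" for p
    using that norm_mult_ineq[of a "k * \<pi> p"] by (auto simp: mult.assoc)
qed simp

lemma K_scaleC: "k \<in> K x \<Longrightarrow> c *\<^sub>C k \<in> K x"
  using K_left[of k x "c *\<^sub>C 1"] by (simp add: scaleC_mult_left C.mem)

lemma K_diff: "c \<in> K x \<Longrightarrow> d \<in> K x \<Longrightarrow> c - d \<in> K x"
  using K_add[of c x "(-1) *\<^sub>C d"] K_scaleC[of d x "-1"] by (simp add: scaleC_minus_left)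

lemma K_mult_B:
  assumes k: "k \<in> K x" and b: "b \<in> B"
  shows "k * b \<in> K x"
proof (rule K_bounded[OF k])
  show "k * b \<in> C" using k b B_subset by (auto intro: C.mult_mem K_C)
  show "\<exists>q\<in>peak x. norm (k * b * \<pi> q) \<le> norm b * norm (k * \<pi> p)" if "p \<in> peak x" for p
  proof
    have "k * b * \<pi> p = (k * \<pi> p) * b" by (simp add: mult.assoc B_commute[OF b])
    then show "norm (k * b * \<pi> p) \<le> norm b * norm (k * \<pi> p)"
      using norm_mult_ineq[of "k * \<pi> p" b] by (simp add: mult.commute)
  qed (fact that)
qed simp

text \<open>Peak functions at x are permuted by \<sigma>^n because it fixes x.\<close>

lemma K_mult_U:
  assumes k: "k \<in> K x" and n: "int_iterate \<sigma> n x = x"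
  shows "k * U n \<in> K x"
proof (rule K_bounded[OF k])
  show "k * U n \<in> C" using k by (intro C.mult_mem K_C U_mem)
  show "\<exists>q\<in>peak x. norm (k * U n * \<pi> q) \<le> 1 * norm (k * \<pi> p)" if p: "p \<in> peak x" for p
  proof
    show "cx_auto \<sigma> (- n) p \<in> peak x"
      using p n by (simp add: peak_def apply_cx_auto[OF homeo])
    have "k * U n * \<pi> (cx_auto \<sigma> (- n) p) = (k * \<pi> p) * U n"
      by (simp add: mult.assoc \<pi>_U)
    then show "norm (k * U n * \<pi> (cx_auto \<sigma> (- n) p)) \<le> 1 * norm (k * \<pi> p)"
      using norm_mult_ineq[of "k * \<pi> p" "U n"] mult_left_mono[OF norm_U[of n], of "norm (k * \<pi> p)"]
      by simp
  qed
qed simp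

lemma K_closed:
  assumes c: "c \<in> C" and near: "\<And>e. e > 0 \<Longrightarrow> \<exists>k\<in>K x. norm (c - k) < e"
  shows "c \<in> K x"
proof (rule K_I[OF c])
  fix e :: real assume "e > 0"
  then have e: "e / 2 > 0" by simp
  obtain k where k: "k \<in> K x" "norm (c - k) < e / 2" using near[OF e] by blast
  obtain p where p: "p \<in> peak x" "norm (k * \<pi> p) < e / 2" using K_D[OF k(1) e] by blast
  have "norm (c * \<pi> p) \<le> norm ((c - k) * \<pi> p) + norm (k * \<pi> p)"
    using norm_triangle_ineq[of "(c - k) * \<pi> p" "k * \<pi> p"] by (simp flip: distrib_right)
  also have "\<dots> < e" using norm_mult_peak[OF p(1), of "c - k"] k(2) p(2) by linarith
  finally show "\<exists>p\<in>peak x. norm (c * \<pi> p) < e" using p(1) by blast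
qed

text \<open>The peak function p = max 0 (1 - \<bar>f - f(x)\<bar> / d) lives where f is close to f(x), so (f - f(x)) p is bounded
  by d.\<close>

lemma K_eval:
  assumes c: "c \<in> C"
  shows "c * \<pi> f - val f x *\<^sub>C c \<in> K x"
proof (rule K_I)
  show "c * \<pi> f - val f x *\<^sub>C c \<in> C" by (intro C.mem c \<pi>_mem)
  fix e :: real assume "e > 0"
  define f0 where "f0 = f - val f x *\<^sub>C 1"
  have f0: "val f0 y = val f y - val f x" for y
    by (simp add: f0_def minus_bcontfun.rep_eq scaleC_bcontfun.rep_eq one_bcontfun.rep_eq scaleC_complex_def)
  define d where "d = e / (norm c + 1)"
  have d: "d > 0" using \<open>e > 0\<close> by (simp add: d_def add_nonneg_pos)
  define p where "p = Bcontfun (\<lambda>y. complex_of_real (max 0 (1 - cmod (val f0 y) / d)))"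
  have p: "val p y = of_real (max 0 (1 - cmod (val f0 y) / d))" for y
    unfolding p_def using d by (subst apply_Bcontfun) (auto intro!: continuous_intros)
  have "p \<in> peak x" using d by (simp add: peak_def p f0)
  have "norm (\<pi> (f0 * p)) \<le> d"
  proof (rule norm_\<pi>_le)
    fix y
    show "cmod (val (f0 * p) y) \<le> d"
    proof (cases "cmod (val f0 y) \<le> d")
      case True
      then have "cmod (val f0 y) * max 0 (1 - cmod (val f0 y) / d) \<le> d * 1"
        using d by (intro mult_mono) auto
      then show ?thesis by (simp add: times_bcontfun.rep_eq norm_mult p)
    next
      case False
      then have "1 - cmod (val f0 y) / d \<le> 0" using d by (simp add: pos_le_divide_eq)
      then show ?thesis using d by (simp add: times_bcontfun.rep_eq p max_def)
    qed
  qed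
  moreover have "(c * \<pi> f - val f x *\<^sub>C c) * \<pi> p = c * \<pi> (f0 * p)"
    by (simp add: \<pi>_simps f0_def \<pi>_diff left_diff_distrib right_diff_distrib scaleC_mult_left
        scaleC_mult_right mult.assoc)
  ultimately have "norm ((c * \<pi> f - val f x *\<^sub>C c) * \<pi> p) \<le> norm c * d"
    using norm_mult_ineq[of c "\<pi> (f0 * p)"] by (metis mult_left_mono norm_ge_zero order_trans)
  also have "\<dots> < (norm c + 1) * d" using d by simp
  also have "\<dots> = e" by (simp add: d_def add_nonneg_eq_0_iff)
  finally show "\<exists>p\<in>peak x. norm ((c * \<pi> f - val f x *\<^sub>C c) * \<pi> p) < e"
    using \<open>p \<in> peak x\<close> by blast
qed

text \<open>A commutative algebra; up to closure, it is what remains of C when one cuts down to the point x.\<close>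

definition stab :: "'x \<Rightarrow> 'h bounded_op set" where
  "stab x = span {c *\<^sub>C U n |c n. int_iterate \<sigma> n x = x}"

lemma stab_add: "s \<in> stab x \<Longrightarrow> t \<in> stab x \<Longrightarrow> s + t \<in> stab x"
  and stab_scaleR: "s \<in> stab x \<Longrightarrow> r *\<^sub>R s \<in> stab x"
  by (auto simp: stab_def span_add span_scale)

lemma stab_induct: "P 0 \<Longrightarrow> (\<And>s t. P s \<Longrightarrow> P t \<Longrightarrow> P (s + t)) \<Longrightarrow> (\<And>r s. P s \<Longrightarrow> P (r *\<^sub>R s)) \<Longrightarrow>
    (\<And>c n. int_iterate \<sigma> n x = x \<Longrightarrow> P (c *\<^sub>C U n)) \<Longrightarrow> s \<in> stab x \<Longrightarrow> P s"
  using span_minimal[of "{c *\<^sub>C U n |c n. int_iterate \<sigma> n x = x}" "Collect P"]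
  unfolding stab_def subspace_def by blast

lemma stab_commute:
  assumes "s \<in> stab x" "t \<in> stab x"
  shows "s * t = t * s"
proof -
  have "U n * t = t * U n" if "t \<in> stab x" for n t
    by (rule stab_induct[OF _ _ _ _ that])
      (simp_all add: distrib_left distrib_right scaleC_mult_left scaleC_mult_right add.commute flip: U_add)
  then have "c *\<^sub>C U n * t = t * c *\<^sub>C U n" for c n
    using assms(2) by (simp add: scaleC_mult_left scaleC_mult_right)
  then show ?thesis
    using assms(1) by (intro stab_induct[of "\<lambda>s. s * t = t * s" x s]) (auto simp: distrib_left distrib_right)
qed

text \<open>Modulo K x, the product \<pi>(p) \<pi>(f) u^n is the multiple of u^n by (p f)(\<sigma>^n x). If \<sigma>^n x differs from x,
  a peak function p can be chosen to vanish there; so the monomials outside the stabiliser disappear. The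
  quantification over q allows the peak functions for two summands to be multiplied.\<close>

lemma span_monomials_mod_K:
  assumes "s \<in> span (monomials \<pi> u)"
  shows "\<exists>p\<in>peak x. \<exists>t\<in>stab x. \<forall>q\<in>peak x. \<pi> (p * q) * s - t \<in> K x"
  using assms
proof (induction rule: span_induct_alt)
  case base
  show ?case
    using peak_one K_zero by (auto simp: stab_def intro!: bexI[of _ 1] bexI[of _ 0] span_zero)
next
  case (step r g s)
  from step.IH obtain p t where pt: "p \<in> peak x" "t \<in> stab x"
    "\<And>q. q \<in> peak x \<Longrightarrow> \<pi> (p * q) * s - t \<in> K x" by blast
  obtain f n where g: "g = \<pi> f * U n" using step.hyps by (auto simp: monomials_def)
  have eval: "\<pi> q * g - (val q (int_iterate \<sigma> n x) * val f (int_iterate \<sigma> n x)) *\<^sub>C U n \<in> K x"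
    for q
  proof -
    have "\<pi> q * g = U n * \<pi> (cx_auto \<sigma> (- n) (q * f))"
      by (simp add: g \<pi>_simps flip: mult.assoc \<pi>_U)
    moreover have "val (cx_auto \<sigma> (- n) (q * f)) x =
        val q (int_iterate \<sigma> n x) * val f (int_iterate \<sigma> n x)"
      by (simp add: apply_cx_auto[OF homeo] times_bcontfun.rep_eq)
    ultimately show ?thesis using K_eval[OF U_mem, of n "cx_auto \<sigma> (- n) (q * f)" x] by simp
  qed
  have "\<exists>p\<in>peak x. \<exists>t\<in>stab x. \<forall>q\<in>peak x. \<pi> (p * q) * g - t \<in> K x"
  proof (cases "int_iterate \<sigma> n x = x")
    case True
    have "\<pi> (1 * q) * g - val f x *\<^sub>C U n \<in> K x" if "q \<in> peak x" for q
      using eval[of "1 * q"] that True by (simp add: peak_def times_bcontfun.rep_eq one_bcontfun.rep_eq)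
    moreover have "val f x *\<^sub>C U n \<in> stab x"
      unfolding stab_def by (rule span_base) (use True in blast)
    ultimately show ?thesis using peak_one by blast
  next
    case False
    then obtain p where p: "p \<in> peak x" "val p (int_iterate \<sigma> n x) = 0"
      using ex_peak_vanishing by blast
    have "\<pi> (p * q) * g - 0 \<in> K x" for q
      using eval[of "p * q"] by (simp add: times_bcontfun.rep_eq p(2))
    moreover have "0 \<in> stab x" by (simp add: stab_def span_zero)
    ultimately show ?thesis using p(1) by blast
  qed
  then obtain p' t' where pt': "p' \<in> peak x" "t' \<in> stab x"
    "\<And>q. q \<in> peak x \<Longrightarrow> \<pi> (p' * q) * g - t' \<in> K x" by blast
  have "\<pi> ((p' * p) * q) * (r *\<^sub>R g + s) - (r *\<^sub>R t' + t) \<in> K x" if q: "q \<in> peak x" for q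
  proof -
    have pq: "\<pi> ((p' * p) * q) = \<pi> (p' * (p * q))" "\<pi> ((p' * p) * q) = \<pi> (p * (p' * q))"
      by (simp_all only: \<pi>_simps mult.assoc) (metis \<pi>_commute mult.assoc)
    have "of_real r *\<^sub>C (\<pi> ((p' * p) * q) * g - t') + (\<pi> ((p' * p) * q) * s - t) \<in> K x"
    proof (intro K_add K_scaleC)
      show "\<pi> (p' * p * q) * g - t' \<in> K x"
        unfolding pq(1) by (intro pt' peak_mult pt q)
      show "\<pi> (p' * p * q) * s - t \<in> K x"
        unfolding pq(2) by (intro pt peak_mult pt' q)
    qed
    also have "of_real r *\<^sub>C (\<pi> ((p' * p) * q) * g - t') + (\<pi> ((p' * p) * q) * s - t) =
        \<pi> ((p' * p) * q) * (r *\<^sub>R g + s) - (r *\<^sub>R t' + t)"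
      by (simp add: scaleC_of_real scaleR_diff_right distrib_left)
    finally show ?thesis .
  qed
  then show ?case
    using peak_mult[OF pt'(1) pt(1)] stab_add[OF stab_scaleR[OF pt'(2)] pt(2)] by blast
qed

text \<open>Modulo K x, b = b \<pi>(p) = \<pi>(p) b, and b may be approximated by a combination s of monomials, for which
  \<pi>(p) s is known by \<open>span_monomials_mod_K\<close>.\<close>

lemma B_mod_K:
  assumes b: "b \<in> B" and "e > 0"
  obtains t k where "t \<in> stab x" "k \<in> K x" "norm (b - t - k) < e"
proof -
  have "b \<in> closure (span (monomials \<pi> u))" using b B_subset C_subset_closure_monomials by blast
  then obtain s where s: "s \<in> span (monomials \<pi> u)" "norm (b - s) < e"
    using \<open>e > 0\<close> by (auto simp: closure_approachable dist_norm norm_minus_commute)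
  obtain p t where p: "p \<in> peak x" and t: "t \<in> stab x" and pt: "\<pi> (p * 1) * s - t \<in> K x"
    using span_monomials_mod_K[OF s(1), of x] peak_one by blast
  define k where "k = (\<pi> (p * 1) * s - t) - (b * \<pi> p - val p x *\<^sub>C b)"
  have "k \<in> K x" unfolding k_def by (rule K_diff[OF pt K_eval]) (use b B_subset in blast)
  moreover have "b - t - k = \<pi> p * (b - s)"
    using p by (simp add: k_def peak_def B_commute[OF b] right_diff_distrib)
  then have "norm (b - t - k) \<le> norm (\<pi> p) * norm (b - s)" by (simp add: norm_mult_ineq)
  then have "norm (b - t - k) < e"
    using s(2) mult_right_mono[OF norm_\<pi>_peak[OF p], of "norm (b - s)"] by simp
  ultimately show ?thesis using that t by blast
qed

text \<open>By \<open>B_mod_K\<close>, b commutes modulo K x with the powers of u in the stabiliser, since these commute with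
  each other. Hence it commutes modulo K x with the approximations of c. Doing this in two steps avoids
  products of an error with a polynomial in u of uncontrolled norm.\<close>

lemma commutator_mod_K:
  assumes b: "b \<in> B" and c: "c \<in> B"
  shows "b * c - c * b \<in> K x"
proof -
  have bC: "b \<in> C" "c \<in> C" using b c B_subset by auto
  have U: "b * U n - U n * b \<in> K x" if n: "int_iterate \<sigma> n x = x" for n
  proof (rule K_closed)
    show "b * U n - U n * b \<in> C" by (intro C.mem bC U_mem)
    fix e :: real assume "e > 0"
    then have "e / 2 > 0" by simp
    then obtain t k where t: "t \<in> stab x" and k: "k \<in> K x" and r: "norm (b - t - k) < e / 2"
      using B_mod_K[OF b] by blast
    have "1 *\<^sub>C U n \<in> stab x" unfolding stab_def by (rule span_base) (use n in blast)
    then have "t * U n = U n * t" using stab_commute[OF t] by simp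
    then have "b * U n - U n * b - (k * U n - U n * k) = (b - t - k) * U n - U n * (b - t - k)"
      by (simp add: algebra_simps)
    also have "norm \<dots> \<le> norm ((b - t - k) * U n) + norm (U n * (b - t - k))"
      by (rule norm_triangle_ineq4)
    also have "\<dots> \<le> norm (b - t - k) + norm (b - t - k)"
      using norm_mult_ineq[of "b - t - k" "U n"] norm_mult_ineq[of "U n" "b - t - k"]
        mult_left_mono[OF norm_U[of n], of "norm (b - t - k)"]
        mult_right_mono[OF norm_U[of n], of "norm (b - t - k)"] by simp
    also have "\<dots> < e" using r by simp
    finally show "\<exists>k\<in>K x. norm (b * U n - U n * b - k) < e"
      using K_diff[OF K_mult_U[OF k n] K_left[OF k U_mem]] by blast
  qed
  have S: "b * t - t * b \<in> K x" if "t \<in> stab x" for t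
  proof (rule stab_induct[OF _ _ _ _ that])
    show "b * 0 - 0 * b \<in> K x" by (simp add: K_zero)
    show "b * (s + t) - (s + t) * b \<in> K x" if "b * s - s * b \<in> K x" "b * t - t * b \<in> K x" for s t
      using K_add[OF that] by (simp add: algebra_simps)
    show "b * r *\<^sub>R s - r *\<^sub>R s * b \<in> K x" if "b * s - s * b \<in> K x" for r s
      using K_scaleC[OF that, of "of_real r"] by (simp add: scaleC_of_real scaleR_diff_right)
    show "b * a *\<^sub>C U n - a *\<^sub>C U n * b \<in> K x" if "int_iterate \<sigma> n x = x" for a n
      using K_scaleC[OF U[OF that], of a] by (simp add: scaleC_mult_left scaleC_mult_right scaleC_diff)
  qed
  show ?thesis
  proof (rule K_closed)
    show "b * c - c * b \<in> C" by (intro C.mem bC)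
    fix e :: real assume "e > 0"
    define d where "d = e / (2 * norm b + 1)"
    have d: "d > 0" using \<open>e > 0\<close> by (simp add: d_def add_nonneg_pos)
    obtain t k where t: "t \<in> stab x" and k: "k \<in> K x" and r: "norm (c - t - k) < d"
      using B_mod_K[OF c d] by blast
    have "(b * t - t * b) + (b * k - k * b) \<in> K x"
      by (intro K_add K_diff S t K_left K_mult_B k b bC)
    moreover have "norm (b * c - c * b - ((b * t - t * b) + (b * k - k * b))) < e"
    proof -
      have "b * c - c * b - ((b * t - t * b) + (b * k - k * b)) = b * (c - t - k) - (c - t - k) * b"
        by (simp add: algebra_simps)
      also have "norm \<dots> \<le> norm (b * (c - t - k)) + norm ((c - t - k) * b)"
        by (rule norm_triangle_ineq4)
      also have "\<dots> \<le> norm b * norm (c - t - k) + norm (c - t - k) * norm b"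
        by (intro add_mono norm_mult_ineq)
      also have "\<dots> \<le> 2 * norm b * d"
        using mult_left_mono[of "norm (c - t - k)" d "norm b"] r by (simp add: mult.commute)
      also have "\<dots> < (2 * norm b + 1) * d" using d by simp
      also have "\<dots> = e" by (simp add: d_def add_nonneg_eq_0_iff)
      finally show ?thesis .
    qed
    ultimately show "\<exists>k\<in>K x. norm (b * c - c * b - k) < e" by blast
  qed
qed

text \<open>If no point is hit, then for each x some h x with \<kappa>(\<pi>(h x)) = 0 is non-zero at x. By compactness a finite
  sum g of the functions \<bar>h x\<bar>^2 is invertible, although \<kappa>(\<pi>(g)) = 0.\<close>

lemma character_\<pi>_eq_eval:
  assumes "cstar_subalgebra D" "range \<pi> \<subseteq> D" "\<kappa> \<in> characters D"
  obtains x where "\<And>f. \<kappa> (\<pi> f) = val f x"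
proof -
  interpret \<kappa>: character D \<kappa> using assms by (simp add: character_def character_axioms_def)
  have \<pi>D: "\<pi> f \<in> D" for f using assms(2) by blast
  show ?thesis
  proof (rule ccontr)
    assume "\<not> thesis"
    then have "\<exists>f. \<kappa> (\<pi> f) \<noteq> val f x" for x using that by blast
    then obtain f where f: "\<And>x. \<kappa> (\<pi> (f x)) \<noteq> val (f x) x" by metis
    define h where "h x = f x - \<kappa> (\<pi> (f x)) *\<^sub>C 1" for x
    have h: "val (h x) y = val (f x) y - \<kappa> (\<pi> (f x))" for x y
      by (simp add: h_def minus_bcontfun.rep_eq scaleC_bcontfun.rep_eq one_bcontfun.rep_eq scaleC_complex_def)
    have "\<kappa> (\<pi> (h x)) = 0" for x
      by (simp add: h_def \<pi>_diff \<pi>_simps \<kappa>.char_diff \<kappa>.char_scaleC \<kappa>.char_one \<kappa>.mem \<pi>D)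
    then have z: "\<kappa> (\<pi> (star (h x) * h x)) = 0" for x
      by (simp only: \<pi>_simps) (simp add: \<kappa>.char_mult \<kappa>.mem \<pi>D)
    define V where "V x = {y. val (h x) y \<noteq> 0}" for x
    have "open (V x)" for x
    proof -
      have "closed {y. val (h x) y = 0}"
        by (intro closed_Collect_eq continuous_on_apply_bcontfun continuous_intros)
      then show ?thesis unfolding V_def by (simp add: open_closed Collect_neg_eq[symmetric])
    qed
    moreover have "x \<in> V x" for x using f[of x] by (simp add: V_def h)
    then have "UNIV \<subseteq> (\<Union>x\<in>UNIV. V x)" by blast
    ultimately obtain F where F: "finite F" "UNIV \<subseteq> (\<Union>x\<in>F. V x)"
      using compactE_image[OF compact, of UNIV V] by auto
    define g where "g = (\<Sum>x\<in>F. star (h x) * h x)"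
    have g: "val g y = of_real (\<Sum>x\<in>F. (cmod (val (h x) y))\<^sup>2)" for y
    proof -
      have "val g y = (\<Sum>x\<in>F. val (star (h x) * h x) y)"
        unfolding g_def by (induction F rule: infinite_finite_induct) (simp_all add: plus_bcontfun.rep_eq)
      also have "\<dots> = (\<Sum>x\<in>F. of_real ((cmod (val (h x) y))\<^sup>2))"
        by (rule sum.cong) (simp_all add: times_bcontfun.rep_eq star_bcontfun.rep_eq star_complex_def
            mult.commute complex_norm_square[symmetric] del: of_real_power)
      finally show ?thesis by simp
    qed
    have gnz: "val g y \<noteq> 0" for y
    proof -
      obtain x where x: "x \<in> F" "val (h x) y \<noteq> 0" using F(2) by (auto simp: V_def)
      then have "0 < (\<Sum>x\<in>F. (cmod (val (h x) y))\<^sup>2)"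
        by (intro sum_pos2[OF F(1) x(1)]) auto
      then show ?thesis unfolding g of_real_eq_0_iff by linarith
    qed
    define k where "k = Bcontfun (\<lambda>y. 1 / val g y)"
    have "val k y = 1 / val g y" for y
      unfolding k_def using gnz by (subst apply_Bcontfun) (auto intro!: continuous_intros)
    then have "g * k = 1"
      by (intro bcontfun_eqI) (simp add: times_bcontfun.rep_eq one_bcontfun.rep_eq gnz)
    then have "\<kappa> (\<pi> g * \<pi> k) = 1" by (simp add: \<pi>_simps(1) \<kappa>.char_one flip: \<pi>_simps(3))
    moreover have "\<pi> g = (\<Sum>x\<in>F. \<pi> (star (h x) * h x))"
      unfolding g_def by (rule \<iota>_sum[OF homeo cov])
    then have "\<kappa> (\<pi> g) = 0" by (simp add: \<kappa>.char_sum \<pi>D z)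
    ultimately show False by (simp add: \<kappa>.char_mult \<pi>D)
  qed
qed

text \<open>The double commutant of D = d^* d and \<pi>(C(X)) is a commutative algebra. A character \<kappa> of it is the evaluation
  at a point x on \<pi>(C(X)), so that \<bar>\<kappa>(D)\<bar> = \<bar>\<kappa>(D \<pi>(p))\<bar> \<le> \<parallel>D \<pi>(p)\<parallel> for all peak functions p at x; the
  infimum of the right side is 0.\<close>

lemma eq_zero_of_K:
  assumes d: "d \<in> B" "\<And>x. d \<in> K x"
  shows "d = 0"
proof (rule ccontr)
  assume "d \<noteq> 0"
  define D where "D = star d * d"
  have "D \<noteq> 0" using \<open>d \<noteq> 0\<close> cstar_identity[of d] by (auto simp: D_def)
  have D: "D \<in> B" "star D = D" "D \<in> K x" for x
    using d B_subset by (auto simp: D_def star_mult star_star intro: B.mem K_left C.star_mem)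
  define S where "S = insert D (range \<pi>)"
  have starS: "star s \<in> S" if "s \<in> S" for s
    using that D(2) by (auto simp: S_def simp flip: \<pi>_simps(5))
  have S: "S \<subseteq> commutant S"
    using B_commute[OF D(1)] by (auto simp: S_def commutant_def \<pi>_commute)
  interpret S': cstar_subalgebra "commutant S"
    by (rule cstar_subalgebra_commutant[OF starS])
  have S'': "cstar_subalgebra (commutant (commutant S))"
    by (rule cstar_subalgebra_commutant) (rule S'.star_mem)
  have comm: "commutative_cstar (commutant (commutant S))"
    unfolding commutative_cstar_def commutative_cstar_axioms_def
  proof (intro conjI allI impI S'')
    fix x y assume x: "x \<in> commutant (commutant S)" and y: "y \<in> commutant (commutant S)"
    have "y \<in> commutant S" using y S unfolding commutant_def by blast
    then show "x * y = y * x" using x unfolding commutant_def by blast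
  qed
  have sub: "S \<subseteq> commutant (commutant S)" by (auto simp: commutant_def)
  obtain \<kappa> where \<kappa>: "\<kappa> \<in> characters (commutant (commutant S))" "\<kappa> D \<noteq> 0"
    using ex_character_nonzero[OF comm _ \<open>D \<noteq> 0\<close>] sub by (auto simp: S_def)
  interpret \<kappa>: character "commutant (commutant S)" \<kappa>
    using S'' \<kappa>(1) by (simp add: character_def character_axioms_def)
  obtain x where x: "\<And>f. \<kappa> (\<pi> f) = val f x"
    using character_\<pi>_eq_eval[OF S'' _ \<kappa>(1)] sub by (auto simp: S_def)
  have "cmod (\<kappa> D) > 0" using \<kappa>(2) by simp
  then obtain p where p: "p \<in> peak x" "norm (D * \<pi> p) < cmod (\<kappa> D)"
    using K_D[OF D(3)] by blast
  have DS: "D \<in> commutant (commutant S)" "\<pi> p \<in> commutant (commutant S)" using sub by (auto simp: S_def)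
  then have "\<kappa> (D * \<pi> p) = \<kappa> D" using p(1) by (simp add: \<kappa>.char_mult x peak_def)
  moreover have "cmod (\<kappa> (D * \<pi> p)) \<le> norm (D * \<pi> p)" by (intro \<kappa>.norm_char_le \<kappa>.mult_mem DS)
  ultimately show False using p(2) by simp
qed

lemma B_commutative:
  assumes "b \<in> B" "c \<in> B"
  shows "b * c = c * b"
proof -
  have "b * c - c * b = 0"
    by (rule eq_zero_of_K) (intro B.mem assms, rule commutator_mod_K[OF assms])
  then show ?thesis by simp
qed

lemma commutative_cstar_B: "commutative_cstar B"
  by unfold_locales (rule B_commutative)

end

section \<open>Uniqueness of state extensions\<close>

context crossed_product_rep
begin

abbreviation Y :: "('h bounded_op \<Rightarrow> complex) topology" where "Y \<equiv> spectrum_topology B"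
abbreviation \<tau> :: "('h bounded_op \<Rightarrow> complex) \<Rightarrow> 'h bounded_op \<Rightarrow> complex" where
  "\<tau> \<equiv> spectrum_map B u"

lemma conj_u_mem_B:
  assumes b: "b \<in> B"
  shows "u * b * star u \<in> B" "star u * b * u \<in> B"
proof -
  have bC: "b \<in> C" using b B_subset by blast
  have u\<pi>: "u * \<pi> f = \<pi> (cx_auto \<sigma> 1 f) * u" "star u * \<pi> f = \<pi> (cx_auto \<sigma> (- 1) f) * star u"
      "\<pi> f * u = u * \<pi> (cx_auto \<sigma> (- 1) f)" "\<pi> f * star u = star u * \<pi> (cx_auto \<sigma> 1 f)" for f
    using U_\<pi>[of 1 f] U_\<pi>[of "- 1" f] \<pi>_U[of f 1] \<pi>_U[of f "- 1"] by (simp_all add: unitary_power_def)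
  show "u * b * star u \<in> B"
  proof (rule B_I)
    show "u * b * star u \<in> C" by (intro C.mem u_mem bC)
    fix f
    have "u * b * star u * \<pi> f = u * (b * \<pi> (cx_auto \<sigma> (- 1) f)) * star u"
      by (simp add: mult.assoc u\<pi>(2))
    also have "\<dots> = \<pi> f * (u * b * star u)"
      by (simp add: B_commute[OF b] flip: mult.assoc u\<pi>(3))
    finally show "u * b * star u * \<pi> f = \<pi> f * (u * b * star u)" .
  qed
  show "star u * b * u \<in> B"
  proof (rule B_I)
    show "star u * b * u \<in> C" by (intro C.mem u_mem bC)
    fix f
    have "star u * b * u * \<pi> f = star u * (b * \<pi> (cx_auto \<sigma> 1 f)) * u"
      by (simp add: mult.assoc u\<pi>(1))
    also have "\<dots> = \<pi> f * (star u * b * u)"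
      by (simp add: B_commute[OF b] flip: mult.assoc u\<pi>(4))
    finally show "star u * b * u * \<pi> f = \<pi> f * (star u * b * u)" .
  qed
qed

lemma conj_u_power_mem_B:
  assumes b: "b \<in> B"
  shows "u ^ n * b * star u ^ n \<in> B" "star u ^ n * b * u ^ n \<in> B"
proof (induction n)
  case (Suc n)
  have "u ^ Suc n * b * star u ^ Suc n = u * (u ^ n * b * star u ^ n) * star u"
    by (simp only: power_Suc[of u] power_Suc2[of "star u"] mult.assoc)
  moreover have "star u ^ Suc n * b * u ^ Suc n = star u * (star u ^ n * b * u ^ n) * u"
    by (simp only: power_Suc[of "star u"] power_Suc2[of u] mult.assoc)
  ultimately show "u ^ Suc n * b * star u ^ Suc n \<in> B" "star u ^ Suc n * b * u ^ Suc n \<in> B"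
    using Suc.IH conj_u_mem_B by auto
qed (use b in simp_all)

lemma u_power_cancel: "star u ^ n * u ^ n = 1" "u ^ n * star u ^ n = 1"
  using U_add[of "- int n" "int n"] U_add[of "int n" "- int n"]
  by (simp_all add: unitary_power_def split: if_splits)

lemma spectrum_map_power:
  assumes "\<omega> \<in> extensional B"
  shows "(\<tau> ^^ n) \<omega> = restrict (\<lambda>b. \<omega> (star u ^ n * b * u ^ n)) B"
proof (induction n)
  case 0
  then show ?case using assms by (simp add: extensional_restrict)
next
  case (Suc n)
  have "star u ^ n * (star u * b * u) * u ^ n = star u ^ Suc n * b * u ^ Suc n" for b
    by (simp only: power_Suc[of u] power_Suc2[of "star u"] mult.assoc)
  note power = this
  have "(\<tau> ^^ Suc n) \<omega> = restrict (\<lambda>b. restrict (\<lambda>b. \<omega> (star u ^ n * b * u ^ n)) B (star u * b * u)) B"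
    unfolding funpow.simps comp_apply Suc.IH by (rule spectrum_map_def)
  also have "\<dots> = restrict (\<lambda>b. \<omega> (star u ^ Suc n * b * u ^ Suc n)) B"
    by (rule restrict_ext) (use conj_u_mem_B(2) in \<open>simp only: restrict_apply' power\<close>)
  finally show ?case .
qed

lemma spectrum_map_fixed_iff:
  assumes \<omega>: "\<omega> \<in> characters B"
  shows "(\<tau> ^^ n) \<omega> = \<omega> \<longleftrightarrow> (\<forall>b\<in>B. \<omega> (u ^ n * b * star u ^ n) = \<omega> b)"
proof -
  have ext: "\<omega> \<in> extensional B" using \<omega> by (simp add: characters_def linear_functional_def)
  have cancel: "star u ^ n * (u ^ n * b * star u ^ n) * u ^ n = b"
    "u ^ n * (star u ^ n * b * u ^ n) * star u ^ n = b" for b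
    by (simp_all add: mult.assoc u_power_cancel) (simp_all add: u_power_cancel flip: mult.assoc)
  show ?thesis
  proof
    assume fixed: "(\<tau> ^^ n) \<omega> = \<omega>"
    show "\<forall>b\<in>B. \<omega> (u ^ n * b * star u ^ n) = \<omega> b"
    proof
      fix b assume b: "b \<in> B"
      have "(\<tau> ^^ n) \<omega> (u ^ n * b * star u ^ n) = \<omega> b"
        using conj_u_power_mem_B(1)[OF b, of n] by (simp add: spectrum_map_power[OF ext] cancel)
      then show "\<omega> (u ^ n * b * star u ^ n) = \<omega> b" unfolding fixed .
    qed
  next
    assume inv: "\<forall>b\<in>B. \<omega> (u ^ n * b * star u ^ n) = \<omega> b"
    have "(\<tau> ^^ n) \<omega> b = \<omega> b" for b
    proof (cases "b \<in> B")
      case True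
      then show ?thesis
        using inv conj_u_power_mem_B(2)[OF True, of n] cancel(2)[of b]
        by (simp add: spectrum_map_power[OF ext]) metis
    next
      case False
      then show ?thesis using ext by (simp add: spectrum_map_power[OF ext] extensional_def)
    qed
    then show "(\<tau> ^^ n) \<omega> = \<omega>" by blast
  qed
qed

lemma period_dvd_fixed:
  assumes "\<omega> \<in> points_of_period Y \<tau> k" "k dvd n"
  shows "(\<tau> ^^ n) \<omega> = \<omega>"
proof -
  have k: "(\<tau> ^^ k) \<omega> = \<omega>" using assms(1) by (simp add: points_of_period_def)
  have "(\<tau> ^^ (k * q)) \<omega> = \<omega>" for q
    by (induction q) (simp_all add: funpow_add k)
  then show ?thesis using assms(2) by (auto elim: dvdE)
qed

lemma period_dvd:
  assumes k: "\<omega> \<in> points_of_period Y \<tau> k" "k \<ge> 1" and n: "(\<tau> ^^ n) \<omega> = \<omega>"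
  shows "k dvd n"
proof -
  have "(\<tau> ^^ (k * q)) \<omega> = \<omega>" for q by (rule period_dvd_fixed[OF k(1)]) simp
  then have "(\<tau> ^^ (n mod k)) \<omega> = \<omega>"
    using n mod_mult_div_eq[of n k] by (metis comp_apply funpow_add)
  moreover have "n mod k < k" using k(2) by simp
  ultimately have "\<not> 1 \<le> n mod k" using k(1) by (auto simp: points_of_period_def)
  then show ?thesis by (simp add: dvd_eq_mod_eq_0)
qed

text \<open>The open set contains the characters \<omega>' with \<bar>\<omega>'(i) - \<omega>(i)\<bar> < r i for all i in a finite set. At \<omega>' the
  Gelfand transform of h is the sum of the squares of \<bar>\<omega>'(i) - \<omega>(i)\<bar> / r i, and F is max 0 (1 - \<bar>h\<bar>).\<close>

lemma openin_spectrum_bump: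
  assumes T: "openin Y T" "\<omega> \<in> T"
  obtains F where "F \<in> B" "\<omega> F = 1" "\<And>\<omega>'. \<omega>' \<in> characters B \<Longrightarrow> \<omega>' F \<noteq> 0 \<Longrightarrow> \<omega>' \<in> T"
proof -
  obtain W where W: "openin (product_topology (\<lambda>_. euclidean) B) W" "T = W \<inter> characters B"
    using T(1) by (auto simp: spectrum_topology_def openin_subtopology)
  obtain V where V: "finite {i \<in> B. V i \<noteq> (UNIV :: complex set)}" "\<And>i. i \<in> B \<Longrightarrow> open (V i)"
    "\<omega> \<in> PiE B V" "PiE B V \<subseteq> W"
    using W T(2) unfolding openin_product_topology_alt by auto
  have \<omega>: "\<omega> \<in> characters B" using T(2) W(2) by blast
  interpret \<omega>: character B \<omega> using \<omega> by unfold_locales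
  define I where "I = {i \<in> B. V i \<noteq> UNIV}"
  have "\<exists>r>0. ball (\<omega> i) r \<subseteq> V i" if "i \<in> B" for i
    using V(2,3) that by (auto simp: PiE_def Pi_def open_contains_ball)
  then obtain r where r: "\<And>i. i \<in> B \<Longrightarrow> r i > 0" "\<And>i. i \<in> B \<Longrightarrow> ball (\<omega> i) (r i) \<subseteq> V i" by metis
  define d where "d i = i - \<omega> i *\<^sub>C 1" for i
  define h where "h = (\<Sum>i\<in>I. (1 / (r i)\<^sup>2) *\<^sub>R (star (d i) * d i))"
  define M where "M = norm h + 1"
  define f :: "real \<Rightarrow> real" where "f t = max 0 (1 - \<bar>t\<bar>)" for t
  have dB: "d i \<in> B" if "i \<in> I" for i using that by (auto simp: d_def I_def intro!: B.mem)
  have h: "h \<in> B" "star h = h" "norm h < M"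
    using dB by (auto simp: h_def M_def star_sum star_scaleR star_mult star_star intro!: B.mem)
  have cont: "continuous_on S f" for S unfolding f_def by (intro continuous_intros)
  have h_char: "\<omega>' h = of_real (\<Sum>i\<in>I. (cmod (\<omega>' i - \<omega> i))\<^sup>2 / (r i)\<^sup>2)"
    if \<omega>': "\<omega>' \<in> characters B" for \<omega>'
  proof -
    interpret \<omega>': character B \<omega>' using \<omega>' by unfold_locales
    have di: "\<omega>' (d i) = \<omega>' i - \<omega> i" if "i \<in> I" for i
      using that by (simp add: d_def I_def \<omega>'.char_diff \<omega>'.char_scaleC \<omega>'.char_one B.mem)
    have "\<omega>' h = (\<Sum>i\<in>I. \<omega>' ((1 / (r i)\<^sup>2) *\<^sub>R (star (d i) * d i)))"
      unfolding h_def by (rule \<omega>'.char_sum) (intro B.mem dB)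
    also have "\<dots> = (\<Sum>i\<in>I. of_real ((cmod (\<omega>' i - \<omega> i))\<^sup>2 / (r i)\<^sup>2))"
    proof (rule sum.cong[OF refl])
      fix i assume i: "i \<in> I"
      have "\<omega>' ((1 / (r i)\<^sup>2) *\<^sub>R (star (d i) * d i)) = of_real (1 / (r i)\<^sup>2) * (cnj (\<omega>' (d i)) * \<omega>' (d i))"
        using dB[OF i] by (simp add: \<omega>'.char_scaleR \<omega>'.char_mult \<omega>'.char_star B.mem)
      also have "cnj (\<omega>' (d i)) * \<omega>' (d i) = of_real ((cmod (\<omega>' (d i)))\<^sup>2)"
        by (simp only: complex_norm_square mult.commute)
      finally show "\<omega>' ((1 / (r i)\<^sup>2) *\<^sub>R (star (d i) * d i)) = of_real ((cmod (\<omega>' i - \<omega> i))\<^sup>2 / (r i)\<^sup>2)"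
        by (simp add: di[OF i])
    qed
    finally show ?thesis by simp
  qed
  have F: "\<omega>' (cfc M h f) = of_real (f (Re (\<omega>' h)))" if "\<omega>' \<in> characters B" for \<omega>'
  proof -
    interpret \<omega>': character B \<omega>' using that by unfold_locales
    show ?thesis by (rule \<omega>'.char_cfc[OF h cont])
  qed
  show ?thesis
  proof
    show "cfc M h f \<in> B" by (rule cfc_mem[OF h(2,3) B.cstar_subalgebra_axioms h(1) cont])
    show "\<omega> (cfc M h f) = 1" unfolding F[OF \<omega>] h_char[OF \<omega>] by (simp add: f_def)
    fix \<omega>' assume \<omega>': "\<omega>' \<in> characters B" and nz: "\<omega>' (cfc M h f) \<noteq> 0"
    define q where "q i = (cmod (\<omega>' i - \<omega> i))\<^sup>2 / (r i)\<^sup>2" for i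
    have "sum q I < 1"
      using nz unfolding F[OF \<omega>'] h_char[OF \<omega>'] by (simp add: f_def q_def max_def split: if_splits)
    have "\<omega>' i \<in> V i" if i: "i \<in> B" for i
    proof (cases "i \<in> I")
      case True
      have "q i \<le> sum q I"
        using V(1) True by (intro member_le_sum) (auto simp: I_def q_def)
      then have "q i < 1" using \<open>sum q I < 1\<close> by simp
      then have "(cmod (\<omega>' i - \<omega> i))\<^sup>2 < (r i)\<^sup>2" using r(1)[OF i] by (simp add: q_def)
      then have "cmod (\<omega>' i - \<omega> i) < r i" using r(1)[OF i] by (simp add: power2_less_imp_less)
      then show ?thesis using r(2)[OF i] by (auto simp: dist_norm norm_minus_commute)
    qed (use i in \<open>auto simp: I_def\<close>)
    moreover have "\<omega>' \<in> extensional B" using \<omega>' by (simp add: characters_def linear_functional_def)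
    ultimately have "\<omega>' \<in> PiE B V" by (auto simp: PiE_def)
    then show "\<omega>' \<in> T" using V(4) W(2) \<omega>' by blast
  qed
qed

text \<open>The element F u^n commutes with \<pi>(f) if and only if F annihilates u^n \<pi>(f) u^(-n) - \<pi>(f). Characters that do
  not vanish at F are fixed by u^n and vanish on this difference, and the characters of the
  commutative algebra B separate its points.\<close>

lemma mult_u_power_mem_B:
  assumes F: "F \<in> B" and fixed: "\<And>\<omega>. \<omega> \<in> characters B \<Longrightarrow> \<omega> F \<noteq> 0 \<Longrightarrow> (\<tau> ^^ n) \<omega> = \<omega>"
  shows "F * u ^ n \<in> B"
proof (rule B_I)
  have FC: "F \<in> C" using F B_subset by blast
  show "F * u ^ n \<in> C" by (intro C.mem FC u_mem)
  fix f
  define b where "b = u ^ n * \<pi> f * star u ^ n"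
  have b: "b \<in> B" unfolding b_def by (intro conj_u_power_mem_B \<pi>_mem_B)
  have "F * (b - \<pi> f) = 0"
  proof (rule ccontr)
    assume nz: "F * (b - \<pi> f) \<noteq> 0"
    have "F * (b - \<pi> f) \<in> B" by (intro B.mem F b \<pi>_mem_B)
    then obtain \<omega> where \<omega>: "\<omega> \<in> characters B" "\<omega> (F * (b - \<pi> f)) \<noteq> 0"
      using ex_character_nonzero[OF commutative_cstar_B _ nz] by blast
    interpret \<omega>: character B \<omega> using \<omega>(1) by unfold_locales
    have *: "\<omega> F * (\<omega> b - \<omega> (\<pi> f)) \<noteq> 0"
      using \<omega>(2) by (simp add: \<omega>.char_mult \<omega>.char_diff F b \<pi>_mem_B B.mem)
    then have "(\<tau> ^^ n) \<omega> = \<omega>" by (intro fixed \<omega>) auto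
    then have "\<omega> b = \<omega> (\<pi> f)" unfolding b_def using spectrum_map_fixed_iff[OF \<omega>(1)] \<pi>_mem_B by blast
    then show False using * by simp
  qed
  then have "F * b = F * \<pi> f" by (simp add: right_diff_distrib)
  moreover have "u ^ n * \<pi> f = b * u ^ n" by (simp add: b_def mult.assoc u_power_cancel)
  ultimately have "F * u ^ n * \<pi> f = F * \<pi> f * u ^ n" by (metis mult.assoc)
  then show "F * u ^ n * \<pi> f = \<pi> f * (F * u ^ n)" by (simp add: B_commute[OF F] mult.assoc)
qed

lemma aperiodic_or_interior_character:
  "\<omega> \<in> aperiodic_points Y \<tau> \<union> periodic_interior_points Y \<tau> \<Longrightarrow> \<omega> \<in> characters B"
  using interior_of_subset_topspace[of Y]
  by (auto simp: aperiodic_points_def periodic_interior_points_def)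

text \<open>By density it suffices to compare the two states on \<pi>(f) u^n, and by taking adjoints only n \<ge> 0 has to be
  considered. If u^n moves \<omega>, both values are 0; if it fixes \<omega>, both are computed inside B.\<close>

lemma state_extension_unique:
  assumes \<omega>: "\<omega> \<in> aperiodic_points Y \<tau> \<union> periodic_interior_points Y \<tau>"
    and \<phi>: "state C \<phi>" "\<And>b. b \<in> B \<Longrightarrow> \<phi> b = \<omega> b"
    and \<psi>: "state C \<psi>" "\<And>b. b \<in> B \<Longrightarrow> \<psi> b = \<omega> b" and c: "c \<in> C"
  shows "\<phi> c = \<psi> c"
proof -
  have char: "\<omega> \<in> characters B" by (rule aperiodic_or_interior_character[OF \<omega>])
  interpret \<omega>: character B \<omega> using char by unfold_locales
  interpret \<phi>: state_on C \<phi> using \<phi>(1) by unfold_locales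
  interpret \<psi>: state_on C \<psi> using \<psi>(1) by unfold_locales
  have \<phi>m: "\<phi> (x * b) = \<phi> x * \<omega> b" "\<phi> (b * x) = \<omega> b * \<phi> x" if "b \<in> B" "x \<in> C" for b x
    by (rule \<phi>.state_mult_character[OF cstar_subalgebra_B B_subset char \<phi>(2) that], assumption)+
  have \<psi>m: "\<psi> (x * b) = \<psi> x * \<omega> b" "\<psi> (b * x) = \<omega> b * \<psi> x" if "b \<in> B" "x \<in> C" for b x
    by (rule \<psi>.state_mult_character[OF cstar_subalgebra_B B_subset char \<psi>(2) that], assumption)+
  have nonneg: "\<phi> (\<pi> f * u ^ n) = \<psi> (\<pi> f * u ^ n)" for f n
  proof -
    define y where "y = \<pi> f * u ^ n"
    have y: "y \<in> C" unfolding y_def by (intro C.mem \<pi>_mem u_mem)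
    show ?thesis
    proof (cases "(\<tau> ^^ n) \<omega> = \<omega>")
      case False
      then obtain b where b: "b \<in> B" "\<omega> (u ^ n * b * star u ^ n) \<noteq> \<omega> b"
        using spectrum_map_fixed_iff[OF char] by blast
      define b' where "b' = u ^ n * b * star u ^ n"
      have b': "b' \<in> B" unfolding b'_def by (rule conj_u_power_mem_B[OF b(1)])
      \<comment> \<open>Evaluating \<open>y b = b' y\<close> gives \<open>\<omega>(b) \<phi>(y) = \<omega>(b') \<phi>(y)\<close>.\<close>
      have "y * b = \<pi> f * (b' * u ^ n)" by (simp add: y_def b'_def mult.assoc u_power_cancel)
      also have "\<dots> = b' * y" by (simp add: y_def B_commute[OF b'] flip: mult.assoc)
      finally have yb: "y * b = b' * y" .
      have "\<phi> y * \<omega> b = \<omega> b' * \<phi> y" "\<psi> y * \<omega> b = \<omega> b' * \<psi> y"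
        by (simp_all only: yb flip: \<phi>m[OF b(1) y] \<phi>m[OF b' y] \<psi>m[OF b(1) y] \<psi>m[OF b' y])
      then have "\<phi> y = 0" "\<psi> y = 0" using b(2) by (auto simp: b'_def mult.commute)
      then show ?thesis by (simp add: y_def)
    next
      case True
      show ?thesis
      proof (cases "n = 0")
        case True
        then show ?thesis using \<phi>(2) \<psi>(2) \<pi>_mem_B by simp
      next
        case False
        then have "n \<ge> 1" by simp
        with True have "\<omega> \<notin> aperiodic_points Y \<tau>" unfolding aperiodic_points_def by blast
        then have "\<omega> \<in> periodic_interior_points Y \<tau>" using \<omega> by blast
        then obtain k where k: "k \<ge> 1" and "\<omega> \<in> Y interior_of points_of_period Y \<tau> k"
          unfolding periodic_interior_points_def by blast
        then obtain T where T: "openin Y T" "\<omega> \<in> T" "T \<subseteq> points_of_period Y \<tau> k"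
          unfolding interior_of_def by blast
        have "k dvd n" using period_dvd[OF _ k True] T by blast
        obtain F where F: "F \<in> B" "\<omega> F = 1" "\<And>\<omega>'. \<omega>' \<in> characters B \<Longrightarrow> \<omega>' F \<noteq> 0 \<Longrightarrow> \<omega>' \<in> T"
          using openin_spectrum_bump[OF T(1,2)] by blast
        have "F * u ^ n \<in> B"
          using F T(3) period_dvd_fixed[OF _ \<open>k dvd n\<close>] by (intro mult_u_power_mem_B) blast+
        then have "\<pi> f * (F * u ^ n) \<in> B" by (rule B.mult_mem[OF \<pi>_mem_B])
        then have Fy: "F * y \<in> B" by (simp add: y_def B_commute[OF F(1)] flip: mult.assoc)
        have "\<phi> y = \<phi> (F * y)" "\<psi> y = \<psi> (F * y)"
          using \<phi>m(2)[OF F(1) y] \<psi>m(2)[OF F(1) y] F(2) by simp_all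
        then show ?thesis using \<phi>(2)[OF Fy] \<psi>(2)[OF Fy] by (simp add: y_def)
      qed
    qed
  qed
  have mono: "\<phi> g = \<psi> g" if g: "g \<in> monomials \<pi> u" for g
  proof -
    obtain f n where g: "g = \<pi> f * U n" using g by (auto simp: monomials_def)
    show ?thesis
    proof (cases "n \<ge> 0")
      case True
      then show ?thesis using nonneg[of f "nat n"] by (simp add: g unitary_power_def)
    next
      case False
      have "star g = U (- n) * \<pi> (star f)"
        by (simp add: g star_mult star_unitary_power \<pi>_simps(5))
      also have "\<dots> = \<pi> (cx_auto \<sigma> (- n) (star f)) * u ^ nat (- n)"
        using False by (simp add: U_\<pi>) (simp add: unitary_power_def)
      finally have "\<phi> (star g) = \<psi> (star g)" by (simp add: nonneg)
      moreover have "g \<in> C" unfolding g by (intro C.mem \<pi>_mem U_mem)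
      ultimately show ?thesis by (simp add: \<phi>.state_star \<psi>.state_star)
    qed
  qed
  have span: "x \<in> C \<and> \<phi> x = \<psi> x" if "x \<in> span (monomials \<pi> u)" for x
    using that
  proof (induction rule: span_induct_alt)
    case base
    show ?case using \<phi>.state_scaleR[OF C.one_mem, of 0] \<psi>.state_scaleR[OF C.one_mem, of 0] by (simp add: C.mem)
  next
    case (step r g x)
    then have "g \<in> C" by (auto simp: monomials_def intro!: C.mem \<pi>_mem U_mem)
    then show ?case
      using step mono[of g]
      by (simp add: \<phi>.state_add \<psi>.state_add \<phi>.state_scaleR \<psi>.state_scaleR C.mem)
  qed
  have "cmod (\<phi> c - \<psi> c) \<le> e" if "e > 0" for e
  proof -
    have "c \<in> closure (span (monomials \<pi> u))" using c C_subset_closure_monomials by blast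
    then obtain x where x: "x \<in> span (monomials \<pi> u)" "norm (c - x) < e / 2"
      using \<open>e > 0\<close> by (metis closure_approachable dist_norm half_gt_zero norm_minus_commute)
    have cx: "c - x \<in> C" using span[OF x(1)] c by (simp add: C.mem)
    have "\<phi> c - \<psi> c = \<phi> (c - x) - \<psi> (c - x)"
      using span[OF x(1)] c by (simp add: \<phi>.state_diff \<psi>.state_diff)
    also have "cmod \<dots> \<le> cmod (\<phi> (c - x)) + cmod (\<psi> (c - x))" by (rule norm_triangle_ineq4)
    also have "\<dots> \<le> norm (c - x) + norm (c - x)"
      by (intro add_mono \<phi>.norm_state_le \<psi>.norm_state_le cx)
    finally show ?thesis using x(2) by simp
  qed
  then have "cmod (\<phi> c - \<psi> c) \<le> 0" using field_le_epsilon[of "cmod (\<phi> c - \<psi> c)" 0] by simp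
  then show ?thesis by simp
qed

section \<open>The intersection property\<close>

lemma intersection_property_of_total:
  assumes total: "total_family C (Phi' A \<iota> \<delta> \<rho>)"
  shows "intersection_property C B"
  unfolding intersection_property_def
proof (intro allI impI, elim conjE, rule notI)
  fix J assume J: "two_sided_ideal C J" "J \<noteq> {0}" and JB: "J \<inter> B = {0}"
  have "0 \<in> J" using JB by blast
  then obtain j where j: "j \<in> J" "j \<noteq> 0" using J(2) by blast
  have jC: "j \<in> C" and jj: "star j * j \<in> J"
    using J(1) j(1) C.star_mem by (auto simp: two_sided_ideal_def)
  have "\<phi> (star j * j) = 0" if \<phi>: "\<phi> \<in> Phi' A \<iota> \<delta> \<rho>" for \<phi>
  proof -
    define \<omega> where "\<omega> = restrict \<phi> B"
    have pure: "pure_state C \<phi>" and \<omega>: "\<omega> \<in> aperiodic_points Y \<tau> \<union> periodic_interior_points Y \<tau>"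
      using \<phi> by (auto simp: Phi'_def Let_def \<omega>_def B_def C_def u_def)
    have char: "\<omega> \<in> characters B" by (rule aperiodic_or_interior_character[OF \<omega>])
    obtain \<psi> where \<psi>: "state C \<psi>" "\<And>b. b \<in> B \<Longrightarrow> \<psi> b = \<omega> b" "\<And>x. x \<in> J \<Longrightarrow> \<psi> x = 0"
      using ex_state_extension_vanishing_on_ideal[OF C.cstar_subalgebra_axioms
          cstar_subalgebra_B B_subset char J(1) JB] by blast
    have "\<phi> (star j * j) = \<psi> (star j * j)"
    proof (rule state_extension_unique[OF \<omega> _ _ \<psi>(1,2)])
      show "state C \<phi>" using pure by (simp add: pure_state_def)
      show "star j * j \<in> C" by (intro C.mem jC)
    qed (simp_all add: \<omega>_def)
    then show ?thesis using \<psi>(3) jj by simp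
  qed
  moreover have "star j * j \<in> positive_elements C" using jC by (auto simp: positive_elements_def)
  ultimately have "star j * j = 0" using total by (simp add: total_family_def)
  then show False using cstar_identity[of j] j(2) by simp
qed

end

theorem theorem4p3:
  fixes \<sigma> :: "'x::t2_space \<Rightarrow> 'x"
    and A :: "'a::cstar_algebra set"
    and \<iota> :: "('x \<Rightarrow>\<^sub>C complex) \<Rightarrow> 'a"
    and \<delta> :: 'a
    and \<rho> :: "'a \<Rightarrow> 'h::chilbert_space bounded_op"
  assumes "compact (UNIV :: 'x set)"
    and "homeomorphism UNIV UNIV \<sigma> (inv \<sigma>)"
    and "is_crossed_product \<sigma> A \<iota> \<delta>"
    and "unital_star_hom A \<rho>"
    and "total_family (\<rho> ` A) (Phi' A \<iota> \<delta> \<rho>)"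
  shows "intersection_property (\<rho> ` A) (rep_commutant A \<iota> \<rho>)"
proof -
  interpret crossed_product_rep \<sigma> A \<iota> \<delta> \<rho>
    using assms(1-4) by unfold_locales (auto simp: is_crossed_product_def)
  show ?thesis
    using intersection_property_of_total assms(5) unfolding C_def B_def by blast
qed

end
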